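(* Let $P_{2k}$ be a real-valued polynomial in $z_1,\bar z_1$ such that for some integer $k>1$, $P_{2k}(rz)=r^{2k}P_{2k}(z)$ for all $r\in\mathbb R,z\in\mathbb C$, and $\frac{\partial^2P_{2k}}{\partial z_1\partial\bar z_1}(z_1)>0$ for all $z_1\neq0$. Let $\Omega=\{(z_1,z_2)\in\mathbb C^2:\mathrm{Re}\, z_2+P_{2k}(z_1)<0\}$. Then for every boundary point $p\in\partial\Omega$ there is a holomorphic function $f_p:\Omega\to\Delta$ (with $\Delta$ the open unit disc) such that (1) $\lim_{z\to p}f_p(z)=1$, and (2) for every $r>0$ there exists $s>0$ with $|f_p(w)|<1-s$ for all $w\in\Omega\setminus B(p,r)$, where $B(p,r)$ is the Euclidean ball of radius $r$ centered at $p$. *)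

theory Defs
  imports "HOL-Analysis.Analysis"
begin

definition wpoly :: "nat \<Rightarrow> (nat \<Rightarrow> nat \<Rightarrow> complex) \<Rightarrow> complex \<Rightarrow> complex" where
  "wpoly N c z = (\<Sum>j\<le>N. \<Sum>l\<le>N. c j l * z ^ j * cnj z ^ l)"

text \<open>Its mixed Wirtinger derivative d^2/(dz dzbar), computed termwise.\<close>
definition wpoly_ddbar :: "nat \<Rightarrow> (nat \<Rightarrow> nat \<Rightarrow> complex) \<Rightarrow> complex \<Rightarrow> complex" where
  "wpoly_ddbar N c z = (\<Sum>j\<le>N. \<Sum>l\<le>N. of_nat (j * l) * c j l * z ^ (j - 1) * cnj z ^ (l - 1))"

definition holomorphic2_on :: "(complex \<times> complex \<Rightarrow> complex) \<Rightarrow> (complex \<times> complex) set \<Rightarrow> bool" where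
  "holomorphic2_on f S \<longleftrightarrow>
     (\<forall>z\<in>S. \<exists>a b. (f has_derivative (\<lambda>h. a * fst h + b * snd h)) (at z within S))"

definition model_domain :: "nat \<Rightarrow> (nat \<Rightarrow> nat \<Rightarrow> complex) \<Rightarrow> (complex \<times> complex) set" where
  "model_domain N c = {(z1, z2). Re z2 + Re (wpoly N c z1) < 0}"

end

theory Submission
  imports Defs "HOL-Complex_Analysis.Complex_Analysis"
begin

text \<open>
  Write \<open>P = Re (wpoly N c)\<close>. The proof rests on entire functions \<open>g\<close> of one variable with \<open>g a = 1\<close> and
  \<open>|g z| \<le> 4 exp (t (\<psi> z - \<psi> a))\<close>, for a strictly subharmonic polynomial weight \<open>\<psi>\<close> and large \<open>t\<close>.
  They are found by a continuity method on a disc. With a logarithmic barrier added, the weight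
  \<open>T |z|\<^sup>2\<close> has explicit functions of this kind. Moving along the segment from it to \<open>t \<psi>\<close> in small steps
  spoils the constant \<open>4\<close> to at most \<open>16\<close>. A Cauchy integral over a small circle around \<open>a\<close>, whose
  kernel is built from the functions already available at the points of that circle, restores the
  constant \<open>4\<close>: strict subharmonicity makes the correction exponentially small. Montel's theorem lets the
  disc exhaust the plane.

  At a boundary point \<open>(a, b)\<close> take \<open>\<psi> = P - \<epsilon> d\<close> with \<open>d \<ge> 0\<close> vanishing only at \<open>a\<close>, and
  \<open>t\<^sub>n = 2\<^sup>n t\<^sub>0\<close>. The functions \<open>exp (t\<^sub>n (z\<^sub>2 - b)) g\<^sub>n(z\<^sub>1)\<close>, times a factor decaying for large
  \<open>|Im z\<^sub>2|\<close>, are bounded holomorphic functions \<open>\<Phi>\<^sub>n\<close> with \<open>\<Phi>\<^sub>n(a, b) = 1\<close>. In terms of an anisotropic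
  distance \<open>\<sigma>\<close> to \<open>(a, b)\<close> they are close to \<open>1\<close> while \<open>t\<^sub>n \<sigma> < 1\<close> and small once \<open>t\<^sub>n \<sigma> > 1\<close>. In
  \<open>F = \<Sum>n. \<theta>\<^sup>n (1 - \<Phi>\<^sub>n)\<close> with \<open>\<theta> < 1\<close> close to \<open>1\<close> the terms with \<open>t\<^sub>n \<sigma> > 1\<close> dominate, whatever the
  bound of the \<open>\<Phi>\<^sub>n\<close> is; hence \<open>Re F > 0\<close> and \<open>exp (- F)\<close> is a peak function. The bound of the \<open>\<Phi>\<^sub>n\<close>
  cannot be taken to be \<open>1\<close> in general, as there need not be a holomorphic support function at \<open>(0, b)\<close>.
\<close>

section \<open>Holomorphic functions below a subharmonic weight\<close>

text \<open>The functions \<open>g\<close> do the work usually done by weighted L2 estimates for the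
  d-bar equation. One constant has to serve all peak points and all large \<open>t\<close>. Since 4
  is regained from 16 after every step, the number of steps does not enter the constant and may
  depend on \<open>t\<close> and on the disc. The barrier is there because no circle of fixed radius
  fits near the edge of a disc: its mixed derivative grows like the inverse square of the distance
  to the edge, which is what shrinking circles require, and it tends to 0 at every fixed point as
  the disc grows. On the boundary side the obstacle is the origin, where the mixed derivative of
  \<open>P\<close> vanishes, whereas \<open>kernel_bound_mixed\<close> asks for a lower bound
  comparable with the power \<open>2 * k - 2\<close> of \<open>1 + cmod z\<close>. For
  \<open>a \<noteq> 0\<close> a function \<open>d\<close> with negative mixed derivative at 0
  repairs this. For \<open>a = 0\<close>, where \<open>d\<close> is the power \<open>2 * k\<close>
  of \<open>cmod z\<close>, a small multiple of the squared modulus is added to the weight instead.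
  That spoils the bound by a factor depending on \<open>t\<close>, so only one \<open>t\<close> is
  used there, and dilations carry the resulting function to all other scales.\<close>

lemma difference_quotient_integral:
  fixes K :: "complex \<Rightarrow> complex"
  assumes "open S" "convex S" "K holomorphic_on S" "x \<in> S" "z \<in> S" "x \<noteq> z"
  shows "integral {0..1} (\<lambda>s. deriv K (z + of_real s * (x - z))) = (K x - K z) / (x - z)"
proof -
  have path: "path_image (linepath z x) \<subseteq> S"
    using assms by (simp add: closed_segment_subset)
  have "contour_integral (linepath z x) (deriv K) = K x - K z"
    using contour_integral_primitive[of S K "deriv K" "linepath z x"] assms path
      holomorphic_derivI[OF assms(3) assms(1)] contour_integral_unique
    by (metis at_within_open pathfinish_linepath pathstart_linepath valid_path_linepath)
  moreover have "contour_integral (linepath z x) (deriv K)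
      = integral {0..1} (\<lambda>s. deriv K (linepath z x s) * (x - z))"
    by (simp add: contour_integral_integral vector_derivative_linepath_at cong: integral_cong)
  moreover have "\<dots> = integral {0..1} (\<lambda>s. deriv K (z + of_real s * (x - z))) * (x - z)"
    by (subst integral_mult_left) (auto simp: linepath_def algebra_simps scaleR_conv_of_real)
  ultimately have "integral {0..1} (\<lambda>s. deriv K (z + of_real s * (x - z))) * (x - z) = K x - K z"
    by (simp only:)
  then show ?thesis using assms(6) by (simp add: eq_divide_eq)
qed

text \<open>The divided difference of \<open>K\<close> extends holomorphically in \<open>z\<close>
  across \<open>z = x\<close>, so its integral, unlike that of the Cauchy kernel, has no jump at the
  circle and defines one function on all of \<open>S\<close>. The extra term with \<open>K z\<close>
  is what becomes the error in \<open>kernel_improve\<close>.\<close>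

lemma circlepath_difference_quotient:
  fixes K q :: "complex \<Rightarrow> complex"
  assumes S: "open S" "convex S" and K: "K holomorphic_on S" and r: "r > 0"
    and sub: "sphere a r \<subseteq> S" and q: "continuous_on (sphere a r) q"
  obtains G where "G holomorphic_on S"
    "\<And>z. z \<in> S \<Longrightarrow> z \<notin> sphere a r \<Longrightarrow>
       G z = contour_integral (circlepath a r) (\<lambda>x. q x * ((K x - K z) / (x - z)))"
proof -
  \<comment> \<open>\<open>D\<close> is the divided difference written as a mean of
    \<open>deriv K\<close> over the segment from \<open>z\<close> to \<open>x\<close>, which makes
    sense for \<open>x = z\<close> too; convexity keeps the segment in \<open>S\<close>.
    Differentiating in \<open>z\<close> under the integral produces the factor \<open>1 - s\<close>
    in \<open>D2\<close>.\<close>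
  define D where "D = (\<lambda>x z. integral {0..1} (\<lambda>s. deriv K (z + of_real s * (x - z))))"
  define D2 where "D2 = (\<lambda>x z. integral {0..1}
      (\<lambda>s. of_real (1 - s) * deriv (deriv K) (z + of_real s * (x - z))))"
  have K1: "deriv K holomorphic_on S" using K S by (simp add: holomorphic_deriv)
  have K2: "deriv (deriv K) holomorphic_on S" using K1 S by (simp add: holomorphic_deriv)
  note c1 = holomorphic_on_imp_continuous_on[OF K1]
  note c2 = holomorphic_on_imp_continuous_on[OF K2]
  have seg: "z + of_real s * (x - z) \<in> S" if "x \<in> S" "z \<in> S" "s \<in> {0..1}" for x z and s :: real
  proof -
    have "(1 - s) *\<^sub>R z + s *\<^sub>R x \<in> S" using S(2) that by (simp add: convexD_alt)
    then show ?thesis by (simp add: algebra_simps scaleR_conv_of_real)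
  qed
  have contD: "continuous_on (S \<times> S) (\<lambda>u. D (fst u) (snd u))"
    unfolding D_def cbox_interval[symmetric] split_beta
    by (intro integral_continuous_on_param, unfold split_beta)
       (intro continuous_intros continuous_on_compose2[OF c1], auto intro!: seg)
  have contD2: "continuous_on (S \<times> S) (\<lambda>u. D2 (fst u) (snd u))"
    unfolding D2_def cbox_interval[symmetric] split_beta
    by (intro integral_continuous_on_param, unfold split_beta)
       (intro continuous_intros continuous_on_compose2[OF c2], auto intro!: seg)
  have derD: "(D x has_field_derivative D2 x z) (at z within S)" if "x \<in> S" "z \<in> S" for x z
    unfolding D_def D2_def cbox_interval[symmetric]
  proof (rule leibniz_rule_field_derivative)
    fix z' and s :: real assume "z' \<in> S" "s \<in> cbox 0 1"
    then have "z' + of_real s * (x - z') \<in> S" using seg that by auto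
    then have d: "(deriv K has_field_derivative deriv (deriv K) (z' + of_real s * (x - z')))
        (at (z' + of_real s * (x - z')))"
      using K1 S(1) holomorphic_derivI by blast
    show "((\<lambda>z. deriv K (z + of_real s * (x - z))) has_field_derivative
        of_real (1 - s) * deriv (deriv K) (z' + of_real s * (x - z'))) (at z' within S)"
      by (rule DERIV_cong, rule DERIV_chain2[where f = "deriv K" and g = "\<lambda>z. z + of_real s * (x - z)"], rule d)
         (auto intro!: derivative_eq_intros)
  next
    fix z' assume z': "z' \<in> S"
    show "(\<lambda>s. deriv K (z' + of_real s * (x - z'))) integrable_on cbox 0 (1::real)"
      by (intro integrable_continuous continuous_on_compose2[OF c1] continuous_intros)
         (use seg that z' in auto)
  next
    show "continuous_on (S \<times> cbox 0 (1::real))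
      (\<lambda>(z, s). of_real (1 - s) * deriv (deriv K) (z + of_real s * (x - z)))"
      unfolding split_beta
      by (intro continuous_intros continuous_on_compose2[OF c2]) (use seg that in auto)
  qed (use S that in auto)
  let ?g = "circlepath a r"
  define v where "v = (\<lambda>t. 2 * of_real pi * \<i> * of_real r * exp (2 * of_real pi * \<i> * of_real (t::real)))"
  define G where "G = (\<lambda>z. integral (cbox 0 1) (\<lambda>t. q (?g t) * D (?g t) z * v t))"
  have gs: "?g t \<in> sphere a r" for t
    using r by (simp add: circlepath dist_norm norm_mult)
  have gS: "?g t \<in> S" for t using gs sub by blast
  have cg: "continuous_on X ?g" for X
    unfolding circlepath by (intro continuous_intros)
  have cq: "continuous_on X (\<lambda>t. q (?g t))" for X
    by (rule continuous_on_compose2[OF q cg]) (use gs in blast)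
  have cv: "continuous_on X v" for X unfolding v_def by (intro continuous_intros)
  have "G holomorphic_on S"
    unfolding G_def
  proof (rule leibniz_rule_holomorphic)
    fix z and t :: real assume "z \<in> S"
    then show "((\<lambda>z. q (?g t) * D (?g t) z * v t) has_field_derivative q (?g t) * D2 (?g t) z * v t) (at z within S)"
      using derD[OF gS[of t], of z] by (auto intro!: derivative_eq_intros)
  next
    fix z assume z: "z \<in> S"
    have "continuous_on (cbox 0 1) (\<lambda>t. D (?g t) z)"
      using continuous_on_compose2[OF contD, of "cbox 0 1" "\<lambda>t. (?g t, z)"] gS z
        continuous_on_Pair[OF cg[of "cbox 0 1"] continuous_on_const[of _ z]]
      by auto
    then show "(\<lambda>t. q (?g t) * D (?g t) z * v t) integrable_on cbox 0 1"
      by (intro integrable_continuous continuous_intros cq cv)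
  next
    have "continuous_on (S \<times> cbox 0 (1::real)) (\<lambda>u. D2 (?g (snd u)) (fst u))"
      using continuous_on_compose2[OF contD2, of "S \<times> cbox 0 (1::real)" "\<lambda>u. (?g (snd u), fst u)"] gS
        continuous_on_Pair[OF continuous_on_compose2[OF cg continuous_on_snd[OF continuous_on_id] subset_UNIV]
          continuous_on_fst[OF continuous_on_id], of "S \<times> cbox 0 (1::real)"]
      by (simp add: image_subset_iff)
    moreover have "continuous_on (S \<times> cbox 0 (1::real)) (\<lambda>u. q (?g (snd u)))"
      by (rule continuous_on_compose2[OF cq]) (auto intro!: continuous_intros)
    moreover have "continuous_on (S \<times> cbox 0 (1::real)) (\<lambda>u. v (snd u))"
      by (rule continuous_on_compose2[OF cv]) (auto intro!: continuous_intros)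
    ultimately show "continuous_on (S \<times> cbox 0 (1::real)) (\<lambda>(z, t). q (?g t) * D2 (?g t) z * v t)"
      unfolding split_beta by (intro continuous_intros)
  qed (use S in auto)
  moreover have "G z = contour_integral ?g (\<lambda>x. q x * ((K x - K z) / (x - z)))"
    if "z \<in> S" "z \<notin> sphere a r" for z
  proof -
    have ne: "?g t \<noteq> z" for t using gs that(2) by metis
    have "contour_integral ?g (\<lambda>x. q x * ((K x - K z) / (x - z)))
      = integral {0..1} (\<lambda>t. q (?g t) * ((K (?g t) - K z) / (?g t - z)) * vector_derivative ?g (at t within {0..1}))"
      by (simp add: contour_integral_def has_contour_integral_def integral_def contour_integrable_on_def integrable_on_def)
    also have "\<dots> = G z"
      unfolding G_def cbox_interval
    proof (rule integral_cong)
      fix t :: real assume t: "t \<in> {0..1}"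
      have "D (?g t) z = (K (?g t) - K z) / (?g t - z)"
        unfolding D_def using difference_quotient_integral[OF S K gS that(1) ne] .
      then show "q (?g t) * ((K (?g t) - K z) / (?g t - z)) * vector_derivative ?g (at t within {0..1})
          = q (?g t) * D (?g t) z * v t"
        using t by (simp add: vector_derivative_circlepath01 v_def)
    qed
    finally show ?thesis by simp
  qed
  ultimately show ?thesis using that by blast
qed

section \<open>Peak functions with a weight bound, and the improvement of their constant\<close>

text \<open>The tolerance \<open>1 / 100\<close> makes circles around \<open>a\<close> almost level curves of \<open>\<phi> - Re h\<close>, as needed for
  the maximum principle on an annulus in \<open>kernel_improve\<close>.\<close>
definition round_at :: "(complex \<Rightarrow> real) \<Rightarrow> complex \<Rightarrow> real \<Rightarrow> real \<Rightarrow> bool" where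
  "round_at \<phi> a \<rho> m \<longleftrightarrow> (\<exists>h. h holomorphic_on ball a \<rho> \<and> h a = 0 \<and>
     (\<forall>z\<in>ball a \<rho>. \<bar>\<phi> z - \<phi> a - Re (h z) - m * (cmod (z - a))\<^sup>2\<bar> \<le> m * (cmod (z - a))\<^sup>2 / 100))"

text \<open>Such \<open>g\<close> behave like normalised Bergman kernels for the weight
  \<open>exp (- 2 * \<phi>)\<close>, with \<open>B\<close> uniform in the peak point. Adding the
  real part of a holomorphic function to \<open>\<phi>\<close> is harmless, as it only multiplies
  \<open>g\<close> by a zero-free holomorphic factor.\<close>

definition kernel_bound :: "complex set \<Rightarrow> (complex \<Rightarrow> real) \<Rightarrow> real \<Rightarrow> bool" where
  "kernel_bound S \<phi> B \<longleftrightarrow> (\<forall>a\<in>S. \<exists>g. g holomorphic_on S \<and> g a = 1 \<and>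
     (\<forall>z\<in>S. cmod (g z) \<le> B * exp (\<phi> z - \<phi> a)))"

text \<open>The peak functions are chosen point by point, with no continuity in the peak point, so
  they cannot be integrated over a curve directly. But \<open>K i\<close> stays above half of
  \<open>exp (\<phi> z - \<phi> i)\<close> near \<open>i\<close>; finitely many such neighbourhoods
  cover \<open>C\<close>, and continuous weights blend the corresponding \<open>K i\<close>. The
  blending costs the factor 2.\<close>

lemma kernel_cover:
  assumes S: "open S" and \<phi>: "continuous_on S \<phi>" and ker: "kernel_bound S \<phi> B" and B: "B > 0"
    and C: "compact C" "C \<subseteq> S"
  shows "\<exists>(I :: complex set) K p. finite I \<and> (\<forall>i\<in>I. K i holomorphic_on S) \<and> (\<forall>i\<in>I. continuous_on C (p i))
    \<and> (\<forall>x\<in>C. (\<Sum>i\<in>I. p i x * K i x) = 1)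
    \<and> (\<forall>x\<in>C. \<forall>z\<in>S. (\<Sum>i\<in>I. cmod (p i x) * cmod (K i z)) \<le> 2 * B * exp (\<phi> z - \<phi> x))"
proof -
  from ker obtain K where K: "\<And>i. i \<in> S \<Longrightarrow> K i holomorphic_on S" "\<And>i. i \<in> S \<Longrightarrow> K i i = 1"
     "\<And>i z. i \<in> S \<Longrightarrow> z \<in> S \<Longrightarrow> cmod (K i z) \<le> B * exp (\<phi> z - \<phi> i)"
    unfolding kernel_bound_def by metis
  define U where "U = (\<lambda>i. {z\<in>S. cmod (K i z) - exp (\<phi> z - \<phi> i) / 2 \<in> {0<..}})"
  have opU: "open (U i)" if "i \<in> S" for i
  proof -
    have "open (S \<inter> (\<lambda>z. cmod (K i z) - exp (\<phi> z - \<phi> i) / 2) -` {0<..})"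
      by (intro continuous_open_preimage S continuous_intros holomorphic_on_imp_continuous_on K \<phi> that) auto
    then show ?thesis by (simp add: U_def vimage_def Int_def)
  qed
  have inU: "i \<in> U i" if "i \<in> S" for i using that K(2) by (simp add: U_def)
  obtain I where I: "I \<subseteq> C" "finite I" "C \<subseteq> (\<Union>i\<in>I. U i)"
  proof (rule compactE_image[OF C(1), of C U])
    show "C \<subseteq> (\<Union>i\<in>C. U i)" using inU C(2) by auto
  qed (use opU C(2) in auto)
  have IS: "i \<in> S" if "i \<in> I" for i using I C that by blast
  define d where "d = (\<lambda>i x. max 0 (cmod (K i x) - exp (\<phi> x - \<phi> i) / 2))"
  define s where "s = (\<lambda>x. \<Sum>i\<in>I. d i x * cmod (K i x))"
  have d0: "d i x \<ge> 0" for i x by (simp add: d_def)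
  have spos: "s x > 0" if xC: "x \<in> C" for x
  proof -
    obtain j where j: "j \<in> I" "x \<in> U j" using I xC by blast
    then have "cmod (K j x) - exp (\<phi> x - \<phi> j) / 2 > 0" by (simp add: U_def)
    then have "d j x * cmod (K j x) > 0" unfolding d_def
      by (smt (verit) exp_gt_zero mult_pos_pos field_sum_of_halves)
    then show ?thesis unfolding s_def using j I(2) d0
      by (intro sum_pos2[where i = j]) auto
  qed
  \<comment> \<open>The cut-off \<open>d i\<close> is positive exactly where \<open>K i\<close>
    exceeds half of its expected size; the conjugate phase turns every product
    \<open>p i x * K i x\<close> into a nonnegative number, and \<open>s\<close> normalises their
    sum to 1.\<close>
  define p where "p = (\<lambda>i x. of_real (d i x / s x) * cnj (sgn (K i x)))"
  have cK: "continuous_on C (K i)" if "i \<in> I" for i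
    using K(1)[OF IS[OF that]] C(2) continuous_on_subset holomorphic_on_imp_continuous_on by blast
  have c\<phi>: "continuous_on C \<phi>" using \<phi> C(2) continuous_on_subset by blast
  have cd: "continuous_on C (d i)" if "i \<in> I" for i
    unfolding d_def by (intro continuous_intros cK c\<phi> that) auto
  have cs: "continuous_on C s" unfolding s_def by (intro continuous_intros cK cd) auto
  show ?thesis
  proof (intro exI conjI ballI)
    show "finite I" by (rule I(2))
  next
    show "K i holomorphic_on S" if "i \<in> I" for i using K IS that by blast
  next
    fix i assume i: "i \<in> I"
    \<comment> \<open>\<open>sgn\<close> is discontinuous at zeros of \<open>K i\<close>. Where
      \<open>d i\<close> does not vanish, the modulus equals its maximum with a positive continuous
      function; dividing by that maximum gives the same \<open>p i\<close> in a visibly continuous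
      form.\<close>
    have eq: "p i x = of_real (d i x / s x / max (cmod (K i x)) (exp (\<phi> x - \<phi> i) / 2)) * cnj (K i x)" for x
    proof (cases "d i x = 0")
      case False
      then have "max (cmod (K i x)) (exp (\<phi> x - \<phi> i) / 2) = cmod (K i x)" by (auto simp: d_def)
      then show ?thesis by (simp add: p_def sgn_eq divide_simps)
    qed (simp add: p_def)
    have "max (cmod (K i x)) (exp (\<phi> x - \<phi> i) / 2) > 0" for x by (simp add: less_max_iff_disj)
    then have "max (cmod (K i x)) (exp (\<phi> x - \<phi> i) / 2) \<noteq> 0" for x by (metis less_irrefl)
    then show "continuous_on C (p i)" unfolding eq
      using spos by (intro continuous_intros cK cd cs c\<phi> i) force+
  next
    fix x assume x: "x \<in> C"
    have "p i x * K i x = of_real (d i x * cmod (K i x) / s x)" for i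
    proof -
      have "cnj (sgn (K i x)) * K i x = of_real (cmod (K i x))"
        by (cases "K i x = 0") (auto simp: sgn_eq complex_norm_square[symmetric] mult.commute power2_eq_square)
      then show ?thesis by (simp add: p_def)
    qed
    then have "(\<Sum>i\<in>I. p i x * K i x) = of_real (\<Sum>i\<in>I. d i x * cmod (K i x) / s x)" by simp
    also have "\<dots> = 1" using spos[OF x] by (simp add: sum_divide_distrib[symmetric] s_def)
    finally show "(\<Sum>i\<in>I. p i x * K i x) = 1" .
  next
    fix x z assume x: "x \<in> C" and z: "z \<in> S"
    \<comment> \<open>Where \<open>d i x\<close> is positive,
      \<open>exp (\<phi> x - \<phi> i)\<close> is at most \<open>2 * cmod (K i x)\<close>. This
      trades the reference point \<open>i\<close> in the bound of \<open>K i z\<close> for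
      \<open>x\<close>.\<close>
    have le: "cmod (p i x) * cmod (K i z) \<le> (d i x * cmod (K i x) / s x) * (2 * B * exp (\<phi> z - \<phi> x))" if i: "i \<in> I" for i
    proof (cases "d i x = 0")
      case False
      then have *: "cmod (K i x) > exp (\<phi> x - \<phi> i) / 2" by (auto simp: d_def max_def split: if_splits)
      have "exp (\<phi> z - \<phi> i) = exp (\<phi> x - \<phi> i) * exp (\<phi> z - \<phi> x)" by (simp add: exp_add[symmetric])
      also have "\<dots> \<le> (2 * cmod (K i x)) * exp (\<phi> z - \<phi> x)" using * by (intro mult_right_mono) auto
      finally have "cmod (K i z) \<le> B * ((2 * cmod (K i x)) * exp (\<phi> z - \<phi> x))"
        using K(3)[OF IS[OF i] z] B by (smt (verit) mult_left_mono)
      then have "d i x / s x * cmod (K i z) \<le> d i x / s x * (B * ((2 * cmod (K i x)) * exp (\<phi> z - \<phi> x)))"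
        using spos[OF x] d0 by (intro mult_left_mono) (auto intro: divide_nonneg_pos)
      moreover have "cmod (p i x) = d i x / s x"
      proof -
        have "K i x \<noteq> 0" using * by (metis exp_ge_zero less_le_not_le norm_zero order_less_le_trans half_gt_zero_iff exp_gt_zero)
        then show ?thesis using d0 spos[OF x] by (simp add: p_def norm_mult norm_divide norm_sgn)
      qed
      ultimately show ?thesis by (simp add: algebra_simps)
    qed (simp add: p_def)
    have "(\<Sum>i\<in>I. cmod (p i x) * cmod (K i z)) \<le> (\<Sum>i\<in>I. (d i x * cmod (K i x) / s x) * (2 * B * exp (\<phi> z - \<phi> x)))"
      by (intro sum_mono le)
    also have "\<dots> = (\<Sum>i\<in>I. d i x * cmod (K i x) / s x) * (2 * B * exp (\<phi> z - \<phi> x))"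
      by (rule sum_distrib_right[symmetric])
    also have "(\<Sum>i\<in>I. d i x * cmod (K i x) / s x) = 1"
      using spos[OF x] by (simp add: sum_divide_distrib[symmetric] s_def)
    finally show "(\<Sum>i\<in>I. cmod (p i x) * cmod (K i z)) \<le> 2 * B * exp (\<phi> z - \<phi> x)" by simp
  qed
qed

text \<open>The sum \<open>G\<close> of Cauchy integrals below is \<open>exp h\<close> inside the circle and \<open>0\<close> outside, up to an error
  bounded by \<open>\<epsilon> exp (\<phi> z - \<phi> a)\<close> away from the circle; near the circle the maximum principle is
  applied to \<open>G exp (- h)\<close>.\<close>
lemma kernel_improve:
  assumes S: "open S" "convex S" and \<phi>: "continuous_on S \<phi>" and ker: "kernel_bound S \<phi> 16"
    and rd: "\<And>a. a \<in> S \<Longrightarrow> \<exists>r m. r > 0 \<and> ball a (2 * r) \<subseteq> S \<and> m * r\<^sup>2 \<ge> 40 \<and> round_at \<phi> a (2 * r) m"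
  shows "kernel_bound S \<phi> 4"
  unfolding kernel_bound_def
proof
  fix a assume aS: "a \<in> S"
  obtain r m where r: "r > 0" and sub: "ball a (2 * r) \<subseteq> S" and L40: "m * r\<^sup>2 \<ge> 40"
    and ra: "round_at \<phi> a (2 * r) m" using rd[OF aS] by blast
  obtain h where h: "h holomorphic_on ball a (2 * r)" "h a = 0"
     and hb: "\<And>z. z \<in> ball a (2 * r) \<Longrightarrow>
        \<bar>\<phi> z - \<phi> a - Re (h z) - m * (cmod (z - a))\<^sup>2\<bar> \<le> m * (cmod (z - a))\<^sup>2 / 100"
    using ra unfolding round_at_def by blast
  define L where "L = m * r\<^sup>2"
  have L: "L \<ge> 40" using L40 by (simp add: L_def)
  have m0: "m > 0" using L40 r by (smt (verit) mult_nonpos_nonneg zero_le_power2)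
  \<comment> \<open>Without \<open>Re h\<close> the weight is almost radial about \<open>a\<close>.
    \<open>L\<close> is the approximate value of \<open>D\<close> on the circle of radius
    \<open>r\<close>, and \<open>Dlo\<close>, \<open>Dhi\<close> compare \<open>D\<close> with
    \<open>L\<close> at radius \<open>c * r\<close>.\<close>
  define D where "D = (\<lambda>z. \<phi> z - \<phi> a - Re (h z))"
  have Dlo: "D z \<ge> 99/100 * (c\<^sup>2 * L)" if "cmod (z - a) \<ge> c * r" "z \<in> ball a (2 * r)" "c \<ge> 0" for z c
  proof -
    have "(c * r)\<^sup>2 \<le> (cmod (z - a))\<^sup>2" using that r by (intro power_mono) auto
    then have "m * (c * r)\<^sup>2 \<le> m * (cmod (z - a))\<^sup>2" using m0 by (intro mult_left_mono) auto
    moreover have "m * (c * r)\<^sup>2 = c\<^sup>2 * L" by (simp add: L_def power_mult_distrib)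
    ultimately show ?thesis using hb[OF that(2)] unfolding D_def by linarith
  qed
  have Dhi: "D z \<le> 101/100 * (c\<^sup>2 * L)" if "cmod (z - a) \<le> c * r" "z \<in> ball a (2 * r)" for z c
  proof -
    have "(cmod (z - a))\<^sup>2 \<le> (c * r)\<^sup>2" using that r by (intro power_mono) auto
    then have "m * (cmod (z - a))\<^sup>2 \<le> m * (c * r)\<^sup>2" using m0 by (intro mult_left_mono) auto
    moreover have "m * (c * r)\<^sup>2 = c\<^sup>2 * L" by (simp add: L_def power_mult_distrib)
    ultimately show ?thesis using hb[OF that(2)] unfolding D_def by linarith
  qed
  have D0: "D z \<ge> 0" if "z \<in> ball a (2 * r)" for z
    using Dlo[of 0 z] that r by simp
  define C where "C = sphere a r"
  have Csub: "C \<subseteq> ball a (2 * r)" using r by (auto simp: C_def)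
  have CS: "compact C" "C \<subseteq> S" using Csub sub by (auto simp: C_def)
  obtain I :: "complex set" and K p where I: "finite I" and *: "\<forall>i\<in>I. K i holomorphic_on S"
     "\<forall>i\<in>I. continuous_on C (p i)" "\<forall>x\<in>C. (\<Sum>i\<in>I. p i x * K i x) = 1"
     "\<forall>x\<in>C. \<forall>z\<in>S. (\<Sum>i\<in>I. cmod (p i x) * cmod (K i z)) \<le> 2 * 16 * exp (\<phi> z - \<phi> x)"
    using kernel_cover[OF S(1) \<phi> ker zero_less_numeral CS] by blast
  have K: "\<And>i. i \<in> I \<Longrightarrow> K i holomorphic_on S"
    and p: "\<And>i. i \<in> I \<Longrightarrow> continuous_on C (p i)"
    and one: "\<And>x. x \<in> C \<Longrightarrow> (\<Sum>i\<in>I. p i x * K i x) = 1"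
    and bd: "\<And>x z. x \<in> C \<Longrightarrow> z \<in> S \<Longrightarrow> (\<Sum>i\<in>I. cmod (p i x) * cmod (K i z)) \<le> 2 * 16 * exp (\<phi> z - \<phi> x)"
    using * by blast+
  have hC: "continuous_on C h"
    using h(1) Csub holomorphic_on_imp_continuous_on continuous_on_subset by blast
  define q where "q = (\<lambda>i x. p i x * exp (h x))"
  have q: "continuous_on C (q i)" if "i \<in> I" for i
    unfolding q_def by (intro continuous_intros p that hC)
  have "\<forall>i\<in>I. \<exists>G. G holomorphic_on S \<and> (\<forall>z\<in>S. z \<notin> C \<longrightarrow>
       G z = contour_integral (circlepath a r) (\<lambda>x. q i x * ((K i x - K i z) / (x - z))))"
  proof
    fix i assume i: "i \<in> I"
    show "\<exists>G. G holomorphic_on S \<and> (\<forall>z\<in>S. z \<notin> C \<longrightarrow>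
       G z = contour_integral (circlepath a r) (\<lambda>x. q i x * ((K i x - K i z) / (x - z))))"
      by (rule circlepath_difference_quotient[OF S K[OF i] r, of a "q i"])
         (use CS(2) q[OF i] in \<open>auto simp: C_def\<close>)
  qed
  then obtain H where H: "\<And>i. i \<in> I \<Longrightarrow> H i holomorphic_on S"
    and HH: "\<And>i z. i \<in> I \<Longrightarrow> z \<in> S \<Longrightarrow> z \<notin> C \<Longrightarrow>
       H i z = contour_integral (circlepath a r) (\<lambda>x. q i x * ((K i x - K i z) / (x - z)))"
    by metis
  define G where "G = (\<lambda>z. (\<Sum>i\<in>I. H i z) / (2 * of_real pi * \<i>))"
  have Ghol: "G holomorphic_on S" unfolding G_def by (intro holomorphic_intros H) auto
  \<comment> \<open>320 is 32 times 10: the factor \<open>2 * 16\<close> from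
    \<open>kernel_cover\<close>, and the reciprocal of the relative distance 1/10 kept from the
    circle. The exponent is the lower bound of \<open>D\<close> on the circle.\<close>
  define \<epsilon> where "\<epsilon> = 320 * exp (- (99/100 * L))"
  \<comment> \<open>Since the blended \<open>K i x\<close> sum to 1 on the circle, the integrands
    add up to the Cauchy kernel applied to \<open>exp h\<close>, with integral \<open>J\<close>,
    minus \<open>V\<close>. In \<open>V\<close> the bound \<open>exp (\<phi> z - \<phi> x)\<close>
    meets \<open>exp (Re (h x))\<close>, and the product is
    \<open>exp (\<phi> z - \<phi> a - D x)\<close>, small because \<open>D\<close> is about
    \<open>L\<close> on the circle.\<close>
  have key: "cmod (G z - J / (2 * of_real pi * \<i>)) \<le> \<epsilon> * exp (\<phi> z - \<phi> a)"
    if z: "z \<in> S" and far: "\<And>x. x \<in> C \<Longrightarrow> cmod (x - z) \<ge> r / 10"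
      and J: "((\<lambda>x. exp (h x) / (x - z)) has_contour_integral J) (circlepath a r)" for z J
  proof -
    have zC: "z \<notin> C" using far[of z] r by auto
    then have xz: "x \<noteq> z" if "x \<in> C" for x using that by blast
    have int1: "(\<lambda>x. q i x * ((K i x - K i z) / (x - z))) contour_integrable_on circlepath a r" if "i \<in> I" for i
      using CS(2) K[OF that, THEN holomorphic_on_imp_continuous_on] xz r
      by (intro contour_integrable_continuous_circlepath continuous_intros)
         (auto simp: C_def[symmetric] intro: q that continuous_on_subset)
    define V where "V = (\<lambda>x. (\<Sum>i\<in>I. p i x * K i z) * exp (h x) / (x - z))"
    have int2: "V contour_integrable_on circlepath a r"
      unfolding V_def using xz r
      by (intro contour_integrable_continuous_circlepath continuous_intros)
         (auto simp: C_def[symmetric] intro: p hC)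
    have "(\<Sum>i\<in>I. H i z) = (\<Sum>i\<in>I. contour_integral (circlepath a r) (\<lambda>x. q i x * ((K i x - K i z) / (x - z))))"
      using HH[OF _ z zC] by simp
    also have "\<dots> = contour_integral (circlepath a r) (\<lambda>x. \<Sum>i\<in>I. q i x * ((K i x - K i z) / (x - z)))"
      using contour_integral_sum[OF I int1] by simp
    also have "\<dots> = contour_integral (circlepath a r) (\<lambda>x. exp (h x) / (x - z) - V x)"
    proof (rule contour_integral_eq)
      fix x assume "x \<in> path_image (circlepath a r)"
      then have x: "x \<in> C" using r by (simp add: C_def)
      have "(\<Sum>i\<in>I. q i x * ((K i x - K i z) / (x - z)))
          = (\<Sum>i\<in>I. (p i x * K i x) * (exp (h x) / (x - z)) - (p i x * K i z) * (exp (h x) / (x - z)))"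
        by (intro sum.cong refl) (simp add: q_def algebra_simps diff_divide_distrib)
      also have "\<dots> = (\<Sum>i\<in>I. p i x * K i x) * (exp (h x) / (x - z)) - (\<Sum>i\<in>I. p i x * K i z) * (exp (h x) / (x - z))"
        by (simp only: sum_subtractf sum_distrib_right)
      finally show "(\<Sum>i\<in>I. q i x * ((K i x - K i z) / (x - z))) = exp (h x) / (x - z) - V x"
        using one[OF x] by (simp add: V_def)
    qed
    also have "\<dots> = J - contour_integral (circlepath a r) V"
      using has_contour_integral_diff[OF J has_contour_integral_integral[OF int2]] contour_integral_unique by blast
    finally have eq: "G z - J / (2 * of_real pi * \<i>) = - (contour_integral (circlepath a r) V / (2 * of_real pi * \<i>))"
      by (simp add: G_def diff_divide_distrib)
    define b where "b = 320 / r * exp (\<phi> z - \<phi> a - 99/100 * L)"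
    have "cmod (contour_integral (circlepath a r) V) \<le> b * (2 * pi * r)"
    proof (rule has_contour_integral_bound_circlepath[OF has_contour_integral_integral[OF int2]])
      show "0 \<le> b" "0 < r" using r by (auto simp: b_def)
      fix x assume "cmod (x - a) = r"
      then have x: "x \<in> C" by (simp add: C_def dist_norm norm_minus_commute)
      have "cmod (\<Sum>i\<in>I. p i x * K i z) \<le> 32 * exp (\<phi> z - \<phi> x)"
        using bd[OF x z] norm_sum[of "\<lambda>i. p i x * K i z" I] by (simp add: norm_mult)
      then have "cmod (V x) \<le> 32 * exp (\<phi> z - \<phi> x) * exp (Re (h x)) / (r / 10)"
        unfolding V_def norm_divide norm_mult using far[OF x] r
        by (intro frac_le mult_mono) auto
      also have "\<dots> = 320 / r * exp (\<phi> z - \<phi> a - D x)"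
        by (simp add: exp_add[symmetric] D_def algebra_simps)
      also have "\<dots> \<le> b"
      proof -
        have "D x \<ge> 99/100 * L" using Dlo[of 1 x] x Csub by (auto simp: C_def dist_norm norm_minus_commute)
        then show ?thesis unfolding b_def using r by (intro mult_left_mono) auto
      qed
      finally show "cmod (V x) \<le> b" .
    qed
    then have "cmod (G z - J / (2 * of_real pi * \<i>)) \<le> b * (2 * pi * r) / (2 * pi)"
      unfolding eq by (simp add: norm_divide norm_mult field_simps)
    also have "\<dots> = \<epsilon> * exp (\<phi> z - \<phi> a)"
    proof -
      have "exp (\<phi> z - \<phi> a - 99/100 * L) = exp (- (99/100 * L)) * exp (\<phi> z - \<phi> a)"
        by (simp add: exp_add[symmetric])
      then show ?thesis using r by (simp add: b_def \<epsilon>_def)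
    qed
    finally show ?thesis .
  qed
  have din: "cmod (x - z) \<ge> r / 10" if "x \<in> C" "cmod (z - a) \<le> 9/10 * r \<or> cmod (z - a) \<ge> 11/10 * r" for x z
  proof -
    have "cmod (x - a) = r" using that(1) by (simp add: C_def dist_norm norm_minus_commute)
    moreover have "cmod (x - a) \<le> cmod (x - z) + cmod (z - a)" "cmod (z - a) \<le> cmod (x - z) + cmod (x - a)"
      using norm_triangle_ineq[of "x - z" "z - a"] norm_triangle_ineq[of "z - x" "x - a"]
      by (auto simp: norm_minus_commute)
    ultimately show ?thesis using that(2) by auto
  qed
  have exph: "(\<lambda>x. exp (h x)) holomorphic_on ball a (2 * r)" by (intro holomorphic_intros h)
  have inside: "cmod (G z - exp (h z)) \<le> \<epsilon> * exp (\<phi> z - \<phi> a)" if z: "cmod (z - a) \<le> 9/10 * r" for z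
  proof -
    have "z \<in> S" using that sub r by (auto simp: dist_norm norm_minus_commute subset_iff)
    moreover have "((\<lambda>x. exp (h x) / (x - z)) has_contour_integral (2 * of_real pi * \<i> * exp (h z))) (circlepath a r)"
      using r that by (intro Cauchy_integral_circlepath_simple holomorphic_on_subset[OF exph]) auto
    ultimately show ?thesis using key[of z "2 * of_real pi * \<i> * exp (h z)"] din that by simp
  qed
  have outside: "cmod (G z) \<le> \<epsilon> * exp (\<phi> z - \<phi> a)" if z: "z \<in> S" "cmod (z - a) \<ge> 11/10 * r" for z
  proof -
    have "((\<lambda>x. exp (h x) / (x - z)) has_contour_integral 0) (circlepath a r)"
    proof (rule Cauchy_theorem_convex_simple[of _ "ball a (11/10 * r)"])
      show "(\<lambda>x. exp (h x) / (x - z)) holomorphic_on ball a (11/10 * r)"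
        using that r by (intro holomorphic_intros holomorphic_on_subset[OF exph])
          (auto simp: dist_norm norm_minus_commute)
    qed (use r in \<open>auto simp: dist_norm\<close>)
    then show ?thesis using key[of z 0] din that by simp
  qed
  \<comment> \<open>\<open>L \<ge> 40\<close> gives \<open>Y \<ge> 2 ^ 10\<close>, enough to absorb
    the factor 320 twice: in \<open>\<epsilon> \<le> 1 / 2\<close> and in
    \<open>1 + 320 * Y \<le> Y\<^sup>2\<close>.\<close>
  define Y where "Y = exp (L / 4)"
  have Y: "Y \<ge> 1024"
  proof -
    have "(2::real) ^ 10 \<le> exp 1 ^ 10" using exp_ge_add_one_self[of 1] by (intro power_mono) auto
    also have "\<dots> = exp 10" by (simp add: exp_of_nat_mult[symmetric])
    also have "\<dots> \<le> Y" using L by (simp add: Y_def)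
    finally show ?thesis by simp
  qed
  have eps: "\<epsilon> \<le> 1 / 2"
  proof -
    have "\<epsilon> \<le> 320 * exp (- (L / 4))" using L by (simp add: \<epsilon>_def)
    also have "\<dots> = 320 / Y" by (simp add: Y_def exp_minus inverse_eq_divide)
    also have "\<dots> \<le> 1/2" using Y by (simp add: divide_simps)
    finally show ?thesis .
  qed
  have Dexp: "exp (\<phi> z - \<phi> a) = exp (D z) * exp (Re (h z))" for z
    by (simp add: D_def exp_add[symmetric])
  have annulus: "cmod (G z) \<le> exp (\<phi> z - \<phi> a)" if z: "9/10 * r < cmod (z - a)" "cmod (z - a) < 11/10 * r" for z
  proof -
    define A where "A = cball a (11/10 * r) - ball a (9/10 * r)"
    have A2: "A \<subseteq> ball a (2 * r)" using r by (auto simp: A_def)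
    have clA: "closed A" unfolding A_def by (intro closed_Diff) auto
    have hol: "(\<lambda>z. G z * exp (- h z)) holomorphic_on ball a (2 * r)"
      by (intro holomorphic_intros holomorphic_on_subset[OF Ghol] sub h)
    have "cmod (G z * exp (- h z)) \<le> Y\<^sup>2"
    proof (rule maximum_modulus_frontier[of "\<lambda>z. G z * exp (- h z)" A])
      show "(\<lambda>z. G z * exp (- h z)) holomorphic_on interior A"
        using hol A2 holomorphic_on_subset interior_subset by blast
      show "continuous_on (closure A) (\<lambda>z. G z * exp (- h z))"
        using hol A2 clA holomorphic_on_imp_continuous_on continuous_on_subset by (metis closure_closed)
      show "bounded A" unfolding A_def by (intro bounded_diff) auto
      show "z \<in> A" using z by (auto simp: A_def dist_norm norm_minus_commute)
    next
      fix u assume u: "u \<in> frontier A"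
      have "ball a (11/10 * r) - cball a (9/10 * r) \<subseteq> interior A"
        by (rule interior_maximal) (auto simp: A_def intro!: open_Diff)
      then have "u \<in> A" "u \<notin> ball a (11/10 * r) - cball a (9/10 * r)"
        using u clA by (auto simp: frontier_def)
      then have "cmod (u - a) = 9/10 * r \<or> cmod (u - a) = 11/10 * r"
        by (auto simp: A_def dist_norm norm_minus_commute)
      then have c: "cmod (u - a) \<le> 9/10 * r \<or> cmod (u - a) \<ge> 11/10 * r" and hi: "cmod (u - a) \<le> 11/10 * r"
        using r by auto
      have u2: "u \<in> ball a (2 * r)" using \<open>u \<in> A\<close> A2 by blast
      have "D u \<le> 101/100 * ((11/10)\<^sup>2 * L)" by (rule Dhi[OF hi u2])
      \<comment> \<open>The numerical core of the choice of tolerance and radii: 1.01 times 1.21 is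
        1.2221, below 0.99 + 0.25.\<close>
      also have "\<dots> \<le> 99/100 * L + L / 4" using L by (simp add: power2_eq_square)
      finally have Du: "\<epsilon> * exp (D u) \<le> 320 * Y"
        by (simp add: \<epsilon>_def Y_def exp_add[symmetric])
      have "cmod (G u) \<le> exp (Re (h u)) + \<epsilon> * exp (\<phi> u - \<phi> a)"
        using c
      proof
        assume "cmod (u - a) \<le> 9/10 * r"
        from inside[OF this] show ?thesis
          using norm_triangle_ineq[of "G u - exp (h u)" "exp (h u)"] by simp
      next
        assume "cmod (u - a) \<ge> 11/10 * r"
        from outside[OF _ this] show ?thesis using u2 sub by (smt (verit) exp_ge_zero subsetD)
      qed
      also have "\<dots> = (1 + \<epsilon> * exp (D u)) * exp (Re (h u))" by (simp add: Dexp algebra_simps)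
      also have "\<dots> \<le> Y\<^sup>2 * exp (Re (h u))"
        using Du Y by (intro mult_right_mono) (auto simp: power2_eq_square intro: order_trans[of _ "1 + 320 * Y"] order_trans[OF _ mult_right_mono[of 1024 Y Y]])
      finally have "cmod (G u) * exp (- Re (h u)) \<le> Y\<^sup>2 * exp (Re (h u)) * exp (- Re (h u))"
        by (intro mult_right_mono) auto
      then show "cmod (G u * exp (- h u)) \<le> Y\<^sup>2" by (simp add: norm_mult mult.assoc exp_add[symmetric])
    qed
    also have "Y\<^sup>2 = exp (L / 2)" by (simp add: Y_def power2_eq_square exp_add[symmetric])
    \<comment> \<open>On the annulus \<open>D\<close> is at least 0.99 times 0.81 times
      \<open>L\<close>, more than the \<open>L / 2\<close> in the bound from the two boundary
      circles.\<close>
    also have "\<dots> \<le> exp (D z)"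
      using Dlo[of "9/10" z] z L r by (auto simp: dist_norm norm_minus_commute power2_eq_square)
    finally have "cmod (G z) * exp (- Re (h z)) * exp (Re (h z)) \<le> exp (D z) * exp (Re (h z))"
      by (intro mult_right_mono) (auto simp: norm_mult)
    then show ?thesis by (simp add: Dexp mult.assoc exp_add[symmetric])
  qed
  have all: "cmod (G z) \<le> 2 * exp (\<phi> z - \<phi> a)" if "z \<in> S" for z
  proof -
    consider "cmod (z - a) \<le> 9/10 * r" | "cmod (z - a) \<ge> 11/10 * r" | "9/10 * r < cmod (z - a)" "cmod (z - a) < 11/10 * r"
      by linarith
    then show ?thesis
    proof cases
      case 1
      then have "z \<in> ball a (2 * r)" using r by (simp add: dist_norm norm_minus_commute)
      then have "exp (Re (h z)) \<le> exp (\<phi> z - \<phi> a)" using D0[of z] by (simp add: D_def)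
      moreover have "cmod (G z) \<le> exp (Re (h z)) + \<epsilon> * exp (\<phi> z - \<phi> a)"
        using inside[OF 1] norm_triangle_ineq[of "G z - exp (h z)" "exp (h z)"] by simp
      moreover have "\<epsilon> * exp (\<phi> z - \<phi> a) \<le> 1/2 * exp (\<phi> z - \<phi> a)" using eps by (intro mult_right_mono) auto
      ultimately show ?thesis using exp_gt_zero[of "\<phi> z - \<phi> a"] by linarith
    next
      case 2
      moreover have "\<epsilon> * exp (\<phi> z - \<phi> a) \<le> 1/2 * exp (\<phi> z - \<phi> a)" using eps by (intro mult_right_mono) auto
      ultimately show ?thesis using outside[OF that 2] exp_gt_zero[of "\<phi> z - \<phi> a"] by linarith
    next
      case 3
      then show ?thesis using annulus[OF 3] exp_gt_zero[of "\<phi> z - \<phi> a"] by linarith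
    qed
  qed
  \<comment> \<open>The final constant is the quotient of the bound 2 for \<open>G\<close> by this
    lower bound 1/2 at \<open>a\<close>.\<close>
  have "cmod (G a - 1) \<le> 1 / 2" using inside[of a] r eps h(2) by simp
  then have Ga: "cmod (G a) \<ge> 1 / 2" using norm_triangle_ineq2[of 1 "1 - G a"] by (simp add: norm_minus_commute)
  show "\<exists>g. g holomorphic_on S \<and> g a = 1 \<and> (\<forall>z\<in>S. cmod (g z) \<le> 4 * exp (\<phi> z - \<phi> a))"
  proof (intro exI conjI ballI)
    show "(\<lambda>z. G z / G a) holomorphic_on S" using Ga by (intro holomorphic_intros Ghol) auto
    show "G a / G a = 1" using Ga by auto
    fix z assume "z \<in> S"
    have "cmod (G z / G a) \<le> 2 * exp (\<phi> z - \<phi> a) / (1/2)"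
      unfolding norm_divide using all[OF \<open>z \<in> S\<close>] Ga by (intro frac_le) auto
    then show "cmod (G z / G a) \<le> 4 * exp (\<phi> z - \<phi> a)" by simp
  qed
qed

section \<open>Roundness of sums, and the logarithmic barrier on a disc\<close>

lemma round_at_add:
  assumes "round_at \<phi> a \<rho> m" "round_at \<psi> a \<rho> n"
  shows "round_at (\<lambda>z. \<phi> z + \<psi> z) a \<rho> (m + n)"
proof -
  obtain h k where h: "h holomorphic_on ball a \<rho>" "h a = 0"
     "\<And>z. z \<in> ball a \<rho> \<Longrightarrow> \<bar>\<phi> z - \<phi> a - Re (h z) - m * (cmod (z - a))\<^sup>2\<bar> \<le> m * (cmod (z - a))\<^sup>2 / 100"
   and k: "k holomorphic_on ball a \<rho>" "k a = 0"
     "\<And>z. z \<in> ball a \<rho> \<Longrightarrow> \<bar>\<psi> z - \<psi> a - Re (k z) - n * (cmod (z - a))\<^sup>2\<bar> \<le> n * (cmod (z - a))\<^sup>2 / 100"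
    using assms unfolding round_at_def by metis
  show ?thesis
    unfolding round_at_def
  proof (intro exI[of _ "\<lambda>z. h z + k z"] conjI ballI)
    fix z assume "z \<in> ball a \<rho>"
    from h(3)[OF this] k(3)[OF this]
    show "\<bar>\<phi> z + \<psi> z - (\<phi> a + \<psi> a) - Re (h z + k z) - (m + n) * (cmod (z - a))\<^sup>2\<bar>
          \<le> (m + n) * (cmod (z - a))\<^sup>2 / 100"
      unfolding distrib_right plus_complex.sel add_divide_distrib by linarith
  qed (use h k in \<open>auto intro!: holomorphic_intros\<close>)
qed

lemma round_at_scale:
  assumes "round_at \<phi> a \<rho> m" "c \<ge> 0"
  shows "round_at (\<lambda>z. c * \<phi> z) a \<rho> (c * m)"
proof -
  obtain h where h: "h holomorphic_on ball a \<rho>" "h a = 0"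
     "\<And>z. z \<in> ball a \<rho> \<Longrightarrow> \<bar>\<phi> z - \<phi> a - Re (h z) - m * (cmod (z - a))\<^sup>2\<bar> \<le> m * (cmod (z - a))\<^sup>2 / 100"
    using assms unfolding round_at_def by metis
  show ?thesis
    unfolding round_at_def
  proof (intro exI[of _ "\<lambda>z. of_real c * h z"] conjI ballI)
    fix z assume "z \<in> ball a \<rho>"
    from mult_left_mono[OF h(3)[OF this] assms(2)]
    have "\<bar>c * (\<phi> z - \<phi> a - Re (h z) - m * (cmod (z - a))\<^sup>2)\<bar> \<le> c * (m * (cmod (z - a))\<^sup>2 / 100)"
      using assms(2) by (simp add: abs_mult)
    then show "\<bar>c * \<phi> z - c * \<phi> a - Re (of_real c * h z) - c * m * (cmod (z - a))\<^sup>2\<bar>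
          \<le> c * m * (cmod (z - a))\<^sup>2 / 100"
      by (simp add: algebra_simps)
  qed (use h in \<open>auto intro!: holomorphic_intros\<close>)
qed

lemma round_at_mono:
  assumes "round_at \<phi> a \<rho> m" "\<rho>' \<le> \<rho>"
  shows "round_at \<phi> a \<rho>' m"
proof -
  have "ball a \<rho>' \<subseteq> ball a \<rho>" using assms(2) by auto
  then show ?thesis using assms(1) unfolding round_at_def
    by (meson holomorphic_on_subset subset_eq)
qed

lemma round_at_norm_square: "round_at (\<lambda>z. (cmod z)\<^sup>2) a \<rho> 1"
  unfolding round_at_def
proof (intro exI[of _ "\<lambda>z. 2 * cnj a * (z - a)"] conjI ballI)
  fix z
  have "(cmod z)\<^sup>2 - (cmod a)\<^sup>2 - Re (2 * cnj a * (z - a)) = (cmod (z - a))\<^sup>2"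
    unfolding cmod_power2 by (simp add: algebra_simps power2_eq_square)
  then show "\<bar>(cmod z)\<^sup>2 - (cmod a)\<^sup>2 - Re (2 * cnj a * (z - a)) - 1 * (cmod (z - a))\<^sup>2\<bar>
      \<le> 1 * (cmod (z - a))\<^sup>2 / 100"
    by (simp only:) simp
qed (auto intro!: holomorphic_intros)

text \<open>Up to a factor, a potential of the hyperbolic metric on the disc of radius
  \<open>R\<close>. Its weighted kernels are explicit, and it tends to 0 at fixed \<open>z\<close>
  as \<open>R\<close> grows.\<close>

definition barrier :: "real \<Rightarrow> complex \<Rightarrow> real" where
  "barrier R z = - ln (1 - (cmod z / R)\<^sup>2)"

text \<open>Divided by the left side, this is the formula for 1 minus the squared modulus of
  \<open>R * (z - a) / (R\<^sup>2 - z * cnj a)\<close>, which for \<open>a\<close> in the disc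
  carries the disc of radius \<open>R\<close> to the unit disc and \<open>a\<close> to 0.\<close>

lemma disc_identity:
  "(cmod (of_real (R\<^sup>2) - z * cnj a))\<^sup>2 = R\<^sup>2 * (cmod (z - a))\<^sup>2 + (R\<^sup>2 - (cmod z)\<^sup>2) * (R\<^sup>2 - (cmod a)\<^sup>2)"
  unfolding cmod_power2 by (simp add: algebra_simps power2_eq_square)

lemma barrier_diff:
  assumes "R > 0" "cmod a < R" "cmod z < R"
  shows "barrier R z - barrier R a = ln ((R\<^sup>2 - (cmod a)\<^sup>2) / (R\<^sup>2 - (cmod z)\<^sup>2))"
proof -
  have pos: "R\<^sup>2 - (cmod a)\<^sup>2 > 0" "R\<^sup>2 - (cmod z)\<^sup>2 > 0"
    using assms by (auto intro!: power_strict_mono)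
  have eq: "1 - (cmod u / R)\<^sup>2 = (R\<^sup>2 - (cmod u)\<^sup>2) / R\<^sup>2" for u
    using assms(1) by (simp add: power_divide diff_divide_distrib)
  have "ln ((R\<^sup>2 - (cmod u)\<^sup>2) / R\<^sup>2) = ln (R\<^sup>2 - (cmod u)\<^sup>2) - ln (R\<^sup>2)" if "R\<^sup>2 - (cmod u)\<^sup>2 > 0" for u
    using that assms(1) by (intro ln_divide_pos) auto
  then show ?thesis using pos ln_divide_pos[of "R\<^sup>2 - (cmod a)\<^sup>2" "R\<^sup>2 - (cmod z)\<^sup>2"] unfolding barrier_def eq by simp
qed

text \<open>By \<open>disc_identity\<close>, \<open>R\<^sup>2 - (cmod z)\<^sup>2\<close> equals
  \<open>s * v * (1 - y)\<close> with \<open>v = (cmod (1 - u z))\<^sup>2\<close> and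
  \<open>y = x / v\<close>, where \<open>x\<close> is the quadratic main term. The logarithm of
  \<open>v\<close> is harmonic and is removed by \<open>h = - 2 * Ln (1 - u z)\<close>. What remains
  is \<open>- ln (1 - y)\<close>; the bound on \<open>\<rho>\<close> forces
  \<open>cmod (u z) \<le> 1 / 1000\<close>, so that this is within one percent of
  \<open>x\<close>.\<close>

lemma round_at_barrier:
  assumes R: "R > 0" and a: "cmod a < R" and \<rho>: "\<rho> \<le> (R - cmod a) / 1000"
  shows "round_at (barrier R) a \<rho> (R\<^sup>2 / (R\<^sup>2 - (cmod a)\<^sup>2)\<^sup>2)"
proof -
  define s where "s = R\<^sup>2 - (cmod a)\<^sup>2"
  have s_eq: "s = (R - cmod a) * (R + cmod a)" by (simp add: s_def power2_eq_square algebra_simps)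
  have s_ge: "s \<ge> (R - cmod a) * R" unfolding s_eq using a by (intro mult_left_mono) auto
  have s: "s > 0" using s_ge a R by (smt (verit) mult_pos_pos)
  define u where "u = (\<lambda>z. cnj a * (z - a) / of_real s)"
  have w_le: "cmod (z - a) * 1000 \<le> R - cmod a" if "z \<in> ball a \<rho>" for z
    using that \<rho> by (simp add: dist_norm norm_minus_commute)
  have u_le: "cmod (u z) \<le> 1/1000" if z: "z \<in> ball a \<rho>" for z
  proof -
    have "cmod a * (cmod (z - a) * 1000) \<le> R * (R - cmod a)"
      using a R w_le[OF z] by (intro mult_mono) auto
    then have "cmod a * cmod (z - a) * 1000 \<le> s" using s_ge by (simp add: algebra_simps)
    then show ?thesis using s by (simp add: u_def norm_divide norm_mult divide_simps)
  qed
  show ?thesis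
    unfolding round_at_def
  proof (intro exI[of _ "\<lambda>z. - 2 * Ln (1 - u z)"] conjI ballI)
    have "1 - u z \<notin> \<real>\<^sub>\<le>\<^sub>0" if "z \<in> ball a \<rho>" for z
    proof -
      have "Re (1 - u z) > 0" using u_le[OF that] complex_Re_le_cmod[of "u z"] by simp
      then show ?thesis by (auto simp: complex_nonpos_Reals_iff)
    qed
    moreover have "u holomorphic_on ball a \<rho>"
      unfolding u_def by (intro holomorphic_intros) (use s in auto)
    ultimately show "(\<lambda>z. - 2 * Ln (1 - u z)) holomorphic_on ball a \<rho>"
      by (intro holomorphic_intros)
    show "- 2 * Ln (1 - u a) = 0" by (simp add: u_def)
  next
    fix z assume z: "z \<in> ball a \<rho>"
    define x where "x = R\<^sup>2 / s\<^sup>2 * (cmod (z - a))\<^sup>2"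
    define v where "v = (cmod (1 - u z))\<^sup>2"
    have c1: "cmod (1 - u z) \<ge> 999/1000" "cmod (1 - u z) \<le> 1001/1000"
      using u_le[OF z] norm_triangle_ineq2[of 1 "u z"] norm_triangle_ineq4[of 1 "u z"] by auto
    have v1: "v \<ge> 998/1000" using power_mono[OF c1(1), of 2] by (simp add: v_def power2_eq_square)
    have v2: "v \<le> 1003/1000" using power_mono[OF c1(2), of 2] by (simp add: v_def power2_eq_square)
    have x0: "x \<ge> 0" by (simp add: x_def)
    have x1: "x \<le> 1/1000000"
    proof -
      have "R * (cmod (z - a) * 1000) \<le> s"
        using s_ge w_le[OF z] R by (smt (verit) mult_left_mono mult.commute)
      then have "(R * (cmod (z - a) * 1000))\<^sup>2 \<le> s\<^sup>2" using R by (intro power_mono) auto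
      then have "R\<^sup>2 * (cmod (z - a))\<^sup>2 * 1000000 \<le> s\<^sup>2" by (simp add: power_mult_distrib)
      then show ?thesis using s by (simp add: x_def divide_simps)
    qed
    define y where "y = x / v"
    have vpos: "v > 0" using v1 by simp
    have y0: "y \<ge> 0" using x0 vpos by (simp add: y_def)
    have ylo: "y \<ge> x * (997/1000)"
    proof -
      have "x * v \<le> x * (1003/1000)" using x0 v2 by (intro mult_left_mono) auto
      moreover have "x * (997/1000) * v = 997/1000 * (x * v)" by simp
      ultimately have "x * (997/1000) * v \<le> x" using x0 by linarith
      then show ?thesis using vpos by (simp add: y_def pos_le_divide_eq)
    qed
    have yhi: "y \<le> x * (1003/1000)"
      using x0 v1 vpos mult_left_mono[of "998/1000" v x] by (simp add: y_def divide_simps)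
    have zR: "cmod z < R" using w_le[OF z] norm_triangle_ineq[of a "z - a"] a by simp
    have e1: "of_real (R\<^sup>2) - z * cnj a = of_real s * (1 - u z)"
    proof -
      have h1: "of_real s = of_real (R\<^sup>2) - a * cnj a" by (simp add: s_def complex_norm_square[symmetric])
      have h2: "of_real s * u z = cnj a * (z - a)" using s by (simp add: u_def)
      have "of_real s * (1 - u z) = of_real s - of_real s * u z" by (simp add: right_diff_distrib)
      also have "\<dots> = (of_real (R\<^sup>2) - a * cnj a) - cnj a * (z - a)" by (simp only: h2) (simp only: h1)
      also have "\<dots> = of_real (R\<^sup>2) - z * cnj a" by (simp add: algebra_simps)
      finally show ?thesis by simp
    qed
    have e2: "s\<^sup>2 * v = R\<^sup>2 * (cmod (z - a))\<^sup>2 + (R\<^sup>2 - (cmod z)\<^sup>2) * s"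
      using disc_identity[of R z a] unfolding e1 s_def[symmetric] by (simp add: norm_mult power_mult_distrib v_def)
    define Z where "Z = R\<^sup>2 - (cmod z)\<^sup>2"
    have Z: "Z > 0" using zR by (auto simp: Z_def intro!: power_strict_mono)
    have e3: "Z / (s * v) = 1 - y"
    proof -
      have "y = (R\<^sup>2 * (cmod (z - a))\<^sup>2) / (s\<^sup>2 * v)" by (simp add: y_def x_def)
      moreover have "Z / (s * v) = (Z * s) / (s\<^sup>2 * v)" using s by (simp add: power2_eq_square)
      ultimately have "Z / (s * v) + y = (Z * s + R\<^sup>2 * (cmod (z - a))\<^sup>2) / (s\<^sup>2 * v)"
        by (simp add: add_divide_distrib)
      also have "Z * s + R\<^sup>2 * (cmod (z - a))\<^sup>2 = s\<^sup>2 * v" using e2 by (simp add: Z_def)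
      also have "s\<^sup>2 * v / (s\<^sup>2 * v) = 1" using s vpos by simp
      finally show ?thesis by simp
    qed
    have "barrier R z - barrier R a - Re (- 2 * Ln (1 - u z)) = ln (s / Z) + 2 * ln (cmod (1 - u z))"
    proof -
      have "1 - u z \<noteq> 0" using c1 by auto
      then show ?thesis using barrier_diff[OF R a zR] by (simp add: s_def Z_def)
    qed
    also have "2 * ln (cmod (1 - u z)) = ln v"
      unfolding v_def using c1 by (subst ln_realpow) auto
    also have "ln (s / Z) + ln v = - ln (Z / (s * v))"
      using s Z vpos by (simp add: ln_div ln_mult)
    also have "\<dots> = - ln (1 - y)" by (simp add: e3)
    finally have D: "barrier R z - barrier R a - Re (- 2 * Ln (1 - u z)) = - ln (1 - y)" .
    have ysmall: "y \<le> 1/1000" using yhi x1 by simp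
    have l1: "- ln (1 - y) \<ge> y" using ln_le_minus_one[of "1 - y"] ysmall by simp
    have l2: "- ln (1 - y) \<le> y * (1002/1000)"
    proof -
      have "- ln (1 - y) = ln (1 / (1 - y))" using ysmall by (simp add: ln_div)
      also have "\<dots> \<le> 1 / (1 - y) - 1" using ysmall by (intro ln_le_minus_one) auto
      also have "\<dots> = y / (1 - y)" using ysmall by (simp add: divide_simps)
      also have "\<dots> \<le> y / (999/1000)" using ysmall y0 by (intro divide_left_mono) auto
      also have "\<dots> \<le> y * (1002/1000)" using y0 by simp
      finally show ?thesis .
    qed
    have "\<bar>- ln (1 - y) - x\<bar> \<le> x / 100"
      using l1 l2 ylo yhi x0 by linarith
    then show "\<bar>barrier R z - barrier R a - Re (- 2 * Ln (1 - u z)) - R\<^sup>2 / (R\<^sup>2 - (cmod a)\<^sup>2)\<^sup>2 * (cmod (z - a))\<^sup>2\<bar>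
       \<le> R\<^sup>2 / (R\<^sup>2 - (cmod a)\<^sup>2)\<^sup>2 * (cmod (z - a))\<^sup>2 / 100"
      unfolding D by (simp add: x_def s_def)
  qed
qed

text \<open>The witness is a product of normalised kernels, of Bargmann-Fock type for the quadratic
  part and of Bergman type for the barrier. The first is bounded by
  \<open>2 * Re (z * cnj a) \<le> (cmod z)\<^sup>2 + (cmod a)\<^sup>2\<close>, the second by
  dropping the nonnegative term with \<open>z - a\<close> in \<open>disc_identity\<close>.\<close>

lemma kernel_bound_barrier:
  fixes N :: nat
  assumes R: "R > 0" and T: "T \<ge> 0"
  shows "kernel_bound (ball 0 R) (\<lambda>z. T * (cmod z)\<^sup>2 + real N * barrier R z) 1"
  unfolding kernel_bound_def
proof
  fix a assume "a \<in> ball (0::complex) R"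
  then have a: "cmod a < R" by simp
  define s where "s = R\<^sup>2 - (cmod a)\<^sup>2"
  have s: "s > 0" using a by (auto simp: s_def intro!: power_strict_mono)
  have ne: "of_real (R\<^sup>2) - z * cnj a \<noteq> 0" if "cmod z < R" for z
  proof -
    have "cmod (z * cnj a) < R * R" unfolding norm_mult
      using that a by (simp, intro mult_strict_mono') auto
    moreover have "cmod (of_real (R\<^sup>2)) = R * R" by (simp add: power2_eq_square norm_mult)
    ultimately show ?thesis by (metis eq_iff_diff_eq_0 less_irrefl)
  qed
  define g where "g = (\<lambda>z. exp (of_real (2 * T) * (z * cnj a - of_real ((cmod a)\<^sup>2))) *
      (of_real s / (of_real (R\<^sup>2) - z * cnj a)) ^ (2 * N))"
  show "\<exists>g. g holomorphic_on ball 0 R \<and> g a = 1 \<and> (\<forall>z\<in>ball 0 R. cmod (g z) \<le>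
     1 * exp (T * (cmod z)\<^sup>2 + real N * barrier R z - (T * (cmod a)\<^sup>2 + real N * barrier R a)))"
  proof (intro exI[of _ g] conjI ballI)
    show "g holomorphic_on ball 0 R"
      unfolding g_def using ne by (intro holomorphic_intros) (auto simp: dist_norm)
    have "of_real (R\<^sup>2) - a * cnj a = of_real s" by (simp add: s_def complex_norm_square[symmetric])
    then show "g a = 1" using s by (simp add: g_def complex_norm_square[symmetric])
  next
    fix z assume "z \<in> ball (0::complex) R"
    then have z: "cmod z < R" by simp
    define Z where "Z = R\<^sup>2 - (cmod z)\<^sup>2"
    have Z: "Z > 0" using z by (auto simp: Z_def intro!: power_strict_mono)
    have "cmod (exp (of_real (2 * T) * (z * cnj a - of_real ((cmod a)\<^sup>2)))) = exp (T * (2 * Re (z * cnj a) - 2 * (cmod a)\<^sup>2))"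
      by (simp add: algebra_simps)
    also have "\<dots> \<le> exp (T * ((cmod z)\<^sup>2 - (cmod a)\<^sup>2))"
    proof -
      have "2 * Re (z * cnj a) \<le> (cmod z)\<^sup>2 + (cmod a)\<^sup>2"
        using zero_le_power2[of "cmod (z - a)"] unfolding cmod_power2
        by (simp add: algebra_simps power2_eq_square)
      then show ?thesis using T by (simp add: mult_left_mono)
    qed
    finally have b1: "cmod (exp (of_real (2 * T) * (z * cnj a - of_real ((cmod a)\<^sup>2)))) \<le> exp (T * ((cmod z)\<^sup>2 - (cmod a)\<^sup>2))" .
    have "(cmod (of_real s / (of_real (R\<^sup>2) - z * cnj a)))\<^sup>2 = s\<^sup>2 / (cmod (of_real (R\<^sup>2) - z * cnj a))\<^sup>2"
      using s by (simp add: norm_divide power_divide)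
    also have "\<dots> \<le> s\<^sup>2 / (Z * s)"
      unfolding disc_identity using s Z R by (intro divide_left_mono) (auto simp: Z_def s_def intro!: mult_pos_pos add_nonneg_pos)
    also have "\<dots> = s / Z" using s by (simp add: power2_eq_square)
    finally have "(cmod (of_real s / (of_real (R\<^sup>2) - z * cnj a))) ^ (2 * N) \<le> (s / Z) ^ N"
      unfolding power_mult by (intro power_mono) auto
    also have "\<dots> = exp (real N * (barrier R z - barrier R a))"
      using barrier_diff[OF R a z] s Z by (simp add: exp_of_nat_mult s_def Z_def)
    finally have b2: "cmod ((of_real s / (of_real (R\<^sup>2) - z * cnj a)) ^ (2 * N)) \<le> exp (real N * (barrier R z - barrier R a))"
      by (simp add: norm_power)
    have "cmod (g z) \<le> exp (T * ((cmod z)\<^sup>2 - (cmod a)\<^sup>2)) * exp (real N * (barrier R z - barrier R a))"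
      unfolding g_def norm_mult by (intro mult_mono b1 b2) auto
    also have "\<dots> = 1 * exp (T * (cmod z)\<^sup>2 + real N * barrier R z - (T * (cmod a)\<^sup>2 + real N * barrier R a))"
      by (simp add: exp_add[symmetric] algebra_simps)
    finally show "cmod (g z) \<le> 1 * exp (T * (cmod z)\<^sup>2 + real N * barrier R z - (T * (cmod a)\<^sup>2 + real N * barrier R a))" .
  qed
qed

section \<open>The continuity method on a disc\<close>

text \<open>The bound involves the weight at \<open>z\<close> and at \<open>a\<close>, so a change
  by 1/2 costs a factor \<open>exp 1\<close>, at most 3; then 12 lies below 16.\<close>

lemma kernel_bound_perturb:
  assumes "kernel_bound S \<phi> 4" "\<And>z. z \<in> S \<Longrightarrow> \<bar>\<psi> z - \<phi> z\<bar> \<le> 1/2"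
  shows "kernel_bound S \<psi> 16"
  unfolding kernel_bound_def
proof
  fix a assume a: "a \<in> S"
  obtain g where g: "g holomorphic_on S" "g a = 1" "\<And>z. z \<in> S \<Longrightarrow> cmod (g z) \<le> 4 * exp (\<phi> z - \<phi> a)"
    using assms(1) a unfolding kernel_bound_def by blast
  have "cmod (g z) \<le> 16 * exp (\<psi> z - \<psi> a)" if z: "z \<in> S" for z
  proof -
    have "exp (\<phi> z - \<phi> a) \<le> exp (1 + (\<psi> z - \<psi> a))"
      using assms(2)[OF a] assms(2)[OF z] unfolding exp_le_cancel_iff by linarith
    also have "\<dots> \<le> 3 * exp (\<psi> z - \<psi> a)" using exp_le by (simp add: exp_add)
    finally show ?thesis using g(3)[OF z] exp_gt_zero[of "\<psi> z - \<psi> a"] by linarith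
  qed
  then show "\<exists>g. g holomorphic_on S \<and> g a = 1 \<and> (\<forall>z\<in>S. cmod (g z) \<le> 16 * exp (\<psi> z - \<psi> a))"
    using g by blast
qed

text \<open>Cutting the segment into at least \<open>2 * M\<close> pieces makes each step at most
  1/2, and \<open>kernel_improve\<close> brings the constant back to 4 before the next step.
  Roundness is therefore required at every parameter of the segment.\<close>

lemma kernel_bound_path:
  assumes S: "open S" "convex S" and c: "continuous_on S \<phi>" "continuous_on S \<psi>"
    and M: "\<And>z. z \<in> S \<Longrightarrow> \<bar>\<psi> z - \<phi> z\<bar> \<le> M"
    and ker: "kernel_bound S \<phi> 4"
    and rd: "\<And>a s. a \<in> S \<Longrightarrow> 0 \<le> s \<Longrightarrow> s \<le> 1 \<Longrightarrow> \<exists>r m. r > 0 \<and> ball a (2 * r) \<subseteq> S \<and> m * r\<^sup>2 \<ge> 40 \<and>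
        round_at (\<lambda>z. \<phi> z + s * (\<psi> z - \<phi> z)) a (2 * r) m"
  shows "kernel_bound S \<psi> 4"
proof -
  obtain n :: nat where n: "real n \<ge> 2 * M" "n > 0"
    by (metis real_arch_simple gr0I le_zero_eq linorder_le_cases of_nat_0_le_iff order_trans zero_less_Suc of_nat_le_iff le_Suc_eq)
  define w where "w = (\<lambda>j::nat. \<lambda>z. \<phi> z + (real j / real n) * (\<psi> z - \<phi> z))"
  have "kernel_bound S (w j) 4" if "j \<le> n" for j
    using that
  proof (induction j)
    case 0
    then show ?case using ker by (simp add: w_def)
  next
    case (Suc j)
    have "\<bar>w (Suc j) z - w j z\<bar> \<le> 1/2" if "z \<in> S" for z
    proof -
      have "w (Suc j) z - w j z = (1 / real n) * (\<psi> z - \<phi> z)" by (simp add: w_def diff_divide_distrib[symmetric] left_diff_distrib[symmetric])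
      then have "\<bar>w (Suc j) z - w j z\<bar> = (1 / real n) * \<bar>\<psi> z - \<phi> z\<bar>" using n by (simp add: abs_mult)
      also have "\<dots> \<le> (1 / real n) * (real n / 2)" using M[OF that] n by (intro mult_left_mono) auto
      also have "\<dots> = 1/2" using n by simp
      finally show ?thesis .
    qed
    then have "kernel_bound S (w (Suc j)) 16" using Suc kernel_bound_perturb by auto
    moreover have "continuous_on S (w (Suc j))" unfolding w_def by (intro continuous_intros c)
    ultimately show ?case
      using kernel_improve[OF S, of "w (Suc j)"] rd[of _ "real (Suc j) / real n"] Suc.prems n
      unfolding w_def by simp
  qed
  from this[of n] show ?thesis using n by (simp add: w_def)
qed

lemma kernel_bound_mono:
  assumes "kernel_bound S \<phi> B" "B \<le> B'"
  shows "kernel_bound S \<phi> B'"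
proof -
  have "c \<le> B' * exp x" if "c \<le> B * exp x" for c x :: real
    by (rule order_trans[OF that mult_right_mono[OF assms(2)]]) simp
  then show ?thesis using assms(1) unfolding kernel_bound_def by fast
qed

text \<open>Near the boundary of the disc the roundness radius shrinks like \<open>(R - |a|) / 2000\<close>; the bound on \<open>N\<close>
  makes the barrier alone strong enough there, uniformly in \<open>R\<close>.\<close>
lemma kernel_bound_disc:
  fixes N :: nat
  assumes c\<phi>: "continuous_on UNIV \<phi>" and r: "r > 0"
    and rd: "\<And>a. round_at \<phi> a (2 * r) (m a)" "\<And>a. m a * r\<^sup>2 \<ge> 40"
    and N: "real N \<ge> 640000000" and R: "R > 0"
  shows "kernel_bound (ball 0 R) (\<lambda>z. \<phi> z + real N * barrier R z) 4"
proof -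
  \<comment> \<open>Chosen so that the initial quadratic weight satisfies the threshold 40 at radius
    \<open>r\<close>; convex combinations with \<open>\<phi>\<close> then satisfy it as
    well.\<close>
  define T where "T = 40 / r\<^sup>2"
  have T: "T \<ge> 0" "T * r\<^sup>2 = 40" using r by (auto simp: T_def)
  have cb: "continuous_on (ball 0 R) (barrier R)"
  proof -
    have "1 - (cmod z / R)\<^sup>2 \<noteq> 0" if "z \<in> ball 0 R" for z
    proof -
      have "(cmod z / R)\<^sup>2 < 1" using that R by (simp add: abs_square_less_1)
      then show ?thesis by simp
    qed
    then show ?thesis unfolding barrier_def using R by (intro continuous_intros) auto
  qed
  have c\<phi>': "continuous_on X \<phi>" for X using c\<phi> continuous_on_subset by blast
  \<comment> \<open>Both ends of the segment contain the same barrier, so their difference extends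
    continuously to the closed disc and is bounded although each weight blows up at the
    edge.\<close>
  obtain M where M: "\<And>z. z \<in> cball 0 R \<Longrightarrow> \<bar>\<phi> z - T * (cmod z)\<^sup>2\<bar> \<le> M"
  proof -
    have "compact ((\<lambda>z. \<phi> z - T * (cmod z)\<^sup>2) ` cball 0 R)"
      by (intro compact_continuous_image continuous_intros c\<phi>') auto
    from compact_imp_bounded[OF this]
    obtain M where "\<forall>x\<in>(\<lambda>z. \<phi> z - T * (cmod z)\<^sup>2) ` cball 0 R. norm x \<le> M"
      by (auto simp: bounded_iff)
    then show ?thesis by (intro that[of M]) auto
  qed
  show ?thesis
  proof (rule kernel_bound_path[of _ "\<lambda>z. T * (cmod z)\<^sup>2 + real N * barrier R z" _ M])
    show "continuous_on (ball 0 R) (\<lambda>z. T * (cmod z)\<^sup>2 + real N * barrier R z)"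
      by (intro continuous_intros cb)
    show "continuous_on (ball 0 R) (\<lambda>z. \<phi> z + real N * barrier R z)"
      by (intro continuous_intros cb c\<phi>')
    show "\<bar>\<phi> z + real N * barrier R z - (T * (cmod z)\<^sup>2 + real N * barrier R z)\<bar> \<le> M" if "z \<in> ball 0 R" for z
      using M[of z] that by simp
    show "kernel_bound (ball 0 R) (\<lambda>z. T * (cmod z)\<^sup>2 + real N * barrier R z) 4"
      by (rule kernel_bound_mono[OF kernel_bound_barrier[OF R T(1), of N]]) simp
  next
    fix a :: complex and s :: real assume aR: "a \<in> ball 0 R" and s: "0 \<le> s" "s \<le> 1"
    then have a: "cmod a < R" by simp
    \<comment> \<open>Roundness is used on radius \<open>2 * q\<close>, hence 2000 in place of the
      1000 of \<open>round_at_barrier\<close>.\<close>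
    define q where "q = min r ((R - cmod a) / 2000)"
    define b where "b = R\<^sup>2 / (R\<^sup>2 - (cmod a)\<^sup>2)\<^sup>2"
    define n where "n = ((1 - s) * T + s * m a) + real N * b"
    have q: "q > 0" "q \<le> r" "2 * q \<le> (R - cmod a) / 1000" using r a by (auto simp: q_def min_def)
    have b0: "b \<ge> 0" by (simp add: b_def)
    have n1: "((1 - s) * T + s * m a) * r\<^sup>2 \<ge> 40"
    proof -
      have "((1 - s) * T + s * m a) * r\<^sup>2 = (1 - s) * (T * r\<^sup>2) + s * (m a * r\<^sup>2)" by (simp add: algebra_simps)
      also have "\<dots> \<ge> (1 - s) * 40 + s * 40" using s rd(2)[of a] T(2) by (intro add_mono mult_left_mono) auto
      finally show ?thesis by simp
    qed
    then have n0: "(1 - s) * T + s * m a \<ge> 0"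
      using r by (smt (verit) mult_nonpos_nonneg zero_le_power2)
    have n40: "n * q\<^sup>2 \<ge> 40"
    proof (cases "q = r")
      case True
      have "n * q\<^sup>2 = ((1 - s) * T + s * m a) * r\<^sup>2 + real N * b * r\<^sup>2" by (simp add: n_def True algebra_simps)
      then show ?thesis using n1 b0 by (smt (verit) mult_nonneg_nonneg of_nat_0_le_iff zero_le_power2)
    next
      case False
      then have qe: "q = (R - cmod a) / 2000" by (auto simp: q_def min_def split: if_splits)
      have "R\<^sup>2 - (cmod a)\<^sup>2 = (R - cmod a) * (R + cmod a)" by (simp add: power2_eq_square algebra_simps)
      then have "b * q\<^sup>2 = R\<^sup>2 / (R + cmod a)\<^sup>2 / 4000000"
        using a R by (simp add: b_def qe power_mult_distrib power_divide)
      moreover have "R\<^sup>2 / (R + cmod a)\<^sup>2 \<ge> 1 / 4"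
      proof -
        have "(R + cmod a)\<^sup>2 \<le> (2 * R)\<^sup>2" using a R by (intro power_mono) auto
        moreover have "R + cmod a > 0" using R by (simp add: add_pos_nonneg)
        ultimately show ?thesis by (simp add: divide_simps power_mult_distrib)
      qed
      moreover have "x / 4000000 \<ge> 1 / 16000000" if "x \<ge> 1 / 4" for x :: real using that by simp
      ultimately have "b * q\<^sup>2 \<ge> 1 / 16000000" by (simp only:)
      \<comment> \<open>The origin of the bound on \<open>N\<close>: 640000000 is 40 times 16000000,
        and 16000000 is 4 times the square of 2000. The 4 comes from
        \<open>R + cmod a \<le> 2 * R\<close>.\<close>
      from mult_mono[OF N this] have "real N * (b * q\<^sup>2) \<ge> 40" by simp
      moreover have "n * q\<^sup>2 = ((1 - s) * T + s * m a) * q\<^sup>2 + real N * (b * q\<^sup>2)" by (simp add: n_def algebra_simps)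
      ultimately show ?thesis using n0 by (smt (verit) mult_nonneg_nonneg zero_le_power2)
    qed
    have "round_at (\<lambda>z. ((1 - s) * (T * (cmod z)\<^sup>2) + s * \<phi> z) + real N * barrier R z) a (2 * q) (((1 - s) * (T * 1) + s * m a) + real N * b)"
      unfolding b_def using s T q
      by (intro round_at_add round_at_scale round_at_norm_square round_at_barrier[OF R a] round_at_mono[OF rd(1)]) auto
    moreover have "(\<lambda>z. ((1 - s) * (T * (cmod z)\<^sup>2) + s * \<phi> z) + real N * barrier R z) =
        (\<lambda>z. T * (cmod z)\<^sup>2 + real N * barrier R z + s * (\<phi> z + real N * barrier R z - (T * (cmod z)\<^sup>2 + real N * barrier R z)))"
      by (auto simp: algebra_simps)
    moreover have "ball a (2 * q) \<subseteq> ball 0 R"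
    proof
      fix z assume "z \<in> ball a (2 * q)"
      then have "cmod (z - a) < (R - cmod a) / 1000" using q by (simp add: dist_norm norm_minus_commute)
      then show "z \<in> ball 0 R" using norm_triangle_ineq[of a "z - a"] a by simp
    qed
    ultimately show "\<exists>r m. r > 0 \<and> ball a (2 * r) \<subseteq> ball 0 R \<and> m * r\<^sup>2 \<ge> 40 \<and>
        round_at (\<lambda>z. T * (cmod z)\<^sup>2 + real N * barrier R z + s * (\<phi> z + real N * barrier R z - (T * (cmod z)\<^sup>2 + real N * barrier R z))) a (2 * r) m"
      using q(1) n40 by (intro exI[of _ q] exI[of _ n]) (simp add: n_def)
  qed auto
qed

section \<open>Exhausting the plane by discs\<close>

text \<open>Taylor partial sums converge uniformly on the half disc, the series having been tested
  at radius \<open>3 / 4 * R\<close>. This replaces functions on growing discs by entire ones, so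
  that a single normal-family argument on the whole plane suffices.\<close>

lemma holomorphic_approx_entire:
  assumes f: "f holomorphic_on ball 0 R" and R: "R > 0" and e: "e > 0"
  shows "\<exists>p. p holomorphic_on UNIV \<and> (\<forall>z\<in>cball 0 (R / 2). cmod (p z - f z) \<le> e)"
proof -
  define c where "c = (\<lambda>n. (deriv ^^ n) f 0 / fact n)"
  have sums: "(\<lambda>n. c n * w ^ n) sums f w" if "w \<in> ball 0 R" for w
    using holomorphic_power_series[OF f that] by (simp add: c_def)
  have "summable (\<lambda>n. c n * of_real (3 / 4 * R) ^ n)"
  proof (rule sums_summable, rule sums)
    have "cmod (of_real (3 / 4 * R)) = 3 / 4 * R" using R by (simp only: norm_of_real)
    then show "of_real (3 / 4 * R) \<in> ball (0::complex) R" using R by (simp only: mem_ball_0)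
  qed
  then have "ereal (cmod (of_real (3 / 4 * R))) \<le> conv_radius c"
    by (rule conv_radius_geI)
  then have "ereal (R / 2) < conv_radius c"
    by (rule less_le_trans[rotated]) (use R in simp)
  from powser_uniform_limit[OF this, of 0]
  have "\<forall>\<^sub>F n in sequentially. \<forall>x\<in>cball 0 (R / 2). dist (\<Sum>i<n. c i * x ^ i) (\<Sum>i. c i * x ^ i) < e"
    using e by (simp add: uniform_limit_iff)
  then obtain n where n: "\<forall>x\<in>cball 0 (R / 2). dist (\<Sum>i<n. c i * x ^ i) (\<Sum>i. c i * x ^ i) < e"
    by (auto simp: eventually_sequentially)
  have "cmod ((\<Sum>i<n. c i * x ^ i) - f x) \<le> e" if "x \<in> cball 0 (R / 2)" for x
  proof -
    have "x \<in> ball 0 R" using that R by simp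
    then have "f x = (\<Sum>i. c i * x ^ i)" using sums sums_unique by blast
    then show ?thesis using n that by (simp add: dist_norm less_imp_le)
  qed
  moreover have "(\<lambda>x. \<Sum>i<n. c i * x ^ i) holomorphic_on UNIV" by (intro holomorphic_intros)
  ultimately show ?thesis by blast
qed

text \<open>\<open>N\<close> is fixed before \<open>R\<close>. On the half disc the barrier is at
  most 1, which gives locally uniform bounds; at each fixed point it tends to 0, so the limit
  function satisfies the bound for \<open>\<phi>\<close> alone, with constant 4 intact.\<close>

lemma kernel_bound_entire:
  assumes c\<phi>: "continuous_on UNIV \<phi>" and r: "r > 0"
    and rd: "\<And>a. round_at \<phi> a (2 * r) (m a)" "\<And>a. m a * r\<^sup>2 \<ge> 40"
  shows "kernel_bound UNIV \<phi> 4"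
  unfolding kernel_bound_def
proof
  fix a :: complex
  obtain N :: nat where N: "real N \<ge> 640000000" using real_arch_simple by blast
  define R where "R = (\<lambda>n::nat. real n + (cmod a + 1))"
  have R: "R n > 0" "cmod a < R n" for n by (auto simp: R_def add_nonneg_pos)
  have "\<forall>n. \<exists>g. g holomorphic_on ball 0 (R n) \<and> g a = 1 \<and>
     (\<forall>z\<in>ball 0 (R n). cmod (g z) \<le> 4 * exp (\<phi> z + real N * barrier (R n) z - (\<phi> a + real N * barrier (R n) a)))"
    using kernel_bound_disc[OF c\<phi> r rd N R(1)] R(2) unfolding kernel_bound_def by simp
  then obtain g where g: "\<And>n. g n holomorphic_on ball 0 (R n)" "\<And>n. g n a = 1"
    "\<And>n z. z \<in> ball 0 (R n) \<Longrightarrow> cmod (g n z) \<le> 4 * exp (\<phi> z + real N * barrier (R n) z - (\<phi> a + real N * barrier (R n) a))"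
    by metis
  have "\<forall>n. \<exists>p. p holomorphic_on UNIV \<and> (\<forall>z\<in>cball 0 (R n / 2). cmod (p z - g n z) \<le> 1 / real (Suc n))"
    using holomorphic_approx_entire[OF g(1) R(1)] by simp
  then obtain p where p: "\<And>n. p n holomorphic_on UNIV"
    "\<And>n z. z \<in> cball 0 (R n / 2) \<Longrightarrow> cmod (p n z - g n z) \<le> 1 / real (Suc n)" by metis
  define E where "E = (\<lambda>n z. 4 * exp (\<phi> z + real N * barrier (R n) z - (\<phi> a + real N * barrier (R n) a)))"
  have pb: "cmod (p n z) \<le> E n z + 1 / real (Suc n)" if "cmod z \<le> R n / 2" for n z
  proof -
    have "z \<in> ball 0 (R n)" using that R(1)[of n] by simp
    then show ?thesis using g(3)[of z n] p(2)[of z n] that norm_triangle_ineq[of "g n z" "p n z - g n z"]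
      by (simp add: E_def)
  qed
  have bar0: "barrier (R n) a \<ge> 0" for n
  proof -
    have "(cmod a / R n)\<^sup>2 < 1" using R[of n] by (simp add: abs_square_less_1)
    then show ?thesis by (simp add: barrier_def)
  qed
  have bar1: "barrier (R n) z \<le> 1" if "cmod z \<le> R n / 2" for n z
  proof -
    have "(cmod z / R n)\<^sup>2 \<le> (1/2)\<^sup>2" using that R[of n] by (intro power_mono) (auto simp: divide_simps)
    moreover have "(1/2::real)\<^sup>2 = 1/4" by (simp add: power2_eq_square)
    ultimately have y: "1 - (cmod z / R n)\<^sup>2 \<ge> 1 / 2" by linarith
    then have "ln (1/2) \<le> ln (1 - (cmod z / R n)\<^sup>2)" by simp
    moreover have "- ln (1/2::real) \<le> 1" using ln_le_minus_one[of 2] by (simp add: ln_div)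
    ultimately show ?thesis by (simp add: barrier_def)
  qed
  have Eb: "E n z \<le> 4 * exp (\<phi> z - \<phi> a + real N)" if "cmod z \<le> R n / 2" for n z
  proof -
    have "real N * barrier (R n) z \<le> real N * 1" using bar1[OF that] by (intro mult_left_mono) auto
    moreover have "real N * barrier (R n) a \<ge> 0" using bar0[of n] by simp
    ultimately show ?thesis by (simp add: E_def)
  qed
  have bounded: "\<exists>B. \<forall>h\<in>range p. \<forall>z\<in>K. cmod (h z) \<le> B" if K: "compact K" for K
  proof -
    obtain b where b: "\<And>z. z \<in> K \<Longrightarrow> cmod z \<le> b"
      using compact_imp_bounded[OF K] by (auto simp: bounded_iff)
    obtain n0 :: nat where n0: "real n0 \<ge> 2 * b" using real_arch_simple by blast
    have "compact ((\<lambda>z. 4 * exp (\<phi> z - \<phi> a + real N)) ` K)"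
      by (intro compact_continuous_image continuous_intros continuous_on_subset[OF c\<phi>] K) auto
    then obtain B1 where "\<forall>x\<in>(\<lambda>z. 4 * exp (\<phi> z - \<phi> a + real N)) ` K. norm x \<le> B1"
      using compact_imp_bounded bounded_iff by blast
    then have B1: "4 * exp (\<phi> z - \<phi> a + real N) \<le> B1" if "z \<in> K" for z
      using that by fastforce
    have "\<exists>C. \<forall>z\<in>K. cmod (p n z) \<le> C" for n
    proof -
      have "compact (p n ` K)"
        by (intro compact_continuous_image K holomorphic_on_imp_continuous_on holomorphic_on_subset[OF p(1)]) auto
      from compact_imp_bounded[OF this] show ?thesis by (simp add: bounded_iff)
    qed
    then have "\<forall>n. \<exists>C. \<forall>z\<in>K. cmod (p n z) \<le> C" by blast
    from choice[OF this] obtain C where C: "\<And>n z. z \<in> K \<Longrightarrow> cmod (p n z) \<le> C n" by blast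
    \<comment> \<open>The weight bound is available on \<open>K\<close> only once the half disc
      contains \<open>K\<close>. The finitely many earlier functions are bounded on \<open>K\<close>
      by continuity.\<close>
    define B where "B = (\<Sum>n<n0. \<bar>C n\<bar>) + \<bar>B1\<bar> + 1"
    have "cmod (p n z) \<le> B" if z: "z \<in> K" for n z
    proof (cases "n < n0")
      case True
      then have "\<bar>C n\<bar> \<le> (\<Sum>n<n0. \<bar>C n\<bar>)" by (intro member_le_sum) auto
      then show ?thesis using C[OF z, of n] by (simp add: B_def)
    next
      case False
      then have "real n \<ge> real n0" by simp
      note nn = this
      have "2 * cmod z \<le> 2 * b" using b[OF z] by simp
      also note n0
      also note nn
      also have "real n \<le> R n" by (simp add: R_def)
      finally have "cmod z \<le> R n / 2" by simp
      then have "cmod (p n z) \<le> B1 + 1 / real (Suc n)" using pb[of z n] Eb[of z n] B1[OF z] by linarith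
      moreover have "1 / real (Suc n) \<le> 1" by simp
      moreover have "(\<Sum>n<n0. \<bar>C n\<bar>) \<ge> 0" by (simp add: sum_nonneg)
      ultimately show ?thesis unfolding B_def by linarith
    qed
    then show ?thesis by auto
  qed
  obtain G \<sigma> where G: "G holomorphic_on UNIV" "strict_mono (\<sigma> :: nat \<Rightarrow> nat)"
    "\<And>x. (\<lambda>n. p (\<sigma> n) x) \<longlonglongrightarrow> G x"
  proof (rule Montel[of UNIV "range p" p])
    show "h holomorphic_on UNIV" if "h \<in> range p" for h using that p(1) by auto
    show "\<exists>B. \<forall>h\<in>range p. \<forall>z\<in>K. cmod (h z) \<le> B" if "compact K" for K using bounded[OF that] .
  qed auto
  have Rlim: "filterlim R at_top sequentially"
    unfolding R_def using filterlim_tendsto_add_at_top[OF tendsto_const filterlim_real_sequentially, of "cmod a + 1"]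
    by (simp add: add.commute)
  have invlim: "(\<lambda>n. 1 / real (Suc n)) \<longlonglongrightarrow> 0"
    using LIMSEQ_inverse_real_of_nat by (simp add: inverse_eq_divide)
  have barlim: "(\<lambda>n. barrier (R n) z) \<longlonglongrightarrow> 0" for z
  proof -
    have "(\<lambda>n. cmod z / R n) \<longlonglongrightarrow> 0"
      using Rlim by (intro tendsto_divide_0[OF tendsto_const] filterlim_at_top_imp_at_infinity)
    then have "(\<lambda>n. - ln (1 - (cmod z / R n)\<^sup>2)) \<longlonglongrightarrow> - ln (1 - 0\<^sup>2)"
      by (intro tendsto_intros) auto
    then show ?thesis by (simp add: barrier_def)
  qed
  have Rz: "\<forall>\<^sub>F n in sequentially. cmod z \<le> R n / 2" for z
    using Rlim unfolding filterlim_at_top by (elim allE[of _ "2 * cmod z"]) (auto elim: eventually_mono)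
  have sub: "filterlim \<sigma> sequentially sequentially" using G(2) by (rule filterlim_subseq)
  have Ga: "G a = 1"
  proof -
    have "(\<lambda>n. p n a - 1) \<longlonglongrightarrow> 0"
    proof (rule Lim_null_comparison[OF _ invlim])
      show "\<forall>\<^sub>F n in sequentially. cmod (p n a - 1) \<le> 1 / real (Suc n)"
        using Rz[of a] by eventually_elim (use p(2)[of a] g(2) in auto)
    qed
    then have "(\<lambda>n. p n a) \<longlonglongrightarrow> 1" by (rule LIM_zero_cancel)
    from filterlim_compose[OF this sub] show ?thesis using G(3)[of a] LIMSEQ_unique by blast
  qed
  have Gb: "cmod (G z) \<le> 4 * exp (\<phi> z - \<phi> a)" for z
  proof (rule tendsto_le[OF _ _ tendsto_norm[OF G(3)[of z]]])
    have "(\<lambda>n. E n z + 1 / real (Suc n)) \<longlonglongrightarrow> 4 * exp (\<phi> z + real N * 0 - (\<phi> a + real N * 0)) + 0"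
      unfolding E_def by (intro tendsto_intros barlim invlim)
    from filterlim_compose[OF this sub]
    show "(\<lambda>n. E (\<sigma> n) z + 1 / real (Suc (\<sigma> n))) \<longlonglongrightarrow> 4 * exp (\<phi> z - \<phi> a)" by simp
    show "\<forall>\<^sub>F n in sequentially. cmod (p (\<sigma> n) z) \<le> E (\<sigma> n) z + 1 / real (Suc (\<sigma> n))"
      using eventually_compose_filterlim[OF Rz[of z] sub] by eventually_elim (rule pb)
  qed simp
  show "\<exists>g. g holomorphic_on UNIV \<and> g a = 1 \<and> (\<forall>z\<in>UNIV. cmod (g z) \<le> 4 * exp (\<phi> z - \<phi> a))"
    using G(1) Ga Gb by blast
qed

section \<open>Polynomial weights\<close>

abbreviation spread :: "complex \<Rightarrow> complex \<Rightarrow> real" where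
  "spread a z \<equiv> 1 + cmod a + cmod (z - a)"

text \<open>Up to the real part of an entire function, \<open>\<phi>\<close> agrees near every point \<open>a\<close> with
  \<open>L a * |z - a|\<^sup>2\<close>, with errors of polynomial growth in \<open>a\<close>; thus \<open>L\<close> plays the role of the
  mixed derivative of \<open>\<phi>\<close>. The holomorphic part comes from polarising \<open>\<phi>\<close>.\<close>
definition mixed :: "nat \<Rightarrow> (complex \<Rightarrow> real) \<Rightarrow> (complex \<Rightarrow> real) \<Rightarrow> bool" where
  "mixed e \<phi> L \<longleftrightarrow> (\<exists>C\<ge>0. \<forall>a. \<exists>h. h holomorphic_on UNIV \<and> h a = 0 \<and> (\<forall>z.
     \<bar>\<phi> z - \<phi> a - Re (h z)\<bar> \<le> C * spread a z ^ e * (cmod (z - a))\<^sup>2 \<and>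
     \<bar>\<phi> z - \<phi> a - Re (h z) - L a * (cmod (z - a))\<^sup>2\<bar> \<le> C * spread a z ^ e * (cmod (z - a)) ^ 3))"

lemma mixedE:
  assumes "mixed e \<phi> L"
  obtains C h where "C \<ge> 0" "\<And>a. h a holomorphic_on UNIV" "\<And>a. h a a = 0"
     "\<And>a z. \<bar>\<phi> z - \<phi> a - Re (h a z)\<bar> \<le> C * spread a z ^ e * (cmod (z - a))\<^sup>2"
     "\<And>a z. \<bar>\<phi> z - \<phi> a - Re (h a z) - L a * (cmod (z - a))\<^sup>2\<bar> \<le> C * spread a z ^ e * (cmod (z - a)) ^ 3"
proof -
  from assms obtain C where C: "C \<ge> 0" and "\<forall>a. \<exists>h. h holomorphic_on UNIV \<and> h a = 0 \<and> (\<forall>z.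
     \<bar>\<phi> z - \<phi> a - Re (h z)\<bar> \<le> C * spread a z ^ e * (cmod (z - a))\<^sup>2 \<and>
     \<bar>\<phi> z - \<phi> a - Re (h z) - L a * (cmod (z - a))\<^sup>2\<bar> \<le> C * spread a z ^ e * (cmod (z - a)) ^ 3)"
    unfolding mixed_def by blast
  from choice[OF this(2)] obtain h where "\<forall>a. h a holomorphic_on UNIV \<and> h a a = 0 \<and> (\<forall>z.
     \<bar>\<phi> z - \<phi> a - Re (h a z)\<bar> \<le> C * spread a z ^ e * (cmod (z - a))\<^sup>2 \<and>
     \<bar>\<phi> z - \<phi> a - Re (h a z) - L a * (cmod (z - a))\<^sup>2\<bar> \<le> C * spread a z ^ e * (cmod (z - a)) ^ 3)"
    by blast
  then show ?thesis using that[OF C, of h] by blast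
qed

lemma mixed_add:
  assumes "mixed e \<phi> L" "mixed e \<psi> M"
  shows "mixed e (\<lambda>z. \<phi> z + \<psi> z) (\<lambda>z. L z + M z)"
proof -
  obtain C h where C: "C \<ge> 0" and h: "\<And>a. h a holomorphic_on UNIV" "\<And>a. h a a = 0"
     "\<And>a z. \<bar>\<phi> z - \<phi> a - Re (h a z)\<bar> \<le> C * spread a z ^ e * (cmod (z - a))\<^sup>2"
     "\<And>a z. \<bar>\<phi> z - \<phi> a - Re (h a z) - L a * (cmod (z - a))\<^sup>2\<bar> \<le> C * spread a z ^ e * (cmod (z - a)) ^ 3"
    by (rule mixedE[OF assms(1)]) blast
  obtain D k where D: "D \<ge> 0" and k: "\<And>a. k a holomorphic_on UNIV" "\<And>a. k a a = 0"
     "\<And>a z. \<bar>\<psi> z - \<psi> a - Re (k a z)\<bar> \<le> D * spread a z ^ e * (cmod (z - a))\<^sup>2"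
     "\<And>a z. \<bar>\<psi> z - \<psi> a - Re (k a z) - M a * (cmod (z - a))\<^sup>2\<bar> \<le> D * spread a z ^ e * (cmod (z - a)) ^ 3"
    by (rule mixedE[OF assms(2)]) blast
  show ?thesis
    unfolding mixed_def
  proof (intro exI[of _ "C + D"] conjI allI)
    fix a
    show "\<exists>h. h holomorphic_on UNIV \<and> h a = 0 \<and> (\<forall>z.
      \<bar>\<phi> z + \<psi> z - (\<phi> a + \<psi> a) - Re (h z)\<bar> \<le> (C + D) * spread a z ^ e * (cmod (z - a))\<^sup>2 \<and>
      \<bar>\<phi> z + \<psi> z - (\<phi> a + \<psi> a) - Re (h z) - (L a + M a) * (cmod (z - a))\<^sup>2\<bar>
        \<le> (C + D) * spread a z ^ e * (cmod (z - a)) ^ 3)"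
    proof (intro exI[of _ "\<lambda>z. h a z + k a z"] conjI allI)
      show "(\<lambda>z. h a z + k a z) holomorphic_on UNIV" by (intro holomorphic_intros h k)
      show "h a a + k a a = 0" by (simp add: h k)
      fix z
      show "\<bar>\<phi> z + \<psi> z - (\<phi> a + \<psi> a) - Re (h a z + k a z)\<bar> \<le> (C + D) * spread a z ^ e * (cmod (z - a))\<^sup>2"
        using h(3)[of z a] k(3)[of z a] unfolding distrib_right plus_complex.sel by linarith
      show "\<bar>\<phi> z + \<psi> z - (\<phi> a + \<psi> a) - Re (h a z + k a z) - (L a + M a) * (cmod (z - a))\<^sup>2\<bar>
        \<le> (C + D) * spread a z ^ e * (cmod (z - a)) ^ 3"
        using h(4)[of z a] k(4)[of z a] unfolding distrib_right plus_complex.sel by linarith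
    qed
  qed (use C D in auto)
qed

lemma mixed_scale:
  fixes c :: real
  assumes "mixed e \<phi> L"
  shows "mixed e (\<lambda>z. c * \<phi> z) (\<lambda>z. c * L z)"
proof -
  obtain C h where C: "C \<ge> 0" and h: "\<And>a. h a holomorphic_on UNIV" "\<And>a. h a a = 0"
     "\<And>a z. \<bar>\<phi> z - \<phi> a - Re (h a z)\<bar> \<le> C * spread a z ^ e * (cmod (z - a))\<^sup>2"
     "\<And>a z. \<bar>\<phi> z - \<phi> a - Re (h a z) - L a * (cmod (z - a))\<^sup>2\<bar> \<le> C * spread a z ^ e * (cmod (z - a)) ^ 3"
    by (rule mixedE[OF assms(1)]) blast
  show ?thesis
    unfolding mixed_def
  proof (intro exI[of _ "\<bar>c\<bar> * C"] conjI allI)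
    fix a
    show "\<exists>h. h holomorphic_on UNIV \<and> h a = 0 \<and> (\<forall>z.
      \<bar>c * \<phi> z - c * \<phi> a - Re (h z)\<bar> \<le> \<bar>c\<bar> * C * spread a z ^ e * (cmod (z - a))\<^sup>2 \<and>
      \<bar>c * \<phi> z - c * \<phi> a - Re (h z) - c * L a * (cmod (z - a))\<^sup>2\<bar>
        \<le> \<bar>c\<bar> * C * spread a z ^ e * (cmod (z - a)) ^ 3)"
    proof (intro exI[of _ "\<lambda>z. of_real c * h a z"] conjI allI)
      show "(\<lambda>z. of_real c * h a z) holomorphic_on UNIV" by (intro holomorphic_intros h)
      show "of_real c * h a a = 0" by (simp add: h)
      fix z
      have "c * \<phi> z - c * \<phi> a - Re (of_real c * h a z) = c * (\<phi> z - \<phi> a - Re (h a z))"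
        by (simp add: algebra_simps)
      then show "\<bar>c * \<phi> z - c * \<phi> a - Re (of_real c * h a z)\<bar> \<le> \<bar>c\<bar> * C * spread a z ^ e * (cmod (z - a))\<^sup>2"
        using mult_left_mono[OF h(3)[of z a], of "\<bar>c\<bar>"] by (simp only: abs_mult mult.assoc abs_ge_zero)
      have "c * \<phi> z - c * \<phi> a - Re (of_real c * h a z) - c * L a * (cmod (z - a))\<^sup>2
          = c * (\<phi> z - \<phi> a - Re (h a z) - L a * (cmod (z - a))\<^sup>2)"
        by (simp add: algebra_simps)
      then show "\<bar>c * \<phi> z - c * \<phi> a - Re (of_real c * h a z) - c * L a * (cmod (z - a))\<^sup>2\<bar>
          \<le> \<bar>c\<bar> * C * spread a z ^ e * (cmod (z - a)) ^ 3"
        using mult_left_mono[OF h(4)[of z a], of "\<bar>c\<bar>"] by (simp only: abs_mult mult.assoc abs_ge_zero)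
    qed
  qed (use C in auto)
qed

lemma mixed_zero: "mixed e (\<lambda>z. 0) (\<lambda>z. 0)"
  unfolding mixed_def by (intro exI[of _ 0] conjI allI exI[of _ "\<lambda>z. 0"]) auto

lemma mixed_sum:
  assumes "finite I" "\<And>i. i \<in> I \<Longrightarrow> mixed e (\<phi> i) (L i)"
  shows "mixed e (\<lambda>z. \<Sum>i\<in>I. \<phi> i z) (\<lambda>z. \<Sum>i\<in>I. L i z)"
  using assms by (induction I rule: finite_induct) (auto simp: mixed_zero intro!: mixed_add)

section \<open>Polynomials have mixed expansions, and these yield peak functions\<close>

lemma poly_norm_bound:
  fixes p :: "complex poly"
  obtains C where "C \<ge> 0" "\<And>z. cmod (poly p z) \<le> C * (1 + cmod z) ^ degree p"
proof
  define C where "C = (\<Sum>i\<le>degree p. cmod (coeff p i))"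
  show "C \<ge> 0" by (simp add: C_def sum_nonneg)
  fix z
  have "cmod (poly p z) \<le> (\<Sum>i\<le>degree p. cmod (coeff p i) * cmod z ^ i)"
    unfolding poly_altdef by (rule order_trans[OF norm_sum]) (simp add: norm_mult norm_power)
  also have "\<dots> \<le> (\<Sum>i\<le>degree p. cmod (coeff p i) * (1 + cmod z) ^ degree p)"
  proof (intro sum_mono mult_left_mono)
    fix i assume "i \<in> {..degree p}"
    then have "cmod z ^ i \<le> (1 + cmod z) ^ i" "(1 + cmod z) ^ i \<le> (1 + cmod z) ^ degree p"
      by (auto intro!: power_mono power_increasing)
    then show "cmod z ^ i \<le> (1 + cmod z) ^ degree p" by simp
  qed auto
  finally show "cmod (poly p z) \<le> C * (1 + cmod z) ^ degree p" by (simp add: C_def sum_distrib_right)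
qed

text \<open>The derivatives are bounded on the disc about \<open>a\<close> through \<open>z\<close>,
  where \<open>1 + cmod x \<le> spread a z\<close>. All three bounds carry the same exponent, so
  that in a product of two polynomials the exponents add up to the total degree minus 2.\<close>

lemma poly_taylor_bounds:
  fixes p :: "complex poly"
  obtains C where "C \<ge> 0"
    "\<And>a z. cmod (poly p z - poly p a) \<le> C * spread a z ^ (degree p - 1) * cmod (z - a)"
    "\<And>a z. cmod (poly (pderiv p) a) \<le> C * spread a z ^ (degree p - 1)"
    "\<And>a z. cmod (poly p z - poly p a - poly (pderiv p) a * (z - a))
       \<le> C * spread a z ^ (degree p - 1) * (cmod (z - a))\<^sup>2"
proof -
  obtain C1 where C1: "C1 \<ge> 0" "\<And>z. cmod (poly (pderiv p) z) \<le> C1 * (1 + cmod z) ^ degree (pderiv p)"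
    by (rule poly_norm_bound[of "pderiv p"]) blast
  obtain C2 where C2: "C2 \<ge> 0" "\<And>z. cmod (poly (pderiv (pderiv p)) z) \<le> C2 * (1 + cmod z) ^ degree (pderiv (pderiv p))"
    by (rule poly_norm_bound[of "pderiv (pderiv p)"]) blast
  have nz: "1 + cmod x \<le> 1 + cmod a + cmod (z - a)" if "x \<in> cball a (cmod (z - a))" for x a z
    using that norm_triangle_ineq[of a "x - a"] by (simp add: dist_norm norm_minus_commute)
  have b1: "cmod (poly (pderiv p) x) \<le> C1 * spread a z ^ (degree p - 1)"
    if "x \<in> cball a (cmod (z - a))" for x a z
    using C1 nz[OF that] by (intro order_trans[OF C1(2)] mult_left_mono) (auto simp: degree_pderiv intro!: power_mono)
  have b2: "cmod (poly (pderiv (pderiv p)) x) \<le> C2 * spread a z ^ (degree p - 1)"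
    if "x \<in> cball a (cmod (z - a))" for x a z
  proof -
    have "(1 + cmod x) ^ degree (pderiv (pderiv p)) \<le> spread a z ^ degree (pderiv (pderiv p))"
      using nz[OF that] by (intro power_mono) auto
    also have "\<dots> \<le> spread a z ^ (degree p - 1)"
      by (intro power_increasing) (auto simp: degree_pderiv)
    finally show ?thesis using C2 by (intro order_trans[OF C2(2)] mult_left_mono) auto
  qed
  have d1: "cmod (poly p x - poly p a) \<le> (C1 * spread a z ^ (degree p - 1)) * cmod (x - a)"
    if "x \<in> cball a (cmod (z - a))" for x a z
    by (rule field_differentiable_bound[of "cball a (cmod (z - a))" "poly p" "poly (pderiv p)"])
       (use b1 that in \<open>auto intro!: has_field_derivative_at_within poly_DERIV\<close>)
  have d2: "cmod (poly (pderiv p) x - poly (pderiv p) a) \<le> (C2 * spread a z ^ (degree p - 1)) * cmod (x - a)"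
    if "x \<in> cball a (cmod (z - a))" for x a z
    by (rule field_differentiable_bound[of "cball a (cmod (z - a))" "poly (pderiv p)" "poly (pderiv (pderiv p))"])
       (use b2 that in \<open>auto intro!: has_field_derivative_at_within poly_DERIV\<close>)
  have d3: "cmod (poly p z - poly p a - poly (pderiv p) a * (z - a))
       \<le> (C2 * spread a z ^ (degree p - 1) * cmod (z - a)) * cmod (z - a)" for a z
  proof -
    have "cmod ((poly p z - poly (pderiv p) a * z) - (poly p a - poly (pderiv p) a * a))
      \<le> (C2 * spread a z ^ (degree p - 1) * cmod (z - a)) * cmod (z - a)"
    proof (rule field_differentiable_bound[of "cball a (cmod (z - a))" "\<lambda>x. poly p x - poly (pderiv p) a * x" "\<lambda>x. poly (pderiv p) x - poly (pderiv p) a"])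
      fix x assume x: "x \<in> cball a (cmod (z - a))"
      show "((\<lambda>x. poly p x - poly (pderiv p) a * x) has_field_derivative poly (pderiv p) x - poly (pderiv p) a) (at x within cball a (cmod (z - a)))"
        by (rule has_field_derivative_at_within) (auto intro!: derivative_eq_intros)
      have "cmod (x - a) \<le> cmod (z - a)" using x by (simp add: dist_norm norm_minus_commute)
      then show "cmod (poly (pderiv p) x - poly (pderiv p) a) \<le> C2 * spread a z ^ (degree p - 1) * cmod (z - a)"
        using C2(1) by (intro order_trans[OF d2[OF x]] mult_left_mono) auto
    qed (auto simp: dist_norm norm_minus_commute)
    then show ?thesis by (simp add: algebra_simps)
  qed
  define C where "C = max C1 C2"
  have CC: "C1 * spread a z ^ n \<le> C * spread a z ^ n"
    "C2 * spread a z ^ n \<le> C * spread a z ^ n" for a z n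
    by (auto intro!: mult_right_mono simp: C_def)
  show ?thesis
  proof (rule that)
    show "C \<ge> 0" using C1 by (simp add: C_def)
    fix a z
    have zz: "z \<in> cball a (cmod (z - a))" "a \<in> cball a (cmod (z - a))" by (auto simp: dist_norm norm_minus_commute)
    show "cmod (poly p z - poly p a) \<le> C * spread a z ^ (degree p - 1) * cmod (z - a)"
      by (rule order_trans[OF d1[OF zz(1)]]) (intro mult_right_mono CC, auto)
    show "cmod (poly (pderiv p) a) \<le> C * spread a z ^ (degree p - 1)"
      by (rule order_trans[OF b1[OF zz(2)] CC(1)])
    show "cmod (poly p z - poly p a - poly (pderiv p) a * (z - a))
       \<le> C * spread a z ^ (degree p - 1) * (cmod (z - a))\<^sup>2"
      unfolding power2_eq_square mult.assoc[symmetric]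
      by (rule order_trans[OF d3]) (intro mult_right_mono CC, auto)
  qed
qed

text \<open>Subtracting the terms that are holomorphic or antiholomorphic in \<open>z\<close> from
  \<open>p * cnj q\<close> leaves \<open>A * cnj B\<close>, with \<open>A\<close> and
  \<open>B\<close> the increments of \<open>p\<close> and \<open>q\<close> from \<open>a\<close> to
  \<open>z\<close>. Each increment is of first order in \<open>z - a\<close>; replacing both by
  their linear parts gives the main term and a cubic error.\<close>

lemma mixed_poly:
  fixes p q :: "complex poly"
  assumes deg: "degree p + degree q \<le> e + 2"
  shows "mixed e (\<lambda>z. Re (poly p z * cnj (poly q z))) (\<lambda>z. Re (poly (pderiv p) z * cnj (poly (pderiv q) z)))"
proof -
  obtain C1 where C1: "C1 \<ge> 0"
    "\<And>a z. cmod (poly p z - poly p a) \<le> C1 * spread a z ^ (degree p - 1) * cmod (z - a)"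
    "\<And>a z. cmod (poly (pderiv p) a) \<le> C1 * spread a z ^ (degree p - 1)"
    "\<And>a z. cmod (poly p z - poly p a - poly (pderiv p) a * (z - a))
       \<le> C1 * spread a z ^ (degree p - 1) * (cmod (z - a))\<^sup>2"
    by (rule poly_taylor_bounds[of p]) blast
  obtain C2 where C2: "C2 \<ge> 0"
    "\<And>a z. cmod (poly q z - poly q a) \<le> C2 * spread a z ^ (degree q - 1) * cmod (z - a)"
    "\<And>a z. cmod (poly (pderiv q) a) \<le> C2 * spread a z ^ (degree q - 1)"
    "\<And>a z. cmod (poly q z - poly q a - poly (pderiv q) a * (z - a))
       \<le> C2 * spread a z ^ (degree q - 1) * (cmod (z - a))\<^sup>2"
    by (rule poly_taylor_bounds[of q]) blast
  define C where "C = 2 * C1 * C2"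
  show ?thesis
    unfolding mixed_def
  proof (intro exI[of _ C] conjI allI)
    show "C \<ge> 0" using C1 C2 by (simp add: C_def)
    fix a
    show "\<exists>h. h holomorphic_on UNIV \<and> h a = 0 \<and> (\<forall>z.
     \<bar>Re (poly p z * cnj (poly q z)) - Re (poly p a * cnj (poly q a)) - Re (h z)\<bar> \<le> C * spread a z ^ e * (cmod (z - a))\<^sup>2 \<and>
     \<bar>Re (poly p z * cnj (poly q z)) - Re (poly p a * cnj (poly q a)) - Re (h z) - Re (poly (pderiv p) a * cnj (poly (pderiv q) a)) * (cmod (z - a))\<^sup>2\<bar>
       \<le> C * spread a z ^ e * (cmod (z - a)) ^ 3)"
    proof (intro exI[of _ "\<lambda>z. cnj (poly q a) * (poly p z - poly p a) + cnj (poly p a) * (poly q z - poly q a)"] conjI allI)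
      show "(\<lambda>z. cnj (poly q a) * (poly p z - poly p a) + cnj (poly p a) * (poly q z - poly q a)) holomorphic_on UNIV"
        by (intro holomorphic_intros)
      show "cnj (poly q a) * (poly p a - poly p a) + cnj (poly p a) * (poly q a - poly q a) = 0" by simp
      fix z
      define X where "X = 1 + cmod a + cmod (z - a)"
      define w where "w = cmod (z - a)"
      define A where "A = poly p z - poly p a"
      define B where "B = poly q z - poly q a"
      define A' where "A' = poly (pderiv p) a * (z - a)"
      define B' where "B' = poly (pderiv q) a * (z - a)"
      have X1: "X \<ge> 1" by (simp add: X_def)
      have w0: "w \<ge> 0" by (simp add: w_def)
      have eq: "Re (poly p z * cnj (poly q z)) - Re (poly p a * cnj (poly q a))
          - Re (cnj (poly q a) * (poly p z - poly p a) + cnj (poly p a) * (poly q z - poly q a)) = Re (A * cnj B)"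
        by (simp add: A_def B_def algebra_simps)
      have eq2: "Re (poly (pderiv p) a * cnj (poly (pderiv q) a)) * (cmod (z - a))\<^sup>2 = Re (A' * cnj B')"
      proof -
        have "A' * cnj B' = (poly (pderiv p) a * cnj (poly (pderiv q) a)) * ((z - a) * cnj (z - a))"
          by (simp add: A'_def B'_def mult_ac)
        also have "\<dots> = (poly (pderiv p) a * cnj (poly (pderiv q) a)) * of_real ((cmod (z - a))\<^sup>2)"
          by (simp only: complex_norm_square)
        finally show ?thesis by simp
      qed
      have "cmod (A * cnj B) \<le> C * X ^ e * w\<^sup>2 \<and> cmod (A * cnj B - A' * cnj B') \<le> C * X ^ e * w ^ 3"
      \<comment> \<open>For a constant factor the truncated \<open>degree - 1\<close> is 0 instead
        of -1, and the exponents could exceed \<open>e\<close>; but then both products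
        vanish.\<close>
      proof (cases "degree p = 0 \<or> degree q = 0")
        case True
        have "pderiv p = 0 \<and> A = 0" if "degree p = 0"
          using that by (auto simp: A_def pderiv_eq_0_iff elim: degree_eq_zeroE)
        moreover have "pderiv q = 0 \<and> B = 0" if "degree q = 0"
          using that by (auto simp: B_def pderiv_eq_0_iff elim: degree_eq_zeroE)
        ultimately have "A * cnj B = 0" "A' * cnj B' = 0" using True by (auto simp: A'_def B'_def)
        then show ?thesis using C1 C2 w0 X1 by (auto simp: C_def)
      next
        case False
        define i j where "i = degree p - 1" and "j = degree q - 1"
        have "X ^ i * X ^ j \<le> X ^ e"
          using False deg X1 unfolding power_add[symmetric] i_def j_def by (intro power_increasing) auto
        then have XX: "(C1 * C2) * (X ^ i * X ^ j) \<le> (C1 * C2) * X ^ e" using C1 C2 by (intro mult_left_mono) auto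
        have bA: "cmod A \<le> C1 * X ^ i * w" "cmod A' \<le> C1 * X ^ i * w" "cmod (A - A') \<le> C1 * X ^ i * w\<^sup>2"
          using C1(2)[of z a] C1(4)[of z a] mult_right_mono[OF C1(3)[of a z], of w]
          by (auto simp: A_def A'_def X_def w_def i_def norm_mult)
        have bB: "cmod B \<le> C2 * X ^ j * w" "cmod B' \<le> C2 * X ^ j * w" "cmod (B - B') \<le> C2 * X ^ j * w\<^sup>2"
          using C2(2)[of z a] C2(4)[of z a] mult_right_mono[OF C2(3)[of a z], of w]
          by (auto simp: B_def B'_def X_def w_def j_def norm_mult)
        have nn: "0 \<le> C1 * X ^ i * w" "0 \<le> C1 * X ^ i * w\<^sup>2" "0 \<le> C2 * X ^ j * w"
          using C1 C2 X1 w0 by auto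
        have "cmod (A * cnj B) \<le> (C1 * X ^ i * w) * (C2 * X ^ j * w)"
          unfolding norm_mult using bA bB nn by (intro mult_mono) auto
        also have "\<dots> = ((C1 * C2) * (X ^ i * X ^ j)) * w\<^sup>2" by (simp add: power2_eq_square)
        also have "\<dots> \<le> ((C1 * C2) * X ^ e) * w\<^sup>2" by (intro mult_right_mono XX) auto
        also have "\<dots> \<le> C * X ^ e * w\<^sup>2" using C1 C2 X1 by (auto simp: C_def intro!: mult_right_mono)
        finally have one: "cmod (A * cnj B) \<le> C * X ^ e * w\<^sup>2" .
        have "A * cnj B - A' * cnj B' = (A - A') * cnj B + A' * cnj (B - B')" by (simp add: algebra_simps)
        then have "cmod (A * cnj B - A' * cnj B') \<le> cmod (A - A') * cmod B + cmod A' * cmod (B - B')"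
          by (metis complex_mod_cnj norm_mult norm_triangle_ineq)
        also have "\<dots> \<le> (C1 * X ^ i * w\<^sup>2) * (C2 * X ^ j * w) + (C1 * X ^ i * w) * (C2 * X ^ j * w\<^sup>2)"
          using bA bB nn by (intro add_mono mult_mono) auto
        also have "\<dots> = 2 * ((C1 * C2) * (X ^ i * X ^ j)) * w ^ 3" by (simp add: power2_eq_square power3_eq_cube)
        also have "\<dots> \<le> 2 * ((C1 * C2) * X ^ e) * w ^ 3" using w0 by (intro mult_right_mono mult_left_mono XX) auto
        finally show ?thesis using one by (simp add: C_def mult.assoc)
      qed
      then have fin: "\<bar>Re (A * cnj B)\<bar> \<le> C * X ^ e * w\<^sup>2" "\<bar>Re (A * cnj B) - Re (A' * cnj B')\<bar> \<le> C * X ^ e * w ^ 3"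
        using abs_Re_le_cmod[of "A * cnj B"] abs_Re_le_cmod[of "A * cnj B - A' * cnj B'"] by auto
      show "\<bar>Re (poly p z * cnj (poly q z)) - Re (poly p a * cnj (poly q a)) - Re (cnj (poly q a) * (poly p z - poly p a) + cnj (poly p a) * (poly q z - poly q a))\<bar>
         \<le> C * spread a z ^ e * (cmod (z - a))\<^sup>2"
        unfolding eq using fin(1) by (simp add: X_def w_def)
      show "\<bar>Re (poly p z * cnj (poly q z)) - Re (poly p a * cnj (poly q a)) - Re (cnj (poly q a) * (poly p z - poly p a) + cnj (poly p a) * (poly q z - poly q a))
            - Re (poly (pderiv p) a * cnj (poly (pderiv q) a)) * (cmod (z - a))\<^sup>2\<bar>
         \<le> C * spread a z ^ e * (cmod (z - a)) ^ 3"
        unfolding eq eq2 using fin(2) by (simp add: X_def w_def)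
    qed
  qed
qed

text \<open>The cubic error and the lower bound of \<open>L\<close> have the same growth in
  \<open>a\<close>, so one radius \<open>r\<close> gives roundness at every point of the plane.
  Multiplying the weight by a large \<open>t\<close> does not affect roundness and raises the mass
  above the threshold 40.\<close>

theorem kernel_bound_mixed:
  assumes mx: "mixed e \<phi> L" and c\<phi>: "continuous_on UNIV \<phi>" and m: "m > 0"
    and L: "\<And>z. L z \<ge> m * (1 + cmod z) ^ e"
  shows "\<exists>t0>0. \<forall>t\<ge>t0. kernel_bound UNIV (\<lambda>z. t * \<phi> z) 4"
proof -
  obtain C h where C: "C \<ge> 0" and h: "\<And>a. h a holomorphic_on UNIV" "\<And>a. h a a = 0"
     "\<And>a z. \<bar>\<phi> z - \<phi> a - Re (h a z) - L a * (cmod (z - a))\<^sup>2\<bar> \<le> C * spread a z ^ e * (cmod (z - a)) ^ 3"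
    by (rule mixedE[OF mx]) blast
  \<comment> \<open>\<open>r \<le> 1 / 2\<close> gives
    \<open>spread a z \<le> 2 * (1 + cmod a)\<close> on the ball of radius \<open>2 * r\<close>; the
    second entry makes the cubic error at most one percent of the quadratic term.\<close>
  define r where "r = min (1/2) (m / (200 * (C + 1) * 2 ^ e))"
  have r: "r > 0" "r \<le> 1/2"
    using m C unfolding r_def by (simp, intro min.cobounded1)
  have rC: "C * 2 ^ e * (2 * r) \<le> m / 100"
  proof -
    have "C * 2 ^ e * (2 * r) \<le> (C + 1) * 2 ^ e * (2 * (m / (200 * (C + 1) * 2 ^ e)))"
      using C r by (intro mult_mono) (auto simp: r_def)
    also have "\<dots> = m / 100" using C by (simp add: field_simps add_nonneg_eq_0_iff)
    finally show ?thesis .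
  qed
  have Lm: "L a \<ge> m" for a
  proof -
    have "m * 1 \<le> m * (1 + cmod a) ^ e" using m by (intro mult_left_mono one_le_power) auto
    then show ?thesis using L[of a] by simp
  qed
  have rd: "round_at \<phi> a (2 * r) (L a)" for a
    unfolding round_at_def
  proof (intro exI[of _ "h a"] conjI ballI)
    fix z assume "z \<in> ball a (2 * r)"
    then have w: "cmod (z - a) \<le> 2 * r" by (simp add: dist_norm norm_minus_commute)
    have "1 + cmod a + cmod (z - a) \<le> 2 * (1 + cmod a)"
      using w r by (smt (verit) norm_ge_zero field_sum_of_halves)
    then have "spread a z ^ e \<le> (2 * (1 + cmod a)) ^ e"
      by (intro power_mono) auto
    then have "C * spread a z ^ e * (cmod (z - a) * (cmod (z - a))\<^sup>2)
       \<le> C * (2 * (1 + cmod a)) ^ e * ((2 * r) * (cmod (z - a))\<^sup>2)"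
      using w C r by (intro mult_mono mult_right_mono) auto
    also have "\<dots> = (C * 2 ^ e * (2 * r)) * ((1 + cmod a) ^ e * (cmod (z - a))\<^sup>2)"
      by (simp only: power_mult_distrib mult_ac)
    also have "\<dots> \<le> (m / 100) * ((1 + cmod a) ^ e * (cmod (z - a))\<^sup>2)"
      by (intro mult_right_mono rC) auto
    also have "\<dots> = (m * (1 + cmod a) ^ e) * (cmod (z - a))\<^sup>2 / 100" by simp
    also have "\<dots> \<le> L a * (cmod (z - a))\<^sup>2 / 100" by (intro divide_right_mono mult_right_mono L) auto
    finally show "\<bar>\<phi> z - \<phi> a - Re (h a z) - L a * (cmod (z - a))\<^sup>2\<bar> \<le> L a * (cmod (z - a))\<^sup>2 / 100"
      using h(3)[of z a] by (simp add: power3_eq_cube power2_eq_square)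
  qed (use h in \<open>auto intro: holomorphic_on_subset\<close>)
  define t0 where "t0 = 40 / (m * r\<^sup>2)"
  have t0: "t0 > 0" using m r by (simp add: t0_def)
  have "kernel_bound UNIV (\<lambda>z. t * \<phi> z) 4" if t: "t \<ge> t0" for t
  proof (rule kernel_bound_entire[where r = r and m = "\<lambda>a. t * L a"])
    show "continuous_on UNIV (\<lambda>z. t * \<phi> z)" by (intro continuous_intros c\<phi>)
    show "round_at (\<lambda>z. t * \<phi> z) a (2 * r) (t * L a)" for a
      using t t0 by (intro round_at_scale rd) auto
    fix a
    have "40 = t0 * (m * r\<^sup>2)" using m r by (simp add: t0_def)
    also have "\<dots> \<le> t * (L a * r\<^sup>2)" using t t0 m Lm[of a] by (intro mult_mono mult_right_mono) auto
    finally show "40 \<le> t * L a * r\<^sup>2" by (simp add: mult.assoc)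
  qed (use r in auto)
  then show ?thesis using t0 by blast
qed

section \<open>Peak functions from families of one-variable functions\<close>

text \<open>A pointwise notion with the full filter \<open>at z\<close>, so that sums, products and
  compositions need no ambient set; it implies the condition of \<open>holomorphic2_on\<close> at
  the points of any set.\<close>

definition cdiff :: "(complex \<times> complex \<Rightarrow> complex) \<Rightarrow> complex \<times> complex \<Rightarrow> bool" where
  "cdiff f z \<longleftrightarrow> (\<exists>a b. (f has_derivative (\<lambda>h. a * fst h + b * snd h)) (at z))"

lemma cdiff_const: "cdiff (\<lambda>z. c) z"
  unfolding cdiff_def by (intro exI[of _ 0]) simp

lemma cdiff_fst: "cdiff fst z"
proof -
  have "(fst has_derivative (\<lambda>h. 1 * fst h + 0 * snd h)) (at z)"
    using has_derivative_fst[OF has_derivative_ident[of "at z"]] by simp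
  then show ?thesis unfolding cdiff_def by blast
qed

lemma cdiff_snd: "cdiff snd z"
proof -
  have "(snd has_derivative (\<lambda>h. 0 * fst h + 1 * snd h)) (at z)"
    using has_derivative_snd[OF has_derivative_ident[of "at z"]] by simp
  then show ?thesis unfolding cdiff_def by blast
qed

lemma cdiff_add:
  assumes "cdiff f z" "cdiff g z"
  shows "cdiff (\<lambda>z. f z + g z) z"
proof -
  obtain a b c d where "(f has_derivative (\<lambda>h. a * fst h + b * snd h)) (at z)"
    "(g has_derivative (\<lambda>h. c * fst h + d * snd h)) (at z)" using assms unfolding cdiff_def by blast
  from has_derivative_add[OF this]
  have "((\<lambda>z. f z + g z) has_derivative (\<lambda>h. (a + c) * fst h + (b + d) * snd h)) (at z)"
    by (simp add: algebra_simps)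
  then show ?thesis unfolding cdiff_def by blast
qed

lemma cdiff_mult:
  assumes "cdiff f z" "cdiff g z"
  shows "cdiff (\<lambda>z. f z * g z) z"
proof -
  obtain a b c d where "(f has_derivative (\<lambda>h. a * fst h + b * snd h)) (at z)"
    "(g has_derivative (\<lambda>h. c * fst h + d * snd h)) (at z)" using assms unfolding cdiff_def by blast
  from has_derivative_mult[OF this]
  have "((\<lambda>z. f z * g z) has_derivative (\<lambda>h. (f z * c + a * g z) * fst h + (f z * d + b * g z) * snd h)) (at z)"
    by (simp add: algebra_simps)
  then show ?thesis unfolding cdiff_def by blast
qed

lemma cdiff_compose:
  assumes "g holomorphic_on UNIV" "cdiff f z"
  shows "cdiff (\<lambda>z. g (f z)) z"
proof -
  obtain a b where f: "(f has_derivative (\<lambda>h. a * fst h + b * snd h)) (at z)" using assms unfolding cdiff_def by blast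
  obtain d where "(g has_field_derivative d) (at (f z))"
    using assms(1) by (metis UNIV_I at_within_open field_differentiable_def holomorphic_on_def open_UNIV)
  then have "(g has_derivative (\<lambda>h. d * h)) (at (f z))" by (simp add: has_field_derivative_def)
  from has_derivative_compose[OF f this]
  have "((\<lambda>z. g (f z)) has_derivative (\<lambda>h. (d * a) * fst h + (d * b) * snd h)) (at z)"
    by (simp add: algebra_simps)
  then show ?thesis unfolding cdiff_def by blast
qed

lemma cdiff_partials:
  assumes "(f has_derivative (\<lambda>h. a * fst h + b * snd h)) (at (x, y))"
  shows "((\<lambda>u. f (u, y)) has_field_derivative a) (at x)" "((\<lambda>u. f (x, u)) has_field_derivative b) (at y)"
proof -
  have "((\<lambda>u. (u, y)) has_derivative (\<lambda>h. (h, 0))) (at x)"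
    by (intro has_derivative_Pair has_derivative_ident has_derivative_const)
  from has_derivative_compose[OF this assms]
  show "((\<lambda>u. f (u, y)) has_field_derivative a) (at x)" by (simp add: has_field_derivative_def)
  have "((\<lambda>u. (x, u)) has_derivative (\<lambda>h. (0, h))) (at y)"
    by (intro has_derivative_Pair has_derivative_ident has_derivative_const)
  from has_derivative_compose[OF this assms]
  show "((\<lambda>u. f (x, u)) has_field_derivative b) (at y)" by (simp add: has_field_derivative_def)
qed

lemma deriv_bound_ball:
  assumes d: "\<And>u. u \<in> ball x (2 * r) \<Longrightarrow> (f has_field_derivative f' u) (at u)"
    and r: "r > 0" and b: "\<And>u. u \<in> ball x (2 * r) \<Longrightarrow> cmod (f u) \<le> B"
  shows "cmod (f' x) \<le> B / r"
proof -
  have hol: "f holomorphic_on ball x (2 * r)"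
    using d by (meson field_differentiable_at_within field_differentiable_def holomorphic_on_def)
  have sub: "cball x r \<subseteq> ball x (2 * r)" using r by auto
  have "norm ((deriv ^^ 1) f x) \<le> fact 1 * B / r ^ 1"
  proof (rule Cauchy_inequality)
    show "f holomorphic_on ball x r" using hol sub by (meson ball_subset_cball holomorphic_on_subset order_trans)
    show "continuous_on (cball x r) f" using hol sub holomorphic_on_imp_continuous_on continuous_on_subset by blast
    show "cmod (f u) \<le> B" if "cmod (x - u) = r" for u using b[of u] that r by (simp add: dist_norm)
  qed (use r in auto)
  moreover have "deriv f x = f' x" using d[of x] r by (simp add: DERIV_imp_deriv)
  ultimately show ?thesis by simp
qed

text \<open>Cauchy estimates on one-variable discs through \<open>z\<close> turn the geometric bound
  of the terms into one for both partial derivatives. The derivatives then converge uniformly near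
  \<open>z\<close>, and the series may be differentiated termwise.\<close>

lemma cdiff_suminf:
  fixes \<Psi> :: "nat \<Rightarrow> complex \<times> complex \<Rightarrow> complex"
  assumes S: "open S" and cd: "\<And>n z. z \<in> S \<Longrightarrow> cdiff (\<Psi> n) z"
    and b: "\<And>n z. z \<in> S \<Longrightarrow> cmod (\<Psi> n z) \<le> M * \<theta> ^ n" and \<theta>: "0 < \<theta>" "\<theta> < 1" and z: "z \<in> S"
  shows "cdiff (\<lambda>z. \<Sum>n. \<Psi> n z) z"
proof -
  from cd have "\<forall>n. \<forall>z\<in>S. \<exists>ab. (\<Psi> n has_derivative (\<lambda>h. fst ab * fst h + snd ab * snd h)) (at z)"
    unfolding cdiff_def by (metis fst_conv snd_conv)
  then obtain D where D: "\<And>n z. z \<in> S \<Longrightarrow> (\<Psi> n has_derivative (\<lambda>h. fst (D n z) * fst h + snd (D n z) * snd h)) (at z)"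
    by metis
  obtain e where e: "e > 0" "ball z e \<subseteq> S" using S z open_contains_ball by blast
  \<comment> \<open>A point of \<open>B\<close> moved by less than \<open>2 * r\<close> in one
    coordinate is within \<open>3 * r\<close> of \<open>z\<close>, hence still in the ball of radius
    \<open>e\<close>.\<close>
  define r where "r = e / 4"
  have r: "r > 0" using e by (simp add: r_def)
  define K where "K = M / r"
  define B where "B = ball z r"
  have inS: "(u, v) \<in> S" if "w \<in> B" "u \<in> ball (fst w) (2 * r)" "v = snd w" for u v w
  proof -
    have "dist z (u, v) \<le> dist z w + dist w (u, v)" by (rule dist_triangle)
    also have "dist w (u, v) = dist (fst w) u" using that(3) by (cases w) (simp add: dist_Pair_Pair)
    also have "dist z w + dist (fst w) u < e" using that r by (simp add: B_def r_def)
    finally show ?thesis using e by auto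
  qed
  have inS2: "(u, v) \<in> S" if "w \<in> B" "v \<in> ball (snd w) (2 * r)" "u = fst w" for u v w
  proof -
    have "dist z (u, v) \<le> dist z w + dist w (u, v)" by (rule dist_triangle)
    also have "dist w (u, v) = dist (snd w) v" using that(3) by (cases w) (simp add: dist_Pair_Pair)
    also have "dist z w + dist (snd w) v < e" using that r by (simp add: B_def r_def)
    finally show ?thesis using e by auto
  qed
  have BS: "B \<subseteq> S" using e r by (auto simp: B_def r_def)
  have b1: "cmod (fst (D n w)) \<le> K * \<theta> ^ n" if w: "w \<in> B" for n w
  proof -
    have "cmod (fst (D n (fst w, snd w))) \<le> (M * \<theta> ^ n) / r"
      by (rule deriv_bound_ball[of "fst w" r "\<lambda>u. \<Psi> n (u, snd w)" "\<lambda>u. fst (D n (u, snd w))"])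
         (use inS[OF w] b r in \<open>auto intro!: cdiff_partials(1)[OF D]\<close>)
    then show ?thesis by (simp add: K_def)
  qed
  have b2: "cmod (snd (D n w)) \<le> K * \<theta> ^ n" if w: "w \<in> B" for n w
  proof -
    have "cmod (snd (D n (fst w, snd w))) \<le> (M * \<theta> ^ n) / r"
      by (rule deriv_bound_ball[of "snd w" r "\<lambda>u. \<Psi> n (fst w, u)" "\<lambda>u. snd (D n (fst w, u))"])
         (use inS2[OF w] b r in \<open>auto intro!: cdiff_partials(2)[OF D]\<close>)
    then show ?thesis by (simp add: K_def)
  qed
  have geo: "summable (\<lambda>n. K * \<theta> ^ n)" using \<theta> by (intro summable_mult summable_geometric) auto
  have s1: "summable (\<lambda>n. fst (D n w))" if "w \<in> B" for w
    using b1[OF that] by (intro summable_comparison_test'[OF geo, of 0]) auto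
  have s2: "summable (\<lambda>n. snd (D n w))" if "w \<in> B" for w
    using b2[OF that] by (intro summable_comparison_test'[OF geo, of 0]) auto
  define T where "T = (\<lambda>n. \<Sum>i. K * \<theta> ^ (i + n))"
  have Tlim: "T \<longlonglongrightarrow> 0"
    unfolding T_def using suminf_exist_split2[OF geo] by simp
  have tail: "cmod ((\<Sum>i<n. c i) - (\<Sum>i. c i)) \<le> T n" if "\<And>i. cmod (c i) \<le> K * \<theta> ^ i" for c n
  proof -
    have sc: "summable c" using that by (intro summable_comparison_test'[OF geo, of 0]) auto
    have sn: "summable (\<lambda>i. cmod (c (i + n)))"
      by (rule summable_comparison_test'[OF summable_ignore_initial_segment[OF geo, of n], of 0]) (use that in auto)
    have "(\<Sum>i<n. c i) - (\<Sum>i. c i) = - (\<Sum>i. c (i + n))"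
      using suminf_split_initial_segment[OF sc, of n] by simp
    then have "cmod ((\<Sum>i<n. c i) - (\<Sum>i. c i)) \<le> (\<Sum>i. cmod (c (i + n)))"
      using summable_norm[OF sn] by simp
    also have "\<dots> \<le> T n" unfolding T_def
      by (intro suminf_le that sn summable_ignore_initial_segment[OF geo])
    finally show ?thesis .
  qed
  have "\<exists>g. \<forall>w\<in>B. (\<lambda>n. \<Psi> n w) sums g w \<and>
     (g has_derivative (\<lambda>h. (\<Sum>n. fst (D n w)) * fst h + (\<Sum>n. snd (D n w)) * snd h)) (at w within B)"
  proof (rule has_derivative_series)
    show "convex B" by (simp add: B_def)
    show "z \<in> B" using r by (simp add: B_def)
    show "(\<Psi> n has_derivative (\<lambda>h. fst (D n w) * fst h + snd (D n w) * snd h)) (at w within B)" if "w \<in> B" for n w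
      using D[of w n] BS that by (meson has_derivative_at_withinI subsetD)
    show "(\<lambda>n. \<Psi> n z) sums (\<Sum>n. \<Psi> n z)"
    proof (rule summable_sums, rule summable_comparison_test'[of "\<lambda>n. M * \<theta> ^ n" 0])
      show "summable (\<lambda>n. M * \<theta> ^ n)" using \<theta> by (intro summable_mult summable_geometric) simp
    qed (rule b[OF z])
  next
    fix \<epsilon> :: real assume "\<epsilon> > 0"
    then have "\<forall>\<^sub>F n in sequentially. T n < \<epsilon> / 2" using order_tendstoD(2)[OF Tlim, of "\<epsilon> / 2"] by simp
    then show "\<forall>\<^sub>F n in sequentially. \<forall>w\<in>B. \<forall>h. norm ((\<Sum>i<n. fst (D i w) * fst h + snd (D i w) * snd h)
        - ((\<Sum>n. fst (D n w)) * fst h + (\<Sum>n. snd (D n w)) * snd h)) \<le> \<epsilon> * norm h"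
    proof eventually_elim
      case (elim n)
      show ?case
      proof (intro ballI allI)
        fix w and h :: "complex \<times> complex" assume w: "w \<in> B"
        have "(\<Sum>i<n. fst (D i w) * fst h + snd (D i w) * snd h) - ((\<Sum>n. fst (D n w)) * fst h + (\<Sum>n. snd (D n w)) * snd h)
          = ((\<Sum>i<n. fst (D i w)) - (\<Sum>n. fst (D n w))) * fst h + ((\<Sum>i<n. snd (D i w)) - (\<Sum>n. snd (D n w))) * snd h"
          by (simp only: sum.distrib sum_distrib_right[symmetric] left_diff_distrib add_diff_add)
        also have "norm \<dots> \<le> cmod ((\<Sum>i<n. fst (D i w)) - (\<Sum>n. fst (D n w))) * cmod (fst h) + cmod ((\<Sum>i<n. snd (D i w)) - (\<Sum>n. snd (D n w))) * cmod (snd h)"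
          by (rule order_trans[OF norm_triangle_ineq]) (simp only: norm_mult order_refl)
        also have "\<dots> \<le> \<epsilon> / 2 * norm h + \<epsilon> / 2 * norm h"
        proof (intro add_mono mult_mono)
          show "cmod ((\<Sum>i<n. fst (D i w)) - (\<Sum>n. fst (D n w))) \<le> \<epsilon> / 2"
            using tail[of "\<lambda>i. fst (D i w)" n, OF b1[OF w]] elim by linarith
          show "cmod ((\<Sum>i<n. snd (D i w)) - (\<Sum>n. snd (D n w))) \<le> \<epsilon> / 2"
            using tail[of "\<lambda>i. snd (D i w)" n, OF b2[OF w]] elim by linarith
          show "cmod (fst h) \<le> norm h" "cmod (snd h) \<le> norm h"
            by (cases h; simp add: norm_fst_le norm_snd_le)+
        qed (use \<open>\<epsilon> > 0\<close> in auto)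
        finally show "norm ((\<Sum>i<n. fst (D i w) * fst h + snd (D i w) * snd h)
          - ((\<Sum>n. fst (D n w)) * fst h + (\<Sum>n. snd (D n w)) * snd h)) \<le> \<epsilon> * norm h" by simp
      qed
    qed
  qed
  then obtain g where g: "\<And>w. w \<in> B \<Longrightarrow> (\<lambda>n. \<Psi> n w) sums g w"
     "\<And>w. w \<in> B \<Longrightarrow> (g has_derivative (\<lambda>h. (\<Sum>n. fst (D n w)) * fst h + (\<Sum>n. snd (D n w)) * snd h)) (at w within B)"
    by blast
  have zB: "z \<in> B" using r by (simp add: B_def)
  have "(g has_derivative (\<lambda>h. (\<Sum>n. fst (D n z)) * fst h + (\<Sum>n. snd (D n z)) * snd h)) (at z)"
    using g(2)[OF zB] zB by (simp add: B_def at_within_open[OF _ open_ball])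
  then have "((\<lambda>z. \<Sum>n. \<Psi> n z) has_derivative (\<lambda>h. (\<Sum>n. fst (D n z)) * fst h + (\<Sum>n. snd (D n z)) * snd h)) (at z)"
    by (rule has_derivative_transform_within_open[of _ _ _ _ B])
       (use g(1) zB in \<open>auto simp: B_def sums_unique\<close>)
  then show ?thesis unfolding cdiff_def by blast
qed

section \<open>Geometric summation over dyadic scales\<close>

text \<open>\<open>x\<close> is the critical scale: after it \<open>u\<close> is close to 1, before
  it \<open>u\<close> is small, each at a geometric rate. In units of \<open>\<theta> ^ x\<close>
  the tail contributes about \<open>1 / (1 - \<theta>)\<close>, unbounded as \<open>\<theta>\<close>
  tends to 1, while the losses stay bounded. The uniform bound \<open>C\<close> on
  \<open>1 - u\<close> affects only \<open>C5\<close>, not the choice of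
  \<open>\<theta>\<close>.\<close>

lemma weighted_series_estimate:
  fixes C C2 C3 \<kappa> :: real
  assumes "C \<ge> 0" "C2 \<ge> 0" "C3 \<ge> 0" and \<kappa>: "0 < \<kappa>" "\<kappa> < 1"
  obtains \<theta> C5 where "0 < \<theta>" "\<theta> < 1" "C5 > 0"
    "\<And>(u :: nat \<Rightarrow> complex) x. (\<And>n. cmod (1 - u n) \<le> C) \<Longrightarrow> (\<And>j. cmod (1 - u (x + j)) \<le> C2 * (1/2) ^ j) \<Longrightarrow>
       (\<And>j. j < x \<Longrightarrow> cmod (u (x - 1 - j)) \<le> C3 * \<kappa> ^ j) \<Longrightarrow>
       Re (\<Sum>n. of_real (\<theta> ^ n) * u n) \<ge> \<theta> ^ x \<and> cmod (\<Sum>n. of_real (\<theta> ^ n) * u n) \<le> C5 * \<theta> ^ x"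
proof -
  \<comment> \<open>In units of \<open>\<theta> ^ x\<close>: the 1 to be left over, the loss from
    the tail where \<open>u\<close> is not exactly 1, and the loss from the head.\<close>
  define Y where "Y = 1 + 2 * C2 + 2 * C3 / (1 - \<kappa>)"
  have Y: "Y \<ge> 1" using assms by (simp add: Y_def)
  define y where "y = 1 / (Y + 1)"
  have y: "y > 0" "y * (Y + 1) = 1" using Y by (auto simp: y_def)
  \<comment> \<open>\<open>1 - y\<close> makes \<open>1 / (1 - \<theta>)\<close> exceed
    \<open>Y\<close>; \<open>(1 + \<kappa>) / 2\<close> keeps \<open>\<theta> - \<kappa>\<close> at
    least \<open>(1 - \<kappa>) / 2\<close>, so the bound for the head does not depend on
    \<open>\<theta>\<close>.\<close>
  define \<theta> where "\<theta> = max ((1 + \<kappa>) / 2) (1 - y)"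
  have th1: "\<theta> < 1" using \<kappa> y by (simp add: \<theta>_def)
  have th2: "\<theta> \<ge> (1 + \<kappa>) / 2" "\<theta> \<ge> 1 - y" by (auto simp: \<theta>_def)
  have th0: "\<theta> > 0" using th2(1) \<kappa> by simp
  have thk: "\<kappa> < \<theta>" using th2(1) \<kappa> by simp
  have thY: "1 / (1 - \<theta>) \<ge> Y"
  proof -
    have "(1 - \<theta>) * (Y + 1) \<le> y * (Y + 1)" using th2(2) Y by (intro mult_right_mono) auto
    then have "Y * (1 - \<theta>) \<le> 1" using th1 y by (simp add: algebra_simps)
    then show ?thesis using th1 by (simp add: pos_le_divide_eq)
  qed
  define C5 where "C5 = (1 + C) / (1 - \<theta>) + 2 * C3 / (1 - \<kappa>)"
  have C5: "C5 > 0" using assms th1 by (auto simp: C5_def intro!: add_pos_nonneg)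
  show ?thesis
  proof (rule that[OF th0 th1 C5])
    fix u :: "nat \<Rightarrow> complex" and x
    assume uC: "\<And>n. cmod (1 - u n) \<le> C" and uhi: "\<And>j. cmod (1 - u (x + j)) \<le> C2 * (1/2) ^ j"
      and ulo: "\<And>j. j < x \<Longrightarrow> cmod (u (x - 1 - j)) \<le> C3 * \<kappa> ^ j"
    define v where "v = (\<lambda>n. of_real (\<theta> ^ n) * u n)"
    have ub: "cmod (u n) \<le> 1 + C" for n
      using norm_triangle_ineq4[of 1 "1 - u n"] uC[of n] by simp
    have vb: "cmod (v n) \<le> (1 + C) * \<theta> ^ n" for n
      using ub[of n] th0 by (simp add: v_def norm_mult norm_power mult.commute mult_left_mono)
    have geo: "summable (\<lambda>n. \<theta> ^ n)" using th0 th1 by (intro summable_geometric) auto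
    have sv: "summable v"
      by (rule summable_comparison_test'[OF summable_mult[OF geo, of "1 + C"], of 0]) (use vb in auto)
    have split: "(\<Sum>n. v n) = (\<Sum>j. v (j + x)) + (\<Sum>n<x. v n)"
      by (rule suminf_split_initial_segment[OF sv])
    have svx: "summable (\<lambda>j. v (j + x))" using summable_ignore_initial_segment[OF sv] .
    have lo: "cmod (\<Sum>n<x. v n) \<le> \<theta> ^ x * (2 * C3 / (1 - \<kappa>))"
    proof -
      have "cmod (\<Sum>n<x. v n) \<le> (\<Sum>n<x. cmod (v n))" by (rule norm_sum)
      also have "\<dots> = (\<Sum>j<x. cmod (v (x - 1 - j)))"
        by (rule sum.reindex_bij_witness[of _ "\<lambda>j. x - 1 - j" "\<lambda>j. x - 1 - j"]) auto
      also have "\<dots> \<le> (\<Sum>j<x. \<theta> ^ x * (C3 / \<theta> * (\<kappa> / \<theta>) ^ j))"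
      proof (rule sum_mono)
        fix j assume "j \<in> {..<x}"
        then have j: "j < x" by simp
        have "cmod (v (x - 1 - j)) = \<theta> ^ (x - 1 - j) * cmod (u (x - 1 - j))"
          using th0 by (simp add: v_def norm_mult norm_power)
        also have "\<dots> \<le> \<theta> ^ (x - 1 - j) * (C3 * \<kappa> ^ j)" using ulo[OF j] th0 by (intro mult_left_mono) auto
        also have "\<theta> ^ (x - 1 - j) = \<theta> ^ x / (\<theta> * \<theta> ^ j)"
        proof -
          have "x = (x - 1 - j) + Suc j" using j by simp
          then have "\<theta> ^ x = \<theta> ^ (x - 1 - j) * \<theta> ^ Suc j" by (metis power_add)
          then show ?thesis using th0 by simp
        qed
        finally show "cmod (v (x - 1 - j)) \<le> \<theta> ^ x * (C3 / \<theta> * (\<kappa> / \<theta>) ^ j)"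
          by (simp add: power_divide mult_ac)
      qed
      also have "\<dots> = \<theta> ^ x * (C3 / \<theta> * (\<Sum>j<x. (\<kappa> / \<theta>) ^ j))" by (simp add: sum_distrib_left)
      also have "\<dots> \<le> \<theta> ^ x * (C3 / \<theta> * (1 / (1 - \<kappa> / \<theta>)))"
      proof -
        have q: "0 \<le> \<kappa> / \<theta>" "\<kappa> / \<theta> < 1" using \<kappa> th0 thk by auto
        have "(\<Sum>j<x. (\<kappa> / \<theta>) ^ j) \<le> (\<Sum>j. (\<kappa> / \<theta>) ^ j)" using q by (intro sum_le_suminf summable_geometric) auto
        also have "\<dots> = 1 / (1 - \<kappa> / \<theta>)" using q by (intro suminf_geometric) auto
        finally show ?thesis using assms th0 by (intro mult_left_mono) auto
      qed
      also have "C3 / \<theta> * (1 / (1 - \<kappa> / \<theta>)) = C3 / (\<theta> - \<kappa>)" using th0 thk by (simp add: divide_simps right_diff_distrib)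
      also have "C3 / (\<theta> - \<kappa>) \<le> C3 / ((1 - \<kappa>) / 2)"
        using assms th2(1) thk by (intro divide_left_mono) (auto simp: divide_simps)
      finally show ?thesis using th0 by (simp add: mult.commute)
    qed
    have vx: "v (j + x) = of_real (\<theta> ^ x) * (of_real (\<theta> ^ j) * u (x + j))" for j
      by (simp add: v_def power_add add.commute mult_ac)
    have half: "(\<lambda>j. (1/2::real) ^ j) sums 2" using geometric_sums[of "1/2::real"] by simp
    have "Re (\<Sum>j. v (j + x)) = (\<Sum>j. Re (v (j + x)))" using Re_suminf[OF svx] by simp
    also have "\<dots> \<ge> (\<Sum>j. \<theta> ^ x * (\<theta> ^ j - C2 * (1/2) ^ j))"
    proof (rule suminf_le)
      fix j
      have "Re (u (x + j)) \<ge> 1 - C2 * (1/2) ^ j"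
        using uhi[of j] abs_Re_le_cmod[of "1 - u (x + j)"] by simp
      then have "\<theta> ^ j * Re (u (x + j)) \<ge> \<theta> ^ j * (1 - C2 * (1/2) ^ j)" using th0 by (intro mult_left_mono) auto
      moreover have "\<theta> ^ j * (C2 * (1/2) ^ j) \<le> 1 * (C2 * (1/2) ^ j)"
        using th0 th1 assms by (intro mult_right_mono power_le_one) auto
      ultimately have "\<theta> ^ j * Re (u (x + j)) \<ge> \<theta> ^ j - C2 * (1/2) ^ j" by (simp add: right_diff_distrib)
      then have "\<theta> ^ x * (\<theta> ^ j - C2 * (1/2) ^ j) \<le> \<theta> ^ x * (\<theta> ^ j * Re (u (x + j)))"
        using th0 by (intro mult_left_mono) auto
      then show "\<theta> ^ x * (\<theta> ^ j - C2 * (1/2) ^ j) \<le> Re (v (j + x))" unfolding vx by (simp del: of_real_power)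
    next
      show "summable (\<lambda>j. \<theta> ^ x * (\<theta> ^ j - C2 * (1/2) ^ j))"
        by (intro summable_mult summable_diff geo sums_summable[OF half])
      show "summable (\<lambda>j. Re (v (j + x)))" using svx by (rule summable_Re)
    qed
    also have "(\<Sum>j. \<theta> ^ x * (\<theta> ^ j - C2 * (1/2) ^ j)) = \<theta> ^ x * (1 / (1 - \<theta>) - C2 * 2)"
      by (rule sums_unique[symmetric], intro sums_mult sums_diff half geometric_sums) (use th0 th1 in auto)
    finally have re: "Re (\<Sum>j. v (j + x)) \<ge> \<theta> ^ x * (1 / (1 - \<theta>) - C2 * 2)" .
    have "Re (\<Sum>n. v n) \<ge> Re (\<Sum>j. v (j + x)) - cmod (\<Sum>n<x. v n)"
      unfolding split using abs_Re_le_cmod[of "\<Sum>n<x. v n"] by (simp add: abs_le_iff)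
    also have "Re (\<Sum>j. v (j + x)) - cmod (\<Sum>n<x. v n) \<ge> \<theta> ^ x * (1 / (1 - \<theta>) - C2 * 2 - 2 * C3 / (1 - \<kappa>))"
      using re lo by (simp add: algebra_simps)
    also (xtrans) have "\<theta> ^ x * (1 / (1 - \<theta>) - C2 * 2 - 2 * C3 / (1 - \<kappa>)) \<ge> \<theta> ^ x * 1"
      using thY th0 unfolding Y_def by (intro mult_left_mono) auto
    finally have one: "Re (\<Sum>n. v n) \<ge> \<theta> ^ x" by simp
    have "cmod (\<Sum>j. v (j + x)) \<le> (\<Sum>j. (1 + C) * \<theta> ^ x * \<theta> ^ j)"
    proof -
      have s: "summable (\<lambda>j. (1 + C) * \<theta> ^ x * \<theta> ^ j)" by (intro summable_mult geo)
      have le: "cmod (v (j + x)) \<le> (1 + C) * \<theta> ^ x * \<theta> ^ j" for j using vb[of "j + x"] by (simp add: power_add mult_ac)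
      have sn: "summable (\<lambda>j. cmod (v (j + x)))"
        by (rule summable_comparison_test'[OF s, of 0]) (use le in auto)
      show ?thesis using summable_norm[OF sn] suminf_le[OF le sn s] by linarith
    qed
    also have "\<dots> = (1 + C) * \<theta> ^ x * (1 / (1 - \<theta>))"
      by (rule sums_unique[symmetric], intro sums_mult geometric_sums) (use th0 th1 in auto)
    finally have "cmod (\<Sum>n. v n) \<le> (1 + C) * \<theta> ^ x * (1 / (1 - \<theta>)) + \<theta> ^ x * (2 * C3 / (1 - \<kappa>))"
      unfolding split using lo norm_triangle_ineq[of "\<Sum>j. v (j + x)" "\<Sum>n<x. v n"] by linarith
    also have "\<dots> = C5 * \<theta> ^ x"
    proof -
      have "p * q * (1 / r) + q * s = (p / r + s) * q" for p q r s :: real by (simp add: algebra_simps)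
      then show ?thesis unfolding C5_def .
    qed
    finally show "Re (\<Sum>n. of_real (\<theta> ^ n) * u n) \<ge> \<theta> ^ x \<and> cmod (\<Sum>n. of_real (\<theta> ^ n) * u n) \<le> C5 * \<theta> ^ x"
      using one by (simp add: v_def)
  qed
qed

section \<open>Estimates for a single term of the series\<close>

text \<open>The mean of \<open>exp (s x)\<close> over \<open>0 \<le> s \<le> 1\<close>, bounded and decaying on the left half-plane.\<close>
definition expq :: "complex \<Rightarrow> complex" where
  "expq x = (if x = 0 then 1 else (exp x - 1) / x)"

lemma expq_holomorphic: "expq holomorphic_on UNIV"
proof -
  have "(\<lambda>z. if z = 0 then deriv exp 0 else (exp z - exp 0) / (z - 0)) holomorphic_on (UNIV :: complex set)"
    by (rule pole_lemma_open) (auto intro!: holomorphic_intros)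
  moreover have "(\<lambda>z. if z = 0 then deriv exp 0 else (exp z - exp 0) / (z - 0)) = expq"
    by (auto simp: expq_def fun_eq_iff DERIV_imp_deriv[OF DERIV_exp])
  ultimately show ?thesis by simp
qed

lemma norm_exp_minus_one: "cmod (exp x - 1) \<le> exp (max 0 (Re x)) * cmod x"
proof -
  have "cmod (exp x - exp 0) \<le> exp (max 0 (Re x)) * cmod (x - 0)"
  proof (rule field_differentiable_bound[of "closed_segment 0 x" exp exp])
    fix y assume "y \<in> closed_segment 0 x"
    then obtain s where s: "0 \<le> s" "s \<le> 1" "y = of_real s * x"
      by (auto simp: in_segment scaleR_conv_of_real)
    have "s * Re x \<le> max 0 (Re x)"
    proof (cases "Re x \<ge> 0")
      case True
      then show ?thesis using s mult_right_mono[of s 1 "Re x"] by simp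
    next
      case False
      then show ?thesis using s by (simp add: mult_nonneg_nonpos max_def)
    qed
    then show "cmod (exp y) \<le> exp (max 0 (Re x))" using s by simp
  qed (auto intro!: derivative_eq_intros)
  then show ?thesis by simp
qed

lemma norm_expq_le: "cmod (expq x) \<le> exp (max 0 (Re x))"
proof (cases "x = 0")
  case False
  then show ?thesis using norm_exp_minus_one[of x] by (simp add: expq_def norm_divide divide_le_eq)
qed (simp add: expq_def)

lemma norm_mult_expq_le: "cmod x * cmod (expq x) \<le> 2 * exp (max 0 (Re x))"
proof (cases "x = 0")
  case False
  then have "cmod x * cmod (expq x) = cmod (exp x - 1)" by (simp add: expq_def norm_divide)
  also have "\<dots> \<le> exp (Re x) + 1" using norm_triangle_ineq4[of "exp x" 1] by simp
  also have "\<dots> \<le> exp (max 0 (Re x)) + exp (max 0 (Re x))" by (intro add_mono) auto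
  finally show ?thesis by simp
qed simp

lemma exp_le_three: "x \<le> 1 \<Longrightarrow> exp x \<le> (3::real)"
  using exp_le order_trans[of "exp x" "exp 1" 3] by simp

lemma norm_expq_minus_one:
  assumes "cmod x \<le> 1"
  shows "cmod (expq x - 1) \<le> 3 * cmod x"
proof (cases "x = 0")
  case False
  have "cmod ((exp x - x) - (exp 0 - 0)) \<le> (3 * cmod x) * cmod (x - 0)"
  proof (rule field_differentiable_bound[of "cball 0 (cmod x)" "\<lambda>y. exp y - y" "\<lambda>y. exp y - 1"])
    fix y :: complex assume "y \<in> cball 0 (cmod x)"
    then have y: "cmod y \<le> cmod x" by simp
    have "Re y \<le> 1" using y assms complex_Re_le_cmod[of y] by linarith
    then have "exp (max 0 (Re y)) \<le> 3" by (intro exp_le_three) simp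
    then have "cmod (exp y - 1) \<le> 3 * cmod y"
      using norm_exp_minus_one[of y] mult_right_mono[of "exp (max 0 (Re y))" 3 "cmod y"] by simp
    then show "cmod (exp y - 1) \<le> 3 * cmod x" using y by linarith
  qed (auto intro!: derivative_eq_intros)
  then have "cmod (exp x - 1 - x) \<le> 3 * cmod x * cmod x" by (simp add: algebra_simps)
  moreover have "expq x - 1 = (exp x - 1 - x) / x" using False by (simp add: expq_def divide_simps)
  ultimately show ?thesis using False by (simp add: norm_divide divide_le_eq)
qed (simp add: expq_def)

lemma Schwarz_disc:
  assumes q: "q holomorphic_on ball a \<rho>" and \<rho>: "\<rho> > 0" and qa: "q a = 1"
    and b: "\<And>z. z \<in> ball a \<rho> \<Longrightarrow> cmod (q z) \<le> B" and z: "z \<in> ball a \<rho>"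
  shows "cmod (q z - 1) \<le> (B + 2) * (cmod (z - a) / \<rho>)"
proof -
  have B: "B \<ge> 0" using b[OF z] norm_ge_zero[of "q z"] by (rule order_trans[rotated])
  \<comment> \<open>\<open>cmod (q - 1)\<close> is at most \<open>B + 1\<close>; the denominator
    \<open>B + 2\<close> makes the rescaled function strictly less than 1, as the Schwarz lemma
    requires.\<close>
  define F where "F = (\<lambda>u. (q (a + of_real \<rho> * u) - 1) / of_real (B + 2))"
  have in_ball: "a + of_real \<rho> * u \<in> ball a \<rho>" if "cmod u < 1" for u
    using that \<rho> by (simp add: dist_norm norm_mult)
  have "cmod (F ((z - a) / of_real \<rho>)) \<le> cmod ((z - a) / of_real \<rho>)"
  proof (rule Schwarz_Lemma(1))
    have "(\<lambda>u. q (a + of_real \<rho> * u)) holomorphic_on ball 0 1"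
      by (rule holomorphic_on_compose_gen[of "\<lambda>u. a + of_real \<rho> * u" _ q "ball a \<rho>", unfolded o_def])
         (use in_ball q in \<open>auto intro!: holomorphic_intros\<close>)
    then show "F holomorphic_on ball 0 1" unfolding F_def using B
      by (intro holomorphic_intros) (auto simp: complex_eq_iff)
    show "F 0 = 0" by (simp add: F_def qa)
    fix u :: complex assume "cmod u < 1"
    then have "cmod (q (a + of_real \<rho> * u) - 1) \<le> B + 1"
      using b[OF in_ball] norm_triangle_ineq4[of "q (a + of_real \<rho> * u)" 1] by fastforce
    then show "cmod (F u) < 1" using B unfolding F_def norm_divide norm_of_real by simp
  next
    show "cmod ((z - a) / of_real \<rho>) < 1" using z \<rho> by (simp add: norm_divide dist_norm norm_minus_commute)
  qed
  then show ?thesis using \<rho> B by (simp add: F_def norm_divide divide_le_eq mult.commute del: of_real_add)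
qed

text \<open>Because \<open>g\<close> lies below \<open>P - c * d\<close>, the first two factors
  decay like \<open>exp (- t * c * d z)\<close>. Since \<open>Re W \<le> C * d z\<close>, the factor
  with \<open>expq\<close> grows by at most the square root of the reciprocal of that decay, and it
  adds decay in \<open>cmod W\<close>; so the term is small in both parts of
  \<open>\<sigma>\<close>. Near the peak, \<open>\<zeta> = W - h z\<close> rearranges the term into
  a function of \<open>t * W\<close> times \<open>q z\<close>, each close to 1. The number
  \<open>m\<close> is the order of vanishing of \<open>d\<close> at \<open>a\<close>, which explains
  the \<open>m\<close>-th root.\<close>

lemma peak_term_estimates:
  fixes P d :: "complex \<Rightarrow> real" and h g :: "complex \<Rightarrow> complex" and a z \<zeta> :: complex and m :: nat
  assumes t: "t \<ge> 1" and C: "C \<ge> 1" and c: "c > 0" and \<epsilon>: "0 < \<epsilon>" "\<epsilon> \<le> 1" "\<epsilon> * C \<le> c / 2" and m: "m \<ge> 1"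
    and dh: "\<And>z. \<bar>P z - P a - Re (h z)\<bar> \<le> C * d z"
    and dlo: "\<And>z. c * cmod (z - a) ^ m \<le> d z" and dhi: "\<And>z. cmod (z - a) \<le> 1 \<Longrightarrow> d z \<le> C * cmod (z - a) ^ m"
    and h: "h holomorphic_on UNIV" "h a = 0" and g: "g holomorphic_on UNIV" "g a = 1"
    and gb: "\<And>z. cmod (g z) \<le> C * exp (t * (P z - P a - c * d z))"
    and neg: "Re \<zeta> + P z - P a \<le> 0"
  defines "W \<equiv> \<zeta> + h z"
  defines "\<Phi> \<equiv> exp (of_real t * \<zeta>) * g z * expq (of_real (\<epsilon> * t) * W)"
  defines "\<sigma> \<equiv> d z + cmod W"
  shows "cmod \<Phi> \<le> C" "t * \<sigma> * cmod \<Phi> \<le> 2 * C / c + 2 * C / \<epsilon>"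
    "t * \<sigma> \<le> 1 \<Longrightarrow> cmod (\<Phi> - 1) \<le> (12 * C * exp C + (C * exp (C * C) + 2) * root m (1 / c)) * root m (t * \<sigma>)"
proof -
  have d0: "d z \<ge> 0" for z using dlo[of z] c by (smt (verit) mult_nonneg_nonneg norm_ge_zero zero_le_power)
  have ReW: "Re W \<le> C * d z"
    using dh[of z] neg by (simp add: W_def abs_le_iff)
  define k where "k = exp (- (t * c * d z / 2))"
  have k1: "k \<le> 1" using t c d0[of z] by (simp add: k_def)
  have e1: "exp (max 0 (Re (of_real (\<epsilon> * t) * W))) \<le> exp (t * c * d z / 2)"
  proof -
    have "(\<epsilon> * t) * Re W \<le> (\<epsilon> * t) * (C * d z)" using ReW \<epsilon> t by (intro mult_left_mono) auto
    also have "\<dots> = (\<epsilon> * C) * (t * d z)" by simp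
    also have "\<dots> \<le> (c / 2) * (t * d z)" using \<epsilon> t d0[of z] by (intro mult_right_mono) auto
    finally have "(\<epsilon> * t) * Re W \<le> t * c * d z / 2" by (simp add: mult_ac)
    moreover have "t * c * d z / 2 \<ge> 0" using t c d0[of z] by simp
    moreover have "Re (of_real (\<epsilon> * t) * W) = (\<epsilon> * t) * Re W" by (simp del: of_real_mult)
    ultimately show ?thesis by simp
  qed
  have e2: "cmod (exp (of_real t * \<zeta>) * g z) \<le> C * exp (- (t * c * d z))"
  proof -
    have "cmod (exp (of_real t * \<zeta>) * g z) \<le> exp (t * Re \<zeta>) * (C * exp (t * (P z - P a - c * d z)))"
      unfolding norm_mult by (intro mult_mono gb) auto
    also have "\<dots> = C * exp (t * (Re \<zeta> + P z - P a) - t * c * d z)"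
      by (simp add: exp_add[symmetric] algebra_simps)
    also have "\<dots> \<le> C * exp (- (t * c * d z))"
    proof -
      have "t * (Re \<zeta> + P z - P a) \<le> 0" using t neg by (simp add: mult_nonneg_nonpos)
      then show ?thesis using C by (intro mult_left_mono) auto
    qed
    finally show ?thesis .
  qed
  have ek: "exp (- (t * c * d z)) * exp (t * c * d z / 2) = k" by (simp add: k_def exp_add[symmetric])
  have b1: "cmod \<Phi> \<le> C * k"
  proof -
    have "cmod \<Phi> \<le> (C * exp (- (t * c * d z))) * exp (t * c * d z / 2)"
      unfolding \<Phi>_def norm_mult[of "exp (of_real t * \<zeta>) * g z"] using C
      by (intro mult_mono e2 order_trans[OF norm_expq_le e1]) auto
    then show ?thesis using ek by (simp add: mult.assoc)
  qed
  have b2: "(\<epsilon> * t * cmod W) * cmod \<Phi> \<le> 2 * C * k"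
  proof -
    have "cmod (of_real (\<epsilon> * t) * W) * cmod (expq (of_real (\<epsilon> * t) * W)) \<le> 2 * exp (t * c * d z / 2)"
      using norm_mult_expq_le[of "of_real (\<epsilon> * t) * W"] e1 by linarith
    then have "cmod (exp (of_real t * \<zeta>) * g z) * (cmod (of_real (\<epsilon> * t) * W) * cmod (expq (of_real (\<epsilon> * t) * W)))
        \<le> (C * exp (- (t * c * d z))) * (2 * exp (t * c * d z / 2))"
      using C by (intro mult_mono[OF e2]) auto
    also have "\<dots> = 2 * C * k" using ek by (simp add: mult_ac)
    also have "cmod (exp (of_real t * \<zeta>) * g z) * (cmod (of_real (\<epsilon> * t) * W) * cmod (expq (of_real (\<epsilon> * t) * W)))
       = (\<epsilon> * t * cmod W) * cmod \<Phi>"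
      unfolding \<Phi>_def using \<epsilon> t by (simp add: norm_mult mult_ac)
    finally show ?thesis .
  qed
  have "C * k \<le> C * 1" using k1 C by (intro mult_left_mono) auto
  then show "cmod \<Phi> \<le> C" using b1 by linarith
  have "t * d z * cmod \<Phi> \<le> 2 * C / c"
  proof -
    have "t * d z * k \<le> 2 / c"
    proof -
      have "t * c * d z / 2 \<le> exp (t * c * d z / 2)" using exp_ge_add_one_self[of "t * c * d z / 2"] by linarith
      then have "(t * c * d z / 2) * k \<le> exp (t * c * d z / 2) * k" by (intro mult_right_mono) (auto simp: k_def)
      also have "\<dots> = 1" by (simp add: k_def exp_add[symmetric])
      finally show ?thesis using c by (simp add: field_simps)
    qed
    then have "C * (t * d z * k) \<le> C * (2 / c)" using C by (intro mult_left_mono) auto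
    moreover have "t * d z * cmod \<Phi> \<le> t * d z * (C * k)" using t d0[of z] by (intro mult_left_mono b1) auto
    ultimately show ?thesis by (simp add: mult_ac)
  qed
  moreover have "t * cmod W * cmod \<Phi> \<le> 2 * C / \<epsilon>"
  proof -
    have "2 * C * k \<le> 2 * C * 1" using k1 C by (intro mult_left_mono) auto
    then have "\<epsilon> * (t * cmod W * cmod \<Phi>) \<le> 2 * C" using b2 by (simp add: mult_ac)
    then show ?thesis using \<epsilon> by (simp add: pos_le_divide_eq mult.commute)
  qed
  ultimately show "t * \<sigma> * cmod \<Phi> \<le> 2 * C / c + 2 * C / \<epsilon>" by (simp add: \<sigma>_def algebra_simps)
  assume y1: "t * \<sigma> \<le> 1"
  define y where "y = t * \<sigma>"
  have y0: "y \<ge> 0" using t d0[of z] by (simp add: y_def \<sigma>_def)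
  have td: "t * d z \<le> y" and tW: "t * cmod W \<le> y" using t d0[of z] by (auto simp: y_def \<sigma>_def algebra_simps)
  define x where "x = of_real t * W"
  have xy: "cmod x \<le> y" using tW t by (simp add: x_def norm_mult)
  have x1: "cmod x \<le> 1" using xy y1 by (simp add: y_def)
  define A where "A = exp x * expq (of_real \<epsilon> * x)"
  have ex: "cmod (of_real \<epsilon> * x) \<le> cmod x" using \<epsilon> mult_right_mono[of \<epsilon> 1 "cmod x"] by (simp add: norm_mult)
  have A1: "cmod (A - 1) \<le> 12 * y"
  proof -
    have "Re x \<le> 1" "Re (of_real \<epsilon> * x) \<le> 1"
      using complex_Re_le_cmod[of x] complex_Re_le_cmod[of "of_real \<epsilon> * x"] x1 ex by linarith+
    then have m3: "exp (max 0 (Re x)) \<le> 3" "exp (max 0 (Re (of_real \<epsilon> * x))) \<le> 3"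
      by (auto intro!: exp_le_three)
    have p1: "cmod (exp x - 1) \<le> 3 * cmod x"
      using norm_exp_minus_one[of x] mult_right_mono[OF m3(1), of "cmod x"] by simp
    have p2: "cmod (expq (of_real \<epsilon> * x)) \<le> 3" using norm_expq_le[of "of_real \<epsilon> * x"] m3 by linarith
    have p3: "cmod (expq (of_real \<epsilon> * x) - 1) \<le> 3 * cmod x"
      using norm_expq_minus_one[of "of_real \<epsilon> * x"] ex x1 by linarith
    have "A - 1 = (exp x - 1) * expq (of_real \<epsilon> * x) + (expq (of_real \<epsilon> * x) - 1)" by (simp add: A_def algebra_simps)
    then have "cmod (A - 1) \<le> cmod (exp x - 1) * cmod (expq (of_real \<epsilon> * x)) + cmod (expq (of_real \<epsilon> * x) - 1)"
      by (metis norm_mult norm_triangle_ineq)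
    also have "\<dots> \<le> (3 * cmod x) * 3 + 3 * cmod x" using p1 p2 p3 by (intro add_mono mult_mono) auto
    finally show ?thesis using xy by simp
  qed
  \<comment> \<open>Removing \<open>h\<close> cancels the first-order variation of the weight: what
    remains of \<open>P - P a\<close> is controlled by \<open>C * d\<close>, so \<open>q\<close> is
    bounded wherever \<open>t * d\<close> is.\<close>
  define q where "q = (\<lambda>z. g z * exp (- (of_real t * h z)))"
  have qhol: "q holomorphic_on UNIV" unfolding q_def by (intro holomorphic_intros g h)
  have qa: "q a = 1" by (simp add: q_def g h)
  have qb: "cmod (q u) \<le> C * exp (C * (t * d u))" for u
  proof -
    have "cmod (q u) \<le> C * exp (t * (P u - P a - c * d u)) * exp (- (t * Re (h u)))"
      unfolding q_def norm_mult using gb[of u] by (simp add: mult_right_mono)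
    also have "\<dots> = C * exp (t * (P u - P a - Re (h u)) - t * (c * d u))" by (simp add: exp_add[symmetric] algebra_simps)
    also have "\<dots> \<le> C * exp (C * (t * d u))"
    proof -
      have "t * (P u - P a - Re (h u)) \<le> t * (C * d u)" using dh[of u] t by (intro mult_left_mono) auto
      moreover have "t * (c * d u) \<ge> 0" using t c d0[of u] by simp
      ultimately have "t * (P u - P a - Re (h u)) - t * (c * d u) \<le> C * (t * d u)" by (simp add: mult.left_commute)
      then show ?thesis using C by (intro mult_left_mono) auto
    qed
    finally show ?thesis .
  qed
  \<comment> \<open>The natural radius at scale \<open>t\<close>: on this disc \<open>t * d\<close>
    is at most \<open>C\<close>. Inside it \<open>Schwarz_disc\<close> bounds \<open>q - 1\<close>;
    outside it the ratio \<open>cmod (z - a) / \<rho>\<close> is at least 1 and a plain bound of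
    \<open>q z\<close> is enough.\<close>
  define \<rho> where "\<rho> = root m (1 / t)"
  have \<rho>: "\<rho> > 0" "\<rho> \<le> 1" "\<rho> ^ m = 1 / t" using t m by (auto simp: \<rho>_def)
  define Q where "Q = C * exp (C * C) + 2"
  have qz: "cmod (q z) \<le> C * exp C"
  proof -
    have "C * (t * d z) \<le> C * 1" using td y1 C by (intro mult_left_mono) (auto simp: y_def)
    then have "C * exp (C * (t * d z)) \<le> C * exp C" using C by (intro mult_left_mono) auto
    then show ?thesis using qb[of z] by linarith
  qed
  have q1: "cmod (q z - 1) \<le> Q * (cmod (z - a) / \<rho>)"
  proof (cases "cmod (z - a) < \<rho>")
    case True
    show ?thesis unfolding Q_def
    proof (rule Schwarz_disc)
      show "q holomorphic_on ball a \<rho>" using qhol holomorphic_on_subset by blast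
      show "z \<in> ball a \<rho>" using True by (simp add: dist_norm norm_minus_commute)
      fix u assume "u \<in> ball a \<rho>"
      then have u: "cmod (u - a) < \<rho>" by (simp add: dist_norm norm_minus_commute)
      have "cmod (u - a) ^ m \<le> \<rho> ^ m" using u by (intro power_mono) auto
      then have "C * cmod (u - a) ^ m \<le> C * (1 / t)" using \<rho>(3) C by (intro mult_left_mono) auto
      moreover have "d u \<le> C * cmod (u - a) ^ m" using dhi[of u] u \<rho>(2) by simp
      ultimately have "d u \<le> C * (1 / t)" by (rule order_trans[rotated])
      then have "t * d u \<le> t * (C * (1 / t))" using t by (intro mult_left_mono) auto
      also have "\<dots> = C" using t by simp
      finally have "t * d u \<le> C" .
      then have "C * (t * d u) \<le> C * C" using C by (intro mult_left_mono) auto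
      then have "C * exp (C * (t * d u)) \<le> C * exp (C * C)" using C by (intro mult_left_mono) auto
      then show "cmod (q u) \<le> C * exp (C * C)" using qb[of u] by linarith
    qed (use \<rho> qa in auto)
  next
    case False
    have "C * 1 \<le> C * C" using C by (intro mult_left_mono) auto
    then have "C * exp C \<le> C * exp (C * C)" using C by (intro mult_left_mono) auto
    then have "cmod (q z - 1) \<le> Q" unfolding Q_def
      using qz norm_triangle_ineq4[of "q z" 1] by simp
    also have "\<dots> \<le> Q * (cmod (z - a) / \<rho>)"
    proof -
      have "1 \<le> cmod (z - a) / \<rho>" using False \<rho> by simp
      moreover have "Q \<ge> 0" using C by (simp add: Q_def)
      ultimately show ?thesis using mult_left_mono[of 1 "cmod (z - a) / \<rho>" Q] by simp
    qed
    finally show ?thesis .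
  qed
  have wr: "cmod (z - a) / \<rho> \<le> root m (1 / c) * root m y"
  proof -
    have "cmod (z - a) / \<rho> = root m (cmod (z - a) ^ m) * root m t"
      using m t by (simp add: \<rho>_def real_root_divide real_root_power_cancel)
    also have "\<dots> = root m (cmod (z - a) ^ m * t)" by (simp add: real_root_mult)
    also have "\<dots> \<le> root m (1 / c * y)"
    proof -
      have "t * (c * cmod (z - a) ^ m) \<le> t * d z" using dlo[of z] t by (intro mult_left_mono) auto
      then have "c * (cmod (z - a) ^ m * t) \<le> y" using td by (simp add: mult_ac)
      then have "cmod (z - a) ^ m * t \<le> 1 / c * y" using c by (simp add: pos_le_divide_eq mult.commute)
      then show ?thesis using m by simp
    qed
    also have "\<dots> = root m (1 / c) * root m y" by (rule real_root_mult)
    finally show ?thesis .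
  qed
  have ry: "y \<le> root m y"
  proof -
    have "root m y \<le> 1" "root m y \<ge> 0" using y0 y1 m by (auto simp: y_def)
    then have "root m y ^ m \<le> root m y ^ 1" using m by (intro power_decreasing) auto
    then show ?thesis using m y0 by simp
  qed
  have eq: "\<Phi> = A * q z"
  proof -
    have "exp (of_real t * \<zeta>) = exp x * exp (- (of_real t * h z))"
      by (simp add: x_def W_def exp_add[symmetric] algebra_simps)
    then show ?thesis by (simp add: \<Phi>_def A_def q_def x_def mult_ac)
  qed
  have "\<Phi> - 1 = (A - 1) * q z + (q z - 1)" by (simp add: eq algebra_simps)
  then have "cmod (\<Phi> - 1) \<le> cmod (A - 1) * cmod (q z) + cmod (q z - 1)" by (metis norm_mult norm_triangle_ineq)
  also have "\<dots> \<le> (12 * y) * (C * exp C) + Q * (root m (1 / c) * root m y)"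
  proof (intro add_mono mult_mono A1 qz)
    have "Q \<ge> 0" using C by (simp add: Q_def)
    then show "cmod (q z - 1) \<le> Q * (root m (1 / c) * root m y)"
      using q1 mult_left_mono[OF wr, of Q] by linarith
  qed (use y0 in auto)
  also have "\<dots> \<le> (12 * root m y) * (C * exp C) + Q * (root m (1 / c) * root m y)"
    using ry C by (intro add_right_mono mult_right_mono) auto
  also have "\<dots> = (12 * C * exp C + Q * root m (1 / c)) * root m y" by (simp add: algebra_simps)
  finally show "cmod (\<Phi> - 1) \<le> (12 * C * exp C + (C * exp (C * C) + 2) * root m (1 / c)) * root m (t * \<sigma>)"
    by (simp add: Q_def y_def)
qed

section \<open>Assembling the peak function\<close>

definition peak_at :: "(complex \<Rightarrow> real) \<Rightarrow> complex \<times> complex \<Rightarrow> bool" where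
  "peak_at P p \<longleftrightarrow> (let \<Omega> = {z. Re (snd z) + P (fst z) < 0} in
     \<exists>f. (\<forall>z\<in>\<Omega>. cdiff f z) \<and> f ` \<Omega> \<subseteq> ball 0 1 \<and> (f \<longlongrightarrow> 1) (at p within \<Omega>) \<and>
     (\<forall>r>0. \<exists>s>0. \<forall>w\<in>\<Omega> - ball p r. cmod (f w) < 1 - s))"

text \<open>For each point, \<open>x\<close> is the first index with
  \<open>t x * \<sigma> z \<ge> 1\<close>, and \<open>F\<close> has size comparable with
  \<open>\<theta> ^ x\<close>. Small \<open>\<sigma>\<close> means large \<open>x\<close>, so
  \<open>F\<close> tends to 0 at the peak; \<open>\<sigma>\<close> bounded below means bounded
  \<open>x\<close>, so \<open>Re F\<close> stays away from 0. On the domain \<open>\<sigma>\<close>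
  is positive, hence \<open>x\<close> exists.\<close>

lemma peak_from_family:
  fixes P d :: "complex \<Rightarrow> real" and h :: "complex \<Rightarrow> complex" and g :: "nat \<Rightarrow> complex \<Rightarrow> complex"
    and a b :: complex and m :: nat
  assumes cP: "continuous_on UNIV P" and ab: "Re b + P a = 0" and t0: "t0 \<ge> 1" and C: "C \<ge> 1" and c: "c > 0"
    and m: "m \<ge> 1"
    and dh: "\<And>z. \<bar>P z - P a - Re (h z)\<bar> \<le> C * d z"
    and dlo: "\<And>z. c * cmod (z - a) ^ m \<le> d z" and dhi: "\<And>z. cmod (z - a) \<le> 1 \<Longrightarrow> d z \<le> C * cmod (z - a) ^ m"
    and h: "h holomorphic_on UNIV" "h a = 0" and g: "\<And>n. g n holomorphic_on UNIV" "\<And>n. g n a = 1"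
    and gb: "\<And>n z. cmod (g n z) \<le> C * exp (t0 * 2 ^ n * (P z - P a - c * d z))"
  shows "peak_at P (a, b)"
proof -
  define \<Omega> where "\<Omega> = {z. Re (snd z) + P (fst z) < 0}"
  \<comment> \<open>With this choice the growth of the \<open>expq\<close> factor, at most
    \<open>exp (\<epsilon> * t * C * d)\<close>, uses up at most half of the decay
    \<open>exp (- t * c * d)\<close>.\<close>
  define \<epsilon> where "\<epsilon> = min 1 (c / (2 * C))"
  have \<epsilon>: "0 < \<epsilon>" "\<epsilon> \<le> 1" "\<epsilon> * C \<le> c / 2"
  proof -
    show "0 < \<epsilon>" "\<epsilon> \<le> 1" using c C by (auto simp: \<epsilon>_def)
    have "\<epsilon> * C \<le> c / (2 * C) * C" using C by (intro mult_right_mono) (auto simp: \<epsilon>_def)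
    then show "\<epsilon> * C \<le> c / 2" using C by simp
  qed
  define t where "t = (\<lambda>n::nat. t0 * 2 ^ n)"
  have t1: "t n \<ge> 1" for n
  proof -
    have "1 * 1 \<le> t0 * 2 ^ n" using t0 by (intro mult_mono) auto
    then show ?thesis by (simp add: t_def)
  qed
  define W where "W = (\<lambda>z. (snd z - b) + h (fst z))"
  define \<Phi> where "\<Phi> = (\<lambda>n z. exp (of_real (t n) * (snd z - b)) * g n (fst z) * expq (of_real (\<epsilon> * t n) * W z))"
  define \<sigma> where "\<sigma> = (\<lambda>z. d (fst z) + cmod (W z))"
  define C2 where "C2 = 2 * C / c + 2 * C / \<epsilon>"
  define C3 where "C3 = 12 * C * exp C + (C * exp (C * C) + 2) * root m (1 / c)"
  have neg: "Re (snd z - b) + P (fst z) - P a \<le> 0" if "z \<in> \<Omega>" for z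
    using that ab by (simp add: \<Omega>_def)
  note est = peak_term_estimates[OF t1 C c \<epsilon> m dh dlo dhi h g]
  have est1: "cmod (\<Phi> n z) \<le> C" if "z \<in> \<Omega>" for n z
    unfolding \<Phi>_def W_def by (rule est(1)) (use gb neg[OF that] in \<open>auto simp: t_def\<close>)
  have est2: "t n * \<sigma> z * cmod (\<Phi> n z) \<le> C2" if "z \<in> \<Omega>" for n z
    unfolding \<Phi>_def W_def \<sigma>_def C2_def by (rule est(2)) (use gb neg[OF that] in \<open>auto simp: t_def\<close>)
  have est3: "cmod (\<Phi> n z - 1) \<le> C3 * root m (t n * \<sigma> z)" if "z \<in> \<Omega>" "t n * \<sigma> z \<le> 1" for n z
    using that(2) unfolding \<Phi>_def W_def \<sigma>_def C3_def by (intro est(3)) (use gb neg[OF that(1)] in \<open>auto simp: t_def\<close>)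
  have d0: "d z \<ge> 0" for z using dlo[of z] c by (smt (verit) mult_nonneg_nonneg norm_ge_zero zero_le_power)
  have \<sigma>0: "\<sigma> z > 0" if "z \<in> \<Omega>" for z
  proof (rule ccontr)
    assume "\<not> \<sigma> z > 0"
    then have "d (fst z) + cmod (W z) \<le> 0" by (simp add: \<sigma>_def)
    then have dW: "d (fst z) = 0" "W z = 0" using d0[of "fst z"] by (auto simp: add_nonneg_eq_0_iff antisym_conv)
    then have "cmod (fst z - a) ^ m \<le> 0" using dlo[of "fst z"] c by (simp add: mult_le_0_iff)
    then have "fst z = a" using m by (simp add: zero_le_power antisym_conv)
    then have "snd z = b" using dW(2) h(2) by (simp add: W_def)
    then show False using \<open>fst z = a\<close> that ab by (simp add: \<Omega>_def)
  qed
  have C20: "C2 \<ge> 0" using C c \<epsilon> by (simp add: C2_def)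
  have C30: "C3 \<ge> 0" unfolding C3_def using C c m by (intro add_nonneg_nonneg mult_nonneg_nonneg) auto
  \<comment> \<open>Going down one dyadic scale halves \<open>t n * \<sigma>\<close>, so its
    \<open>m\<close>-th root, which bounds \<open>\<Phi> - 1\<close>, shrinks by this
    factor.\<close>
  define \<kappa> where "\<kappa> = root m (1/2)"
  have \<kappa>: "0 < \<kappa>" "\<kappa> < 1" using m by (auto simp: \<kappa>_def)
  obtain \<theta> C5 where \<theta>: "0 < \<theta>" "\<theta> < 1" and C5: "C5 > 0" and ser:
    "\<And>(u :: nat \<Rightarrow> complex) x. (\<And>n. cmod (1 - u n) \<le> C) \<Longrightarrow> (\<And>j. cmod (1 - u (x + j)) \<le> C2 * (1/2) ^ j) \<Longrightarrow>
       (\<And>j. j < x \<Longrightarrow> cmod (u (x - 1 - j)) \<le> C3 * \<kappa> ^ j) \<Longrightarrow>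
       Re (\<Sum>n. of_real (\<theta> ^ n) * u n) \<ge> \<theta> ^ x \<and> cmod (\<Sum>n. of_real (\<theta> ^ n) * u n) \<le> C5 * \<theta> ^ x"
    by (rule weighted_series_estimate[of C C2 C3 \<kappa>]) (use C C20 C30 \<kappa> in auto)
  define F where "F = (\<lambda>z. \<Sum>n. of_real (\<theta> ^ n) * (1 - \<Phi> n z))"
  have F: "Re (F z) \<ge> \<theta> ^ x \<and> cmod (F z) \<le> C5 * \<theta> ^ x"
    if z: "z \<in> \<Omega>" and x: "t x * \<sigma> z \<ge> 1" "\<And>j. j < x \<Longrightarrow> t j * \<sigma> z < 1" for z x
    unfolding F_def
  proof (rule ser)
    show "cmod (1 - (1 - \<Phi> n z)) \<le> C" for n using est1[OF z] by simp
    fix j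
    have tj: "t (x + j) * \<sigma> z = 2 ^ j * (t x * \<sigma> z)" by (simp add: t_def power_add)
    have "2 ^ j * 1 \<le> 2 ^ j * (t x * \<sigma> z)" using x(1) by (intro mult_left_mono) auto
    then have "2 ^ j * cmod (\<Phi> (x + j) z) \<le> t (x + j) * \<sigma> z * cmod (\<Phi> (x + j) z)"
      unfolding tj by (intro mult_right_mono) auto
    then have "2 ^ j * cmod (\<Phi> (x + j) z) \<le> C2" using est2[OF z, of "x + j"] by linarith
    then show "cmod (1 - (1 - \<Phi> (x + j) z)) \<le> C2 * (1/2) ^ j" by (simp add: power_one_over field_simps)
  next
    fix j assume j: "j < x"
    define n where "n = x - 1 - j"
    have n: "n < x" "x - 1 = n + j" using j by (auto simp: n_def)
    have "t (x - 1) * \<sigma> z < 1" using x(2)[of "x - 1"] j by simp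
    moreover have "t (x - 1) * \<sigma> z = 2 ^ j * (t n * \<sigma> z)" unfolding n(2) by (simp add: t_def power_add)
    ultimately have "2 ^ j * (t n * \<sigma> z) < 1" by (simp only:)
    then have "t n * \<sigma> z < 1 / 2 ^ j" by (simp add: pos_less_divide_eq mult.commute)
    then have "t n * \<sigma> z \<le> (1/2) ^ j" by (simp add: power_one_over)
    then have "root m (t n * \<sigma> z) \<le> root m ((1/2) ^ j)" using m by simp
    also have "\<dots> = \<kappa> ^ j" using m by (simp add: \<kappa>_def real_root_power)
    finally have "C3 * root m (t n * \<sigma> z) \<le> C3 * \<kappa> ^ j" using C30 by (intro mult_left_mono) auto
    then show "cmod (1 - \<Phi> (x - 1 - j) z) \<le> C3 * \<kappa> ^ j"
      using est3[OF z, of n] x(2)[OF n(1)] by (simp add: n_def norm_minus_commute)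
  qed
  have ex: "\<exists>x. t x * \<sigma> z \<ge> 1 \<and> (\<forall>j<x. t j * \<sigma> z < 1)" if "z \<in> \<Omega>" for z
  proof -
    obtain n where "(2::real) ^ n > 1 / (t0 * \<sigma> z)" using real_arch_pow[of 2 "1 / (t0 * \<sigma> z)"] by auto
    then have "1 < 2 ^ n * (t0 * \<sigma> z)" using \<sigma>0[OF that] t0 by (simp add: pos_divide_less_eq)
    then have "t n * \<sigma> z \<ge> 1" by (simp add: t_def mult_ac)
    then have "t (LEAST n. t n * \<sigma> z \<ge> 1) * \<sigma> z \<ge> 1" by (rule LeastI)
    moreover have "t j * \<sigma> z < 1" if "j < (LEAST n. t n * \<sigma> z \<ge> 1)" for j
      using not_less_Least[OF that] by simp
    ultimately show ?thesis by blast
  qed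
  have Fpos: "Re (F z) > 0" if "z \<in> \<Omega>" for z
    using ex[OF that] F[OF that] \<theta>(1) by (meson less_le_trans zero_less_power)
  have far: "\<exists>\<eta>>0. \<forall>z\<in>\<Omega>. \<sigma> z \<ge> s0 \<longrightarrow> Re (F z) \<ge> \<eta>" if "s0 > 0" for s0
  proof -
    obtain n where "(2::real) ^ n > 1 / (t0 * s0)" using real_arch_pow[of 2 "1 / (t0 * s0)"] by auto
    then have "1 < 2 ^ n * (t0 * s0)" using that t0 by (simp add: pos_divide_less_eq)
    then have n: "t n * s0 \<ge> 1" by (simp add: t_def mult_ac)
    have "Re (F z) \<ge> \<theta> ^ n" if z: "z \<in> \<Omega>" and s: "\<sigma> z \<ge> s0" for z
    proof -
      obtain x where x: "t x * \<sigma> z \<ge> 1" "\<And>j. j < x \<Longrightarrow> t j * \<sigma> z < 1" using ex[OF z] by blast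
      have "t n * s0 \<le> t n * \<sigma> z" using s t1[of n] by (intro mult_left_mono) auto
      then have "\<not> n < x" using x(2)[of n] n by linarith
      then have "\<theta> ^ n \<le> \<theta> ^ x" using \<theta> by (intro power_decreasing) auto
      then show ?thesis using F[OF z x] by linarith
    qed
    then show ?thesis using \<theta>(1) by (intro exI[of _ "\<theta> ^ n"]) auto
  qed
  have near: "\<exists>s0>0. \<forall>z\<in>\<Omega>. \<sigma> z < s0 \<longrightarrow> cmod (F z) < e" if e0: "e > 0" for e
  proof -
    obtain n where n: "\<theta> ^ n < e / C5" using real_arch_pow_inv[of "e / C5" \<theta>] \<theta> C5 e0 by auto
    have "cmod (F z) < e" if z: "z \<in> \<Omega>" and s: "\<sigma> z < 1 / t n" for z
    proof -
      obtain x where x: "t x * \<sigma> z \<ge> 1" "\<And>j. j < x \<Longrightarrow> t j * \<sigma> z < 1" using ex[OF z] by blast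
      have "t n * \<sigma> z < 1" using s t1[of n] by (simp add: pos_less_divide_eq mult.commute)
      moreover have "t x \<le> t n" if "x \<le> n" using that t0 by (simp add: t_def power_increasing)
      ultimately have "\<not> x \<le> n" using x(1) \<sigma>0[OF z] by (smt (verit) mult_right_mono)
      then have "C5 * \<theta> ^ x \<le> C5 * \<theta> ^ n" using \<theta> C5 by (intro mult_left_mono power_decreasing) auto
      moreover have "C5 * \<theta> ^ n < e" using n C5 by (simp add: pos_less_divide_eq mult.commute)
      ultimately show ?thesis using F[OF z x] by linarith
    qed
    moreover have "1 / t n > 0" using t1[of n] by simp
    ultimately show ?thesis by blast
  qed
  have \<Omega>_open: "open \<Omega>"
  proof -
    have "continuous_on UNIV (\<lambda>z :: complex \<times> complex. Re (snd z) + P (fst z))"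
      by (intro continuous_intros continuous_on_compose2[OF cP]) auto
    then show ?thesis unfolding \<Omega>_def by (intro open_Collect_less continuous_on_const)
  qed
  have cW: "cdiff W z" for z
  proof -
    have "cdiff (\<lambda>z. (snd z + (- b)) + h (fst z)) z"
      by (intro cdiff_add cdiff_snd cdiff_const cdiff_compose[OF h(1) cdiff_fst])
    then show ?thesis by (simp add: W_def)
  qed
  have c\<Phi>: "cdiff (\<Phi> n) z" for n z
  proof -
    have exp_hol: "exp holomorphic_on (UNIV :: complex set)" by (intro holomorphic_intros)
    have "cdiff (\<lambda>z. exp (of_real (t n) * (snd z + (- b))) * g n (fst z) * expq (of_real (\<epsilon> * t n) * W z)) z"
      by (intro cdiff_mult cdiff_compose[OF exp_hol] cdiff_compose[OF g(1) cdiff_fst] cdiff_compose[OF expq_holomorphic]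
           cdiff_add cdiff_snd cdiff_const cW)
    then show ?thesis by (simp add: \<Phi>_def)
  qed
  have cF: "cdiff F z" if "z \<in> \<Omega>" for z
    unfolding F_def
  proof (rule cdiff_suminf[OF \<Omega>_open _ _ \<theta> that])
    fix n z assume z: "z \<in> \<Omega>"
    have "cdiff (\<lambda>z. of_real (\<theta> ^ n) * (1 + (-1) * \<Phi> n z)) z" by (intro cdiff_mult cdiff_add cdiff_const c\<Phi>)
    then show "cdiff (\<lambda>z. of_real (\<theta> ^ n) * (1 - \<Phi> n z)) z" by simp
    have "cmod (1 - \<Phi> n z) \<le> 1 + C" using est1[OF z, of n] norm_triangle_ineq4[of 1 "\<Phi> n z"] by simp
    then show "cmod (of_real (\<theta> ^ n) * (1 - \<Phi> n z)) \<le> (1 + C) * \<theta> ^ n"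
      using \<theta> by (simp add: norm_mult norm_power mult.commute mult_right_mono)
  qed
  define f where "f = (\<lambda>z. exp (- F z))"
  have "cdiff f z" if "z \<in> \<Omega>" for z
  proof -
    have "(\<lambda>x. exp (- x)) holomorphic_on (UNIV :: complex set)" by (intro holomorphic_intros)
    from cdiff_compose[OF this cF[OF that]] show ?thesis by (simp add: f_def)
  qed
  moreover have "f ` \<Omega> \<subseteq> ball 0 1" using Fpos by (auto simp: f_def)
  moreover have "(f \<longlongrightarrow> 1) (at (a, b) within \<Omega>)"
  proof -
    have \<sigma>lim: "(\<sigma> \<longlongrightarrow> 0) (at (a, b))"
    proof -
      have "isCont h a" using h(1) by (metis continuous_on_eq_continuous_at holomorphic_on_imp_continuous_on open_UNIV UNIV_I)
      then have hl: "((\<lambda>z. h (fst z)) \<longlongrightarrow> h (fst (a, b))) (at (a, b))"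
        by (intro isCont_tendsto_compose[of _ h] tendsto_intros) auto
      have "(W \<longlongrightarrow> (snd (a, b) - b) + h (fst (a, b))) (at (a, b))"
        unfolding W_def by (intro tendsto_intros hl)
      then have Wl: "((\<lambda>z. cmod (W z)) \<longlongrightarrow> 0) (at (a, b))" using h(2) tendsto_norm_zero by fastforce
      have fl: "((\<lambda>z. fst z - a) \<longlongrightarrow> fst (a, b) - a) (at (a, b))" by (intro tendsto_intros)
      have "((\<lambda>z. C * cmod (fst z - a) ^ m) \<longlongrightarrow> C * cmod (fst (a, b) - a) ^ m) (at (a, b))" by (intro tendsto_intros)
      then have ml: "((\<lambda>z. C * cmod (fst z - a) ^ m) \<longlongrightarrow> 0) (at (a, b))" using m by (simp add: power_0_left)
      have ev: "\<forall>\<^sub>F z in at (a, b). cmod (fst z - a) < 1"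
        using tendstoD[OF fl, of 1] by (simp add: dist_norm)
      have "((\<lambda>z. d (fst z)) \<longlongrightarrow> 0) (at (a, b))"
      proof (rule Lim_null_comparison[OF _ ml])
        show "\<forall>\<^sub>F z in at (a, b). norm (d (fst z)) \<le> C * cmod (fst z - a) ^ m"
          using ev by eventually_elim (use dhi d0 in \<open>auto simp: less_imp_le\<close>)
      qed
      from tendsto_add[OF this Wl] show ?thesis by (simp add: \<sigma>_def)
    qed
    have "(F \<longlongrightarrow> 0) (at (a, b) within \<Omega>)"
    proof (rule tendstoI)
      fix e :: real assume "e > 0"
      then obtain s0 where s0: "s0 > 0" "\<And>z. z \<in> \<Omega> \<Longrightarrow> \<sigma> z < s0 \<Longrightarrow> cmod (F z) < e" using near by blast
      have "\<forall>\<^sub>F z in at (a, b) within \<Omega>. \<sigma> z < s0"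
        using order_tendstoD(2)[OF tendsto_within_subset[OF \<sigma>lim, of \<Omega>, simplified] s0(1)] by simp
      moreover have "\<forall>\<^sub>F z in at (a, b) within \<Omega>. z \<in> \<Omega>" by (simp add: eventually_at_filter)
      ultimately show "\<forall>\<^sub>F z in at (a, b) within \<Omega>. dist (F z) 0 < e"
        by eventually_elim (use s0(2) in auto)
    qed
    then have "((\<lambda>z. exp (- F z)) \<longlongrightarrow> exp (- 0)) (at (a, b) within \<Omega>)" by (intro tendsto_intros)
    then show ?thesis by (simp add: f_def)
  qed
  moreover have "\<exists>s>0. \<forall>w\<in>\<Omega> - ball (a, b) r. cmod (f w) < 1 - s" if r: "r > 0" for r
  proof -
    have "isCont h a" using h(1) by (metis continuous_on_eq_continuous_at holomorphic_on_imp_continuous_on open_UNIV UNIV_I)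
    then obtain \<delta> where \<delta>: "\<delta> > 0" "\<And>u. dist u a < \<delta> \<Longrightarrow> dist (h u) (h a) < r / 4"
      unfolding continuous_at_eps_delta using r by (metis divide_pos_pos zero_less_numeral)
    define \<delta>' where "\<delta>' = min \<delta> (r / 4)"
    have \<delta>': "\<delta>' > 0" using \<delta> r by (simp add: \<delta>'_def)
    \<comment> \<open>If \<open>\<sigma> z\<close> is below \<open>s0\<close>, the first part forces
      \<open>fst z\<close> close to \<open>a\<close>, hence \<open>h (fst z)\<close> close to 0; the
      second part then controls \<open>snd z - b = W z - h (fst z)\<close>.\<close>
    define s0 where "s0 = min (r / 4) (c * \<delta>' ^ m)"
    have s0: "s0 > 0" using r c \<delta>' by (simp add: s0_def)
    have big: "\<sigma> z \<ge> s0" if "z \<notin> ball (a, b) r" for z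
    proof (rule ccontr)
      assume "\<not> \<sigma> z \<ge> s0"
      then have s: "\<sigma> z < s0" by simp
      have dz: "d (fst z) < c * \<delta>' ^ m" and Wz: "cmod (W z) < r / 4"
        using s d0[of "fst z"] norm_ge_zero[of "W z"] unfolding \<sigma>_def s0_def by linarith+
      have "c * cmod (fst z - a) ^ m < c * \<delta>' ^ m" using dlo[of "fst z"] dz by linarith
      then have "cmod (fst z - a) ^ m < \<delta>' ^ m" using c by simp
      then have f1: "cmod (fst z - a) < \<delta>'" using \<delta>' by (meson less_imp_le power_less_imp_less_base)
      then have "cmod (h (fst z)) < r / 4" using \<delta>(2)[of "fst z"] h(2) by (simp add: \<delta>'_def dist_norm)
      then have f2: "cmod (snd z - b) < r / 2"
        using Wz norm_triangle_ineq4[of "W z" "h (fst z)"] by (simp add: W_def)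
      have "dist (a, b) z \<le> cmod (a - fst z) + cmod (b - snd z)"
        by (cases z) (simp add: dist_norm norm_Pair sqrt_sum_squares_le_sum)
      also have "\<dots> < r" using f1 f2 r by (simp add: \<delta>'_def norm_minus_commute)
      finally show False using that by simp
    qed
    obtain \<eta> where \<eta>: "\<eta> > 0" "\<And>z. z \<in> \<Omega> \<Longrightarrow> \<sigma> z \<ge> s0 \<Longrightarrow> Re (F z) \<ge> \<eta>" using far[OF s0] by blast
    define E where "E = exp (- \<eta>)"
    have e1: "E < 1" using \<eta> by (simp add: E_def)
    have "cmod (f w) < 1 - (1 - E) / 2" if "w \<in> \<Omega> - ball (a, b) r" for w
    proof -
      have "Re (F w) \<ge> \<eta>" using \<eta>(2)[of w] big[of w] that by simp
      then have "cmod (f w) \<le> E" by (simp add: f_def E_def)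
      then show ?thesis using e1 by (simp add: field_simps)
    qed
    then show ?thesis using e1 by (intro exI[of _ "(1 - E) / 2"]) auto
  qed
  ultimately show ?thesis unfolding peak_at_def Let_def \<Omega>_def[symmetric] by blast
qed

section \<open>The model domain\<close>

lemma poly_eq_0_of_infinite_roots:
  fixes p :: "complex poly"
  assumes "infinite X" "\<And>x. x \<in> X \<Longrightarrow> poly p x = 0"
  shows "p = 0"
  using assms poly_roots_finite[of p] finite_subset[of X "{x. poly p x = 0}"] by blast

lemma infinite_unit_circle: "infinite {z :: complex. cmod z = 1}"
proof
  assume fin: "finite {z :: complex. cmod z = 1}"
  define n where "n = card {z :: complex. cmod z = 1} + 1"
  have "cmod z = 1" if "z ^ n = 1" for z :: complex
    using power_eq_1_iff[OF that] by (simp add: n_def)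
  then have "{z :: complex. z ^ n = 1} \<subseteq> {z. cmod z = 1}" by blast
  then have "card {z :: complex. z ^ n = 1} \<le> card {z :: complex. cmod z = 1}" using fin by (rule card_mono[rotated])
  then show False using card_complex_roots_unity[of n] by (simp add: n_def)
qed

text \<open>Two comparisons of coefficients. For fixed \<open>u\<close> both sides of the
  homogeneity relation are polynomials in the real scaling factor, which isolates the part of total
  degree \<open>D\<close>. On the unit circle, with \<open>v = u ^ 2\<close> and
  \<open>cnj u\<close> the inverse of \<open>u\<close>, this part times \<open>u ^ D\<close> is an
  ordinary polynomial in \<open>v\<close>, whose coefficients are the wanted
  \<open>c j l\<close>.\<close>

lemma wpoly_homogeneous_coeff:
  assumes homog: "\<And>(r::real) z. wpoly N c (of_real r * z) = of_real (r ^ n) * wpoly N c z"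
    and jl: "j \<le> N" "l \<le> N" "j + l \<noteq> n"
  shows "c j l = 0"
proof -
  define D where "D = j + l"
  have graded: "(\<Sum>i\<le>N. \<Sum>q\<le>N. if i + q = D then c i q * u ^ i * cnj u ^ q else 0) = 0" for u
  proof -
    define R where "R = (\<Sum>i\<le>N. \<Sum>q\<le>N. monom (c i q * u ^ i * cnj u ^ q) (i + q)) - monom (wpoly N c u) n"
    have "R = 0"
    proof (rule poly_eq_0_of_infinite_roots[of "range complex_of_real"])
      show "infinite (range complex_of_real)"
        using finite_imageD[of complex_of_real UNIV] infinite_UNIV_char_0 inj_of_real by blast
      fix x assume "x \<in> range complex_of_real"
      then obtain r where r: "x = of_real r" by blast
      have "(\<Sum>i\<le>N. \<Sum>q\<le>N. c i q * u ^ i * cnj u ^ q * x ^ (i + q)) = wpoly N c (of_real r * u)"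
        unfolding wpoly_def r by (intro sum.cong refl) (simp add: power_mult_distrib power_add mult_ac)
      then show "poly R x = 0"
        using homog[of r u] by (simp add: R_def poly_sum poly_monom r)
    qed
    then have "coeff R D = 0" by simp
    then show ?thesis using jl(3) by (simp add: R_def D_def coeff_sum)
  qed
  define p where "p = (\<Sum>i\<le>N. \<Sum>q\<le>N. if i + q = D then monom (c i q) i else 0)"
  have "p = 0"
  proof (rule poly_eq_0_of_infinite_roots[OF infinite_unit_circle])
    fix v :: complex assume "v \<in> {z. cmod z = 1}"
    then have v: "cmod v = 1" by simp
    define u where "u = csqrt v"
    have uv: "u ^ 2 = v" by (simp add: u_def)
    have "cmod u ^ 2 = 1" using v by (simp add: uv[symmetric] norm_power[symmetric])
    then have uu: "u * cnj u = 1" by (simp add: complex_norm_square[symmetric])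
    have "poly p v = (\<Sum>i\<le>N. \<Sum>q\<le>N. if i + q = D then c i q * v ^ i else 0)"
      unfolding p_def poly_sum by (intro sum.cong refl) (auto simp: poly_monom)
    also have "\<dots> = (\<Sum>i\<le>N. \<Sum>q\<le>N. u ^ D * (if i + q = D then c i q * u ^ i * cnj u ^ q else 0))"
    proof (intro sum.cong refl)
      fix i q
      show "(if i + q = D then c i q * v ^ i else 0) = u ^ D * (if i + q = D then c i q * u ^ i * cnj u ^ q else 0)"
      proof (cases "i + q = D")
        case True
        have "u ^ D * (u ^ i * cnj u ^ q) = u ^ i * u ^ i * (u * cnj u) ^ q"
          by (simp add: True[symmetric] power_add power_mult_distrib mult_ac)
        also have "\<dots> = v ^ i" by (simp add: uu uv[symmetric] power_mult[symmetric] power_add[symmetric] mult_2)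
        finally show ?thesis using True by (simp add: mult_ac)
      qed simp
    qed
    also have "\<dots> = u ^ D * (\<Sum>i\<le>N. \<Sum>q\<le>N. if i + q = D then c i q * u ^ i * cnj u ^ q else 0)"
      by (simp only: sum_distrib_left)
    also have "\<dots> = 0" by (simp add: graded)
    finally show "poly p v = 0" .
  qed
  then have "coeff p j = 0" by simp
  moreover have "coeff p j = c j l"
  proof -
    have "coeff p j = (\<Sum>i\<le>N. \<Sum>q\<le>N. if i = j \<and> q = l then c i q else 0)"
      unfolding p_def coeff_sum by (intro sum.cong refl) (auto simp: D_def)
    also have "\<dots> = (\<Sum>i\<le>N. if i = j then (\<Sum>q\<le>N. if q = l then c i q else 0) else 0)"
      by (intro sum.cong refl) (auto)
    also have "\<dots> = c j l" using jl by simp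
    finally show ?thesis .
  qed
  ultimately show ?thesis by simp
qed

lemma one_plus_power_le: "(1 + x) ^ e \<le> 2 ^ e * (1 + x ^ e)" if "x \<ge> 0" for x :: real
proof -
  have "(1 + x) ^ e \<le> (2 * max 1 x) ^ e" using that by (intro power_mono) auto
  also have "\<dots> = 2 ^ e * max 1 x ^ e" by (rule power_mult_distrib)
  also have "\<dots> \<le> 2 ^ e * (1 + x ^ e)" using that by (intro mult_left_mono) (auto simp: max_def)
  finally show ?thesis .
qed

text \<open>At \<open>z = a + 1\<close> both error terms of \<open>mixed\<close> are available with
  \<open>cmod (z - a) = 1\<close>; \<open>L a\<close> is the difference of the two quantities that
  they estimate.\<close>

lemma mixed_bound:
  assumes "mixed e \<phi> L"
  obtains C where "C > 0" "\<And>a. \<bar>L a\<bar> \<le> C * (1 + cmod a) ^ e"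
proof -
  obtain C h where C: "C \<ge> 0" and
     h: "\<And>a z. \<bar>\<phi> z - \<phi> a - Re (h a z)\<bar> \<le> C * spread a z ^ e * (cmod (z - a))\<^sup>2"
     "\<And>a z. \<bar>\<phi> z - \<phi> a - Re (h a z) - L a * (cmod (z - a))\<^sup>2\<bar> \<le> C * spread a z ^ e * (cmod (z - a)) ^ 3"
    by (rule mixedE[OF assms]) blast
  have "\<bar>L a\<bar> \<le> (2 * C * 2 ^ e + 1) * (1 + cmod a) ^ e" for a
  proof -
    have "\<bar>L a\<bar> \<le> 2 * (C * (1 + cmod a + 1) ^ e)"
      using h(1)[of "a + 1" a] h(2)[of "a + 1" a] by (simp add: abs_le_iff)
    also have "\<dots> \<le> 2 * (C * (2 * (1 + cmod a)) ^ e)" using C by (intro mult_left_mono power_mono) auto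
    also have "\<dots> = (2 * C * 2 ^ e) * (1 + cmod a) ^ e" by (simp only: power_mult_distrib mult_ac)
    also have "\<dots> \<le> (2 * C * 2 ^ e + 1) * (1 + cmod a) ^ e" by (intro mult_right_mono) auto
    finally show ?thesis .
  qed
  moreover have "2 * C * 2 ^ e + 1 > 0" using C by (intro add_nonneg_pos) auto
  ultimately show ?thesis using that by blast
qed

lemma Re_mult_cnj_self: "Re (u * v * cnj v) = Re u * (cmod v)\<^sup>2"
  unfolding cmod_power2 by (simp add: algebra_simps power2_eq_square)

lemma Re_times_cnj: "Re (v * cnj v) = (cmod v)\<^sup>2"
  using Re_mult_cnj_self[of 1 v] by simp

lemma wpoly_mixed:
  assumes cz: "\<And>j l. j \<le> N \<Longrightarrow> l \<le> N \<Longrightarrow> j + l \<noteq> e + 2 \<Longrightarrow> c j l = 0"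
  shows "mixed e (\<lambda>z. Re (wpoly N c z)) (\<lambda>z. Re (wpoly_ddbar N c z))"
proof -
  have "mixed e (\<lambda>z. Re (c j l * z ^ j * cnj z ^ l)) (\<lambda>z. Re (of_nat (j * l) * c j l * z ^ (j - 1) * cnj z ^ (l - 1)))"
    if "j \<le> N" "l \<le> N" for j l
  proof (cases "j + l = e + 2")
    case True
    have "mixed e (\<lambda>z. Re (poly (monom (c j l) j) z * cnj (poly (monom 1 l) z)))
        (\<lambda>z. Re (poly (pderiv (monom (c j l) j)) z * cnj (poly (pderiv (monom 1 l)) z)))"
      using degree_monom_le[of "c j l" j] degree_monom_le[of "1::complex" l] True
      by (intro mixed_poly) linarith
    then show ?thesis by (simp add: poly_monom pderiv_monom mult_ac)
  next
    case False
    then show ?thesis using cz[OF that False] mixed_zero by simp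
  qed
  then have "mixed e (\<lambda>z. \<Sum>j\<le>N. \<Sum>l\<le>N. Re (c j l * z ^ j * cnj z ^ l))
     (\<lambda>z. \<Sum>j\<le>N. \<Sum>l\<le>N. Re (of_nat (j * l) * c j l * z ^ (j - 1) * cnj z ^ (l - 1)))"
    by (intro mixed_sum) auto
  then show ?thesis by (simp only: wpoly_def wpoly_ddbar_def Re_sum)
qed

lemma wpoly_ddbar_scale:
  assumes cz: "\<And>j l. j \<le> N \<Longrightarrow> l \<le> N \<Longrightarrow> j + l \<noteq> e + 2 \<Longrightarrow> c j l = 0"
  shows "wpoly_ddbar N c (of_real r * z) = of_real (r ^ e) * wpoly_ddbar N c z"
proof -
  have "of_nat (j * l) * c j l * (of_real r * z) ^ (j - 1) * cnj (of_real r * z) ^ (l - 1)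
      = of_real (r ^ e) * (of_nat (j * l) * c j l * z ^ (j - 1) * cnj z ^ (l - 1))" if "j \<le> N" "l \<le> N" for j l
  \<comment> \<open>The truncated exponents \<open>j - 1\<close> and \<open>l - 1\<close> add up to
    \<open>e\<close> only for positive \<open>j\<close> and \<open>l\<close>; otherwise the factor
    \<open>j * l\<close> removes the term.\<close>
  proof (cases "j + l = e + 2 \<and> j \<ge> 1 \<and> l \<ge> 1")
    case True
    then have "r ^ e = r ^ (j - 1) * r ^ (l - 1)" by (simp add: power_add[symmetric])
    then show ?thesis by (simp add: power_mult_distrib mult_ac)
  next
    case False
    then have "of_nat (j * l) * c j l = 0" using cz[OF that] by (cases "j = 0"; cases "l = 0") auto
    then show ?thesis by (metis mult_zero_left mult_zero_right)
  qed
  then show ?thesis unfolding wpoly_ddbar_def sum_distrib_left by (intro sum.cong refl) auto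
qed

lemma wpoly_norm_bound:
  assumes cz: "\<And>j l. j \<le> N \<Longrightarrow> l \<le> N \<Longrightarrow> j + l \<noteq> n \<Longrightarrow> c j l = 0"
  shows "cmod (wpoly N c z) \<le> (\<Sum>j\<le>N. \<Sum>l\<le>N. cmod (c j l)) * cmod z ^ n"
proof -
  have "cmod (wpoly N c z) \<le> (\<Sum>j\<le>N. \<Sum>l\<le>N. cmod (c j l * z ^ j * cnj z ^ l))"
    unfolding wpoly_def by (intro order_trans[OF norm_sum] sum_mono order_refl)
  also have "\<dots> = (\<Sum>j\<le>N. \<Sum>l\<le>N. cmod (c j l) * cmod z ^ n)"
  proof (intro sum.cong refl)
    fix j l assume "j \<in> {..N}" "l \<in> {..N}"
    then show "cmod (c j l * z ^ j * cnj z ^ l) = cmod (c j l) * cmod z ^ n"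
      using cz[of j l] by (cases "j + l = n") (auto simp: norm_mult norm_power power_add)
  qed
  finally show ?thesis by (simp only: sum_distrib_right)
qed

text \<open>This lets the squared modulus added to the weight at the origin be absorbed by half of
  the subtracted power, up to an additive constant.\<close>

lemma norm_square_le_power:
  assumes "k > (1::nat)" "x \<ge> (0::real)"
  shows "x\<^sup>2 \<le> x ^ (2 * k) / 2 + 4"
proof (cases "x \<le> 2")
  case True
  then have "x\<^sup>2 \<le> 2\<^sup>2" using assms by (intro power_mono) auto
  moreover have "0 \<le> x ^ (2 * k) / 2" using assms by simp
  ultimately have "0 + x\<^sup>2 \<le> x ^ (2 * k) / 2 + 2\<^sup>2" by (intro add_mono)
  then show ?thesis by simp
next
  case False
  have "x\<^sup>2 * x\<^sup>2 = x ^ 4" by (simp add: power_add[symmetric])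
  also have "\<dots> \<le> x ^ (2 * k)" using assms False by (intro power_increasing) auto
  finally have "x\<^sup>2 * x\<^sup>2 \<le> x ^ (2 * k)" .
  moreover have "2 * x\<^sup>2 \<le> x\<^sup>2 * x\<^sup>2"
  proof -
    have "2\<^sup>2 \<le> x\<^sup>2" using False by (intro power_mono) auto
    then show ?thesis by (intro mult_right_mono) auto
  qed
  ultimately have "2 * x\<^sup>2 \<le> x ^ (2 * k)" by (rule order_trans[rotated])
  then show ?thesis by (simp add: field_simps)
qed

section \<open>Peak functions over the origin and over other points\<close>

text \<open>Subtracting \<open>\<epsilon> * cmod z ^ (2 * k)\<close> uses half of the available
  \<open>L\<close>, and the added \<open>\<epsilon> * (cmod z)\<^sup>2\<close> restores positivity
  at 0. By \<open>norm_square_le_power\<close> the addition costs the factor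
  \<open>exp (t0 * (4 * \<epsilon>))\<close>, a constant for the single \<open>t0\<close> used here.
  Homogeneity of \<open>P\<close> lets \<open>h = 0\<close> serve in
  \<open>peak_from_family\<close>.\<close>

lemma peak_zero:
  fixes P L :: "complex \<Rightarrow> real"
  assumes k: "k > 1" and mx: "mixed (2 * k - 2) P L" and cP: "continuous_on UNIV P" and \<mu>: "\<mu> > 0"
    and L: "\<And>z. L z \<ge> \<mu> * cmod z ^ (2 * k - 2)"
    and hom: "\<And>(r::real) z. P (of_real r * z) = r ^ (2 * k) * P z"
    and PC: "\<And>z. \<bar>P z\<bar> \<le> C0 * cmod z ^ (2 * k)" and b: "Re b + P 0 = 0"
  shows "peak_at P (0, b)"
proof -
  define e where "e = 2 * k - 2"
  \<comment> \<open>The mixed derivative of \<open>cmod z ^ (2 * k)\<close> is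
    \<open>(real k)\<^sup>2 * cmod z ^ (2 * k - 2)\<close>; hence the square of \<open>k\<close>,
    and the 2 that leaves half of \<open>L\<close>.\<close>
  define \<epsilon> where "\<epsilon> = \<mu> / (2 * (real k)\<^sup>2)"
  have \<epsilon>: "\<epsilon> > 0" "\<epsilon> * (real k)\<^sup>2 = \<mu> / 2" using \<mu> k by (auto simp: \<epsilon>_def)
  define \<psi> where "\<psi> = (\<lambda>z. P z + (- \<epsilon>) * cmod z ^ (2 * k) + \<epsilon> * (cmod z)\<^sup>2)"
  define M where "M = (\<lambda>z. L z + (- \<epsilon>) * ((real k)\<^sup>2 * cmod z ^ e) + \<epsilon> * 1)"
  have "mixed e (\<lambda>z. P z + (- \<epsilon>) * Re (poly (monom 1 k) z * cnj (poly (monom 1 k) z)) + \<epsilon> * Re (poly [:0, 1:] z * cnj (poly [:0, 1:] z)))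
    (\<lambda>z. L z + (- \<epsilon>) * Re (poly (pderiv (monom 1 k)) z * cnj (poly (pderiv (monom 1 k)) z)) + \<epsilon> * Re (poly (pderiv [:0, 1:]) z * cnj (poly (pderiv [:0, 1:]) z)))"
    using k by (intro mixed_add mixed_scale mixed_poly mx[folded e_def]) (auto simp: degree_monom_eq e_def)
  moreover have "Re (poly (monom 1 k) z * cnj (poly (monom 1 k) z)) = cmod z ^ (2 * k)" for z
    unfolding Re_times_cnj by (simp add: poly_monom norm_power power_mult[symmetric] mult.commute)
  moreover have "Re (poly (pderiv (monom 1 k)) z * cnj (poly (pderiv (monom 1 k)) z)) = (real k)\<^sup>2 * cmod z ^ e" for z
  proof -
    have "(cmod z ^ (k - 1))\<^sup>2 = cmod z ^ e" unfolding power_mult[symmetric] e_def by (rule arg_cong[where f = "power (cmod z)"]) simp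
    then show ?thesis
      unfolding Re_times_cnj by (simp add: poly_monom pderiv_monom norm_power norm_mult power_mult_distrib)
  qed
  moreover have "Re (poly [:0, 1:] z * cnj (poly [:0, 1:] z)) = (cmod z)\<^sup>2" for z
    unfolding Re_times_cnj by simp
  moreover have "Re (poly (pderiv [:0, 1:]) z * cnj (poly (pderiv [:0, 1:]) z)) = 1" for z
    unfolding Re_times_cnj by (simp add: pderiv_pCons)
  ultimately have mx\<psi>: "mixed e \<psi> M" unfolding \<psi>_def M_def by simp
  have c\<psi>: "continuous_on UNIV \<psi>" unfolding \<psi>_def by (intro continuous_intros cP)
  define m0 where "m0 = min (\<mu> / 2) \<epsilon> / 2 ^ e"
  have m0: "m0 > 0" using \<mu> \<epsilon> by (simp add: m0_def)
  have "M z \<ge> m0 * (1 + cmod z) ^ e" for z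
  proof -
    have "m0 * (1 + cmod z) ^ e \<le> m0 * (2 ^ e * (1 + cmod z ^ e))"
      using m0 by (intro mult_left_mono one_plus_power_le) auto
    also have "\<dots> = min (\<mu> / 2) \<epsilon> * 1 + min (\<mu> / 2) \<epsilon> * cmod z ^ e" by (simp add: m0_def distrib_left)
    also have "\<dots> \<le> \<epsilon> * 1 + \<mu> / 2 * cmod z ^ e" by (intro add_mono mult_right_mono) auto
    also have "\<dots> \<le> M z"
    proof -
      have "\<epsilon> * ((real k)\<^sup>2 * cmod z ^ e) = \<mu> / 2 * cmod z ^ e" using \<epsilon>(2) by (simp only: mult.assoc[symmetric])
      moreover have "M z = L z - \<epsilon> * ((real k)\<^sup>2 * cmod z ^ e) + \<epsilon>" by (simp add: M_def)
      ultimately have "M z = L z - \<mu> / 2 * cmod z ^ e + \<epsilon>" by (simp only:)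
      moreover have "\<mu> * cmod z ^ e = \<mu> / 2 * cmod z ^ e + \<mu> / 2 * cmod z ^ e"
        by (simp only: distrib_right[symmetric] field_sum_of_halves)
      ultimately show ?thesis using L[of z, folded e_def] by linarith
    qed
    finally show ?thesis .
  qed
  from kernel_bound_mixed[OF mx\<psi> c\<psi> m0 this]
  obtain T where T: "T > 0" "\<And>t. t \<ge> T \<Longrightarrow> kernel_bound UNIV (\<lambda>z. t * \<psi> z) 4" by blast
  define t0 where "t0 = max 1 T"
  have t0: "t0 \<ge> 1" "t0 \<ge> T" by (auto simp: t0_def)
  have "P 0 = 0 ^ (2 * k) * P 0" using hom[of 0 0] by (simp only: mult_zero_right of_real_0)
  then have P0: "P 0 = 0" using k by (simp only: power_0_left) simp
  have \<psi>0: "\<psi> 0 = 0" using P0 k by (simp add: \<psi>_def)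
  obtain g where g: "g holomorphic_on UNIV" "g 0 = 1" "\<And>z. cmod (g z) \<le> 4 * exp (t0 * \<psi> z - t0 * \<psi> 0)"
    using T(2)[OF t0(2)] unfolding kernel_bound_def by blast
  define A where "A = 4 * exp (t0 * (4 * \<epsilon>))"
  have A: "A \<ge> 1"
  proof -
    have "exp (t0 * (4 * \<epsilon>)) \<ge> 1" using t0 \<epsilon> by simp
    then show ?thesis unfolding A_def by linarith
  qed
  have gA: "cmod (g z) \<le> A * exp (t0 * (P z - \<epsilon> / 2 * cmod z ^ (2 * k)))" for z
  proof -
    have "\<epsilon> * (cmod z)\<^sup>2 \<le> \<epsilon> * (cmod z ^ (2 * k) / 2 + 4)"
      using norm_square_le_power[OF k, of "cmod z"] \<epsilon> by (intro mult_left_mono) auto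
    then have "\<psi> z \<le> 4 * \<epsilon> + (P z - \<epsilon> / 2 * cmod z ^ (2 * k))" by (simp add: \<psi>_def algebra_simps)
    then have "t0 * \<psi> z \<le> t0 * (4 * \<epsilon> + (P z - \<epsilon> / 2 * cmod z ^ (2 * k)))" using t0 by (intro mult_left_mono) auto
    then have "exp (t0 * \<psi> z) \<le> exp (t0 * (4 * \<epsilon>) + t0 * (P z - \<epsilon> / 2 * cmod z ^ (2 * k)))"
      by (simp add: distrib_left)
    then have "exp (t0 * \<psi> z) \<le> exp (t0 * (4 * \<epsilon>)) * exp (t0 * (P z - \<epsilon> / 2 * cmod z ^ (2 * k)))"
      by (simp only: exp_add)
    then show ?thesis using g(3)[of z] unfolding A_def \<psi>0 by (simp add: mult.assoc)
  qed
  \<comment> \<open>Dilation by \<open>q n\<close> multiplies both \<open>P\<close> and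
    \<open>cmod z ^ (2 * k)\<close> by \<open>2 ^ n\<close>, which turns the bound at scale
    \<open>t0\<close> into the one at scale \<open>t0 * 2 ^ n\<close> with the same constant
    \<open>A\<close>.\<close>
  define q where "q = (\<lambda>n::nat. root (2 * k) (2 ^ n))"
  have k2: "0 < 2 * k" using k by simp
  have q: "q n ^ (2 * k) = 2 ^ n" "q n > 0" for n
    unfolding q_def by (rule real_root_pow_pos2[OF k2], simp, rule real_root_gt_zero[OF k2], simp)
  define C where "C = max (max 1 A) C0"
  define c where "c = min 1 (\<epsilon> / 2)"
  have C: "C \<ge> 1" "C \<ge> A" "C \<ge> C0" by (auto simp: C_def)
  have c: "c > 0" "c \<le> 1" "c \<le> \<epsilon> / 2" using \<epsilon> by (auto simp: c_def)
  show ?thesis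
  proof (rule peak_from_family[where ?t0.0 = t0 and C = C and c = c and m = "2 * k" and h = "\<lambda>z. 0"
        and d = "\<lambda>z. cmod z ^ (2 * k)" and g = "\<lambda>n z. g (of_real (q n) * z)"])
    show "\<bar>P z - P 0 - Re 0\<bar> \<le> C * cmod z ^ (2 * k)" for z
      using order_trans[OF PC[of z] mult_right_mono[OF C(3), of "cmod z ^ (2 * k)"]] P0 by simp
    show "c * cmod (z - 0) ^ (2 * k) \<le> cmod z ^ (2 * k)" for z
      using c mult_right_mono[of c 1 "cmod z ^ (2 * k)"] by simp
    show "cmod z ^ (2 * k) \<le> C * cmod (z - 0) ^ (2 * k)" for z
      using C mult_right_mono[of 1 C "cmod z ^ (2 * k)"] by simp
    show "(\<lambda>z. g (of_real (q n) * z)) holomorphic_on UNIV" for n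
      by (rule holomorphic_on_compose_gen[of "\<lambda>z. of_real (q n) * z" UNIV g UNIV, unfolded o_def])
         (auto intro!: holomorphic_intros g)
    fix n z
    have "P (of_real (q n) * z) = 2 ^ n * P z" using hom[of "q n" z] q(1)[of n] by (simp only:)
    moreover have "cmod (of_real (q n) * z) = q n * cmod z" using q(2)[of n] by (simp add: norm_mult)
    then have "cmod (of_real (q n) * z) ^ (2 * k) = 2 ^ n * cmod z ^ (2 * k)"
      using q(1)[of n] by (simp only: power_mult_distrib)
    ultimately have "cmod (g (of_real (q n) * z)) \<le> A * exp (t0 * (2 ^ n * P z - \<epsilon> / 2 * (2 ^ n * cmod z ^ (2 * k))))"
      using gA[of "of_real (q n) * z"] by (simp only:)
    also have "t0 * (2 ^ n * P z - \<epsilon> / 2 * (2 ^ n * cmod z ^ (2 * k))) = t0 * 2 ^ n * (P z - \<epsilon> / 2 * cmod z ^ (2 * k))"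
      by (simp add: algebra_simps)
    also have "A * exp \<dots> \<le> C * exp (t0 * 2 ^ n * (P z - P 0 - c * cmod z ^ (2 * k)))"
    proof (rule mult_mono[OF C(2)])
      have "c * cmod z ^ (2 * k) \<le> \<epsilon> / 2 * cmod z ^ (2 * k)" using c by (intro mult_right_mono) auto
      then have "t0 * 2 ^ n * (P z - \<epsilon> / 2 * cmod z ^ (2 * k)) \<le> t0 * 2 ^ n * (P z - P 0 - c * cmod z ^ (2 * k))"
        using t0 P0 by (intro mult_left_mono) auto
      then show "exp (t0 * 2 ^ n * (P z - \<epsilon> / 2 * cmod z ^ (2 * k))) \<le> exp (t0 * 2 ^ n * (P z - P 0 - c * cmod z ^ (2 * k)))" by simp
    qed (use C in auto)
    finally show "cmod (g (of_real (q n) * z)) \<le> C * exp (t0 * 2 ^ n * (P z - P 0 - c * cmod z ^ (2 * k)))" .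
  qed (use cP b t0 C c k g in auto)
qed

lemma norm_power_pred_square: "(cmod z ^ (k - 1))\<^sup>2 = cmod z ^ (2 * k - 2)"
  unfolding power_mult[symmetric] by (rule arg_cong[where f = "power (cmod z)"]) simp

text \<open>The Levi form of \<open>P\<close> degenerates at \<open>0\<close>. The factor \<open>(1 + Re (z / a))\<^sup>2\<close> makes the weight
  superharmonic near \<open>0\<close>, so that subtracting a multiple of it from \<open>P\<close> removes this degeneracy.\<close>
lemma bump_weight:
  fixes a :: complex
  assumes k: "k > 1" and a: "a \<noteq> 0" and \<eta>: "\<eta> = 1 / (8 * (1 + (cmod a)\<^sup>2))"
  obtains M where "mixed (2 * k - 2) (\<lambda>z. (cmod (z - a))\<^sup>2 * ((1 + Re (z / a))\<^sup>2 + \<eta> + \<eta> * cmod z ^ (2 * k - 2))) M"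
    "isCont M 0" "M 0 \<le> - 3 / 8"
proof -
  define D where "D = 1 / a"
  define y v w where "y = [:0, D:]" and "v = [:-1, D:]" and "w = monom 1 (k - 1) * [:-a, 1:]"
  have dv: "degree v \<le> 1" and dy: "degree y \<le> 1" by (simp_all add: v_def y_def)
  have dyv: "degree (y * v) \<le> 2" using degree_mult_le[of y v] dv dy by linarith
  have dyyv: "degree (y * y * v) \<le> 3" using degree_mult_le[of "y * y" v] degree_mult_le[of y y] dv dy by linarith
  have dw: "degree w \<le> k"
  proof -
    have "degree (monom 1 (k - 1) :: complex poly) \<le> k - 1" "degree [:-a, 1:] \<le> 1"
      by (simp_all add: degree_monom_le)
    then show ?thesis using degree_mult_le[of "monom 1 (k - 1)" "[:-a, 1:]"] k unfolding w_def by linarith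
  qed
  define R where "R = (\<lambda>p q z. Re (poly p z * cnj (poly q z)))"
  define S where "S = (\<lambda>p q z. R (pderiv p) (pderiv q) z)"
  \<comment> \<open>With \<open>Y = z / a\<close>, the square of \<open>1 + Re Y\<close> is
    \<open>1 + 2 * Re Y\<close> plus half of \<open>(cmod Y)\<^sup>2\<close> plus half of
    \<open>Re (Y * Y)\<close>. Multiplied by the squared modulus of \<open>v\<close>, each summand
    becomes the real part of a polynomial times a conjugate polynomial, as \<open>mixed_poly\<close>
    requires.\<close>
  define Q where "Q = (\<lambda>z. (cmod a)\<^sup>2 * ((1 + \<eta>) * R v v z + 2 * R (y * v) v z + 1/2 * R (y * v) (y * v) z
      + 1/2 * R (y * y * v) v z) + \<eta> * R w w z)"
  define M where "M = (\<lambda>z. (cmod a)\<^sup>2 * ((1 + \<eta>) * S v v z + 2 * S (y * v) v z + 1/2 * S (y * v) (y * v) z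
      + 1/2 * S (y * y * v) v z) + \<eta> * S w w z)"
  have mp: "mixed (2 * k - 2) (R p q) (S p q)" if "degree p + degree q \<le> 4 \<or> degree p + degree q \<le> 2 * k" for p q
    unfolding R_def S_def using that k by (intro mixed_poly) auto
  have mQ: "mixed (2 * k - 2) Q M"
    unfolding Q_def M_def
    by (intro mixed_add mixed_scale mp) (use dv dyv dyyv dw in linarith)+
  have Qeq: "Q = (\<lambda>z. (cmod (z - a))\<^sup>2 * ((1 + Re (z / a))\<^sup>2 + \<eta> + \<eta> * cmod z ^ (2 * k - 2)))"
  proof
    fix z
    define Y V where "Y = z / a" and "V = z / a - 1"
    have py: "poly y z = Y" and pv: "poly v z = V" by (simp_all add: y_def v_def Y_def V_def D_def)
    have "z - a = a * V" using a by (simp add: V_def field_simps)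
    then have za: "(cmod (z - a))\<^sup>2 = (cmod a)\<^sup>2 * (cmod V)\<^sup>2" by (simp add: norm_mult power_mult_distrib)
    have r1: "R v v z = (cmod V)\<^sup>2" by (simp only: R_def pv Re_times_cnj)
    have r2: "R (y * v) v z = Re Y * (cmod V)\<^sup>2" by (simp only: R_def pv py poly_mult Re_mult_cnj_self)
    have r3: "R (y * v) (y * v) z = (cmod Y)\<^sup>2 * (cmod V)\<^sup>2"
      by (simp only: R_def pv py poly_mult Re_times_cnj norm_mult power_mult_distrib)
    have r4: "R (y * y * v) v z = Re (Y * Y) * (cmod V)\<^sup>2" by (simp only: R_def pv py poly_mult Re_mult_cnj_self)
    have "poly w z = z ^ (k - 1) * (z - a)" by (simp add: w_def poly_monom algebra_simps)
    then have r5: "R w w z = cmod z ^ (2 * k - 2) * (cmod (z - a))\<^sup>2"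
      by (simp only: R_def Re_times_cnj norm_mult power_mult_distrib norm_power norm_power_pred_square)
    have sq: "(1 + Re Y)\<^sup>2 = 1 + 2 * Re Y + 1/2 * (cmod Y)\<^sup>2 + 1/2 * Re (Y * Y)"
      unfolding cmod_power2 by (simp add: power2_eq_square algebra_simps)
    have "Q z = (cmod a)\<^sup>2 * (cmod V)\<^sup>2 * (1 + \<eta> + 2 * Re Y + 1/2 * (cmod Y)\<^sup>2 + 1/2 * Re (Y * Y)) + \<eta> * (cmod z ^ (2 * k - 2) * (cmod (z - a))\<^sup>2)"
      unfolding Q_def r1 r2 r3 r4 r5 by (simp only: distrib_left distrib_right mult_ac)
    also have "\<dots> = (cmod (z - a))\<^sup>2 * ((1 + Re Y)\<^sup>2 + \<eta> + \<eta> * cmod z ^ (2 * k - 2))"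
      unfolding sq za by (simp only: distrib_left distrib_right mult_ac add_ac)
    finally show "Q z = (cmod (z - a))\<^sup>2 * ((1 + Re (z / a))\<^sup>2 + \<eta> + \<eta> * cmod z ^ (2 * k - 2))"
      by (simp only: Y_def)
  qed
  have cont: "continuous_on UNIV M" unfolding M_def S_def R_def by (intro continuous_intros)
  have cM: "isCont M 0" using cont by (simp add: continuous_on_eq_continuous_at)
  have M0: "M 0 \<le> - 3 / 8"
  proof -
    have p1: "poly (pderiv v) 0 = D" by (simp add: v_def pderiv_pCons)
    have p2: "poly (pderiv (y * v)) 0 = - D" by (simp add: v_def y_def pderiv_mult pderiv_pCons)
    have p3: "poly (pderiv (y * y * v)) 0 = 0" by (simp add: v_def y_def pderiv_mult pderiv_pCons)
    have pw: "poly (pderiv w) 0 = poly (monom 1 (k - 1)) 0 * poly (pderiv [:-a, 1:]) 0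
        + poly [:-a, 1:] 0 * poly (pderiv (monom 1 (k - 1))) 0"
      by (simp only: w_def pderiv_mult poly_add poly_mult)
    have p4: "cmod (poly (pderiv w) 0) \<le> cmod a"
    proof (cases "k = 2")
      case True
      then show ?thesis unfolding pw by (simp add: pderiv_pCons pderiv_monom poly_monom)
    next
      case False
      then have "k - 1 > 0" "k - 1 - 1 > 0" using k by auto
      then show ?thesis unfolding pw by (simp add: pderiv_pCons pderiv_monom poly_monom power_0_left)
    qed
    have aD: "(cmod a)\<^sup>2 * (cmod D)\<^sup>2 = 1"
      using a by (simp add: D_def norm_divide power_divide)
    have s1: "S v v 0 = (cmod D)\<^sup>2" by (simp only: S_def R_def p1 Re_times_cnj)
    have s2: "S (y * v) v 0 = - (cmod D)\<^sup>2" by (simp only: S_def R_def p1 p2 mult_minus_left uminus_complex.sel Re_times_cnj)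
    have s3: "S (y * v) (y * v) 0 = (cmod D)\<^sup>2" by (simp only: S_def R_def p2 Re_times_cnj norm_minus_cancel)
    have s4: "S (y * y * v) v 0 = 0" by (simp only: S_def R_def p3 mult_zero_left zero_complex.sel)
    have s5: "S w w 0 \<le> (cmod a)\<^sup>2"
      unfolding S_def R_def Re_times_cnj by (rule power_mono[OF p4]) simp
    have \<eta>0: "\<eta> > 0" "\<eta> * (1 + (cmod a)\<^sup>2) = 1 / 8"
    proof -
      have pos: "1 + (cmod a)\<^sup>2 > 0" by (simp add: add_pos_nonneg)
      then show "\<eta> > 0" unfolding \<eta> by simp
      show "\<eta> * (1 + (cmod a)\<^sup>2) = 1 / 8" unfolding \<eta> using pos by (simp add: divide_simps)
    qed
    \<comment> \<open>The bracket of \<open>M\<close> at 0 is \<open>(1 + \<eta> - 2 + 1/2)\<close>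
      times \<open>(cmod D)\<^sup>2\<close>; the cross term supplies the -2. Together with the
      contribution of \<open>w\<close>, \<open>\<eta>\<close> adds at most 1/8 to -1/2.\<close>
    have "M 0 = ((cmod a)\<^sup>2 * (cmod D)\<^sup>2) * (\<eta> - 1/2) + \<eta> * S w w 0"
      unfolding M_def s1 s2 s3 s4 by (simp add: algebra_simps)
    also have "\<dots> \<le> (\<eta> - 1/2) + \<eta> * (cmod a)\<^sup>2" using s5 \<eta>0 by (simp add: aD mult_left_mono)
    also have "\<dots> = - 3 / 8" using \<eta>0(2) by (simp add: algebra_simps)
    finally show ?thesis .
  qed
  show ?thesis by (rule that[OF mQ[unfolded Qeq] cM M0])
qed

text \<open>The weight \<open>P - \<epsilon> * Q\<close> has mixed derivative
  \<open>L - \<epsilon> * M\<close>. Near 0, where \<open>L\<close> may vanish,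
  \<open>- \<epsilon> * M\<close> is positive; elsewhere \<open>L\<close> dominates
  \<open>\<epsilon> * M\<close> for small \<open>\<epsilon>\<close>. The resulting bound holds for
  all large \<open>t\<close>, so it is applied at every scale \<open>t0 * 2 ^ n\<close> directly,
  with \<open>Q\<close> vanishing to order 2 at \<open>a\<close>.\<close>

lemma peak_nonzero:
  fixes P L :: "complex \<Rightarrow> real"
  assumes k: "k > 1" and mx: "mixed (2 * k - 2) P L" and cP: "continuous_on UNIV P" and \<mu>: "\<mu> > 0"
    and L: "\<And>z. L z \<ge> \<mu> * cmod z ^ (2 * k - 2)" and a: "a \<noteq> 0" and ab: "Re b + P a = 0"
  shows "peak_at P (a, b)"
proof -
  define e where "e = 2 * k - 2"
  define \<eta> where "\<eta> = 1 / (8 * (1 + (cmod a)\<^sup>2))"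
  have \<eta>: "\<eta> > 0" unfolding \<eta>_def by (simp add: add_pos_nonneg)
  \<comment> \<open>The square vanishes on the line \<open>Re (z / a) = -1\<close>; the terms with
    \<open>\<eta>\<close> keep \<open>U\<close> positive there and make it grow at least like
    \<open>cmod z ^ e\<close>, as the comparison of \<open>P - P a - Re h\<close> with
    \<open>Q\<close> requires.\<close>
  define U where "U = (\<lambda>z. (1 + Re (z / a))\<^sup>2 + \<eta> + \<eta> * cmod z ^ e)"
  define Q where "Q = (\<lambda>z. (cmod (z - a))\<^sup>2 * U z)"
  obtain M where M: "mixed e Q M" "isCont M 0" "M 0 \<le> - 3 / 8"
    unfolding Q_def U_def e_def by (rule bump_weight[OF k a \<eta>_def])
  have Uge: "U z \<ge> \<eta> * (1 + cmod z ^ e)" for z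
    unfolding U_def distrib_left using zero_le_power2[of "1 + Re (z / a)"] by simp
  have U0: "U z \<ge> \<eta>" for z
  proof -
    have "\<eta> * 1 \<le> \<eta> * (1 + cmod z ^ e)" using \<eta> by (intro mult_left_mono) auto
    then show ?thesis using Uge[of z] by linarith
  qed
  obtain \<delta> where \<delta>: "\<delta> > 0" "\<And>z. cmod z < \<delta> \<Longrightarrow> M z < - 1 / 4"
  proof -
    obtain s where s: "s > 0" "\<And>x. dist x 0 < s \<Longrightarrow> dist (M x) (M 0) < 1 / 8"
      using M(2) unfolding continuous_at_eps_delta by (metis zero_less_divide_1_iff zero_less_numeral)
    have "M z < - 1 / 4" if "cmod z < s" for z
    proof -
      have "\<bar>M z - M 0\<bar> < 1 / 8" using s(2)[of z] that by (simp only: dist_real_def dist_0_norm dist_norm diff_zero)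
      then show ?thesis using M(3) by linarith
    qed
    then show ?thesis using that s(1) by blast
  qed
  obtain CM where CM: "CM > 0" "\<And>z. \<bar>M z\<bar> \<le> CM * (1 + cmod z) ^ e" by (rule mixed_bound[OF M(1)]) blast
  \<comment> \<open>Outside the disc of radius \<open>\<delta>\<close>, \<open>cmod z\<close> is at
    least \<open>\<nu> * (1 + cmod z)\<close>, which converts the homogeneous lower bound of
    \<open>L\<close> into one by a power of \<open>1 + cmod z\<close>.\<close>
  define \<nu> where "\<nu> = \<delta> / (1 + \<delta>)"
  have \<nu>: "\<nu> > 0" using \<delta> by (simp add: \<nu>_def)
  define \<mu>' where "\<mu>' = \<mu> * \<nu> ^ e"
  have \<mu>': "\<mu>' > 0" using \<mu> \<nu> by (simp add: \<mu>'_def)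
  define \<epsilon> where "\<epsilon> = \<mu>' / (2 * CM)"
  have \<epsilon>: "\<epsilon> > 0" "\<epsilon> * CM = \<mu>' / 2" using \<mu>' CM by (auto simp: \<epsilon>_def)
  \<comment> \<open>The first entry is what \<open>L\<close> keeps away from 0 after
    \<open>\<epsilon> * M\<close> has taken half of it; the second spreads the gain
    \<open>\<epsilon> / 4\<close> over the disc, where \<open>1 + cmod z\<close> is below
    \<open>1 + \<delta>\<close>.\<close>
  define m0 where "m0 = min (\<mu>' / 2) (\<epsilon> / 4 / (1 + \<delta>) ^ e)"
  have m0: "m0 > 0" using \<mu>' \<epsilon> \<delta> by (simp add: m0_def)
  define \<psi> where "\<psi> = (\<lambda>z. P z + (- \<epsilon>) * Q z)"
  have cU: "continuous_on X U" for X unfolding U_def using a by (intro continuous_intros) auto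
  have c\<psi>: "continuous_on UNIV \<psi>"
    unfolding \<psi>_def Q_def by (intro continuous_intros cP cU)
  have mx\<psi>: "mixed e \<psi> (\<lambda>z. L z + (- \<epsilon>) * M z)"
    unfolding \<psi>_def by (intro mixed_add mixed_scale M mx[folded e_def])
  have low: "L z + (- \<epsilon>) * M z \<ge> m0 * (1 + cmod z) ^ e" for z
  proof (cases "cmod z < \<delta>")
    case True
    have "(1 + cmod z) ^ e \<le> (1 + \<delta>) ^ e" using True by (intro power_mono) auto
    then have "m0 * (1 + cmod z) ^ e \<le> (\<epsilon> / 4 / (1 + \<delta>) ^ e) * (1 + \<delta>) ^ e"
      using m0 \<epsilon> \<delta> by (intro mult_mono) (auto simp: m0_def)
    also have "\<dots> = \<epsilon> * (1 / 4)" using \<delta>(1) by simp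
    also have "\<dots> \<le> \<epsilon> * (- M z)" using \<epsilon> \<delta>(2)[OF True] by (intro mult_left_mono) auto
    also have "\<dots> \<le> L z + (- \<epsilon>) * M z"
    proof -
      have "0 \<le> \<mu> * cmod z ^ (2 * k - 2)" using \<mu> by simp
      then have "0 \<le> L z" using L[of z] by (rule order_trans)
      then show ?thesis by simp
    qed
    finally show ?thesis .
  next
    case False
    have "\<nu> * (1 + cmod z) \<le> cmod z"
      using False \<delta> unfolding \<nu>_def by (simp add: divide_simps) (simp add: algebra_simps)
    then have "(\<nu> * (1 + cmod z)) ^ e \<le> cmod z ^ e" using \<nu> by (intro power_mono) auto
    then have "\<mu> * (\<nu> ^ e * (1 + cmod z) ^ e) \<le> \<mu> * cmod z ^ e" using \<mu> by (intro mult_left_mono) (auto simp: power_mult_distrib)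
    then have l1: "\<mu>' * (1 + cmod z) ^ e \<le> L z" using L[of z, folded e_def] by (simp add: \<mu>'_def mult.assoc)
    have "\<epsilon> * M z \<le> \<epsilon> * (CM * (1 + cmod z) ^ e)" using CM(2)[of z] \<epsilon> by (intro mult_left_mono) auto
    also have "\<dots> = \<mu>' / 2 * (1 + cmod z) ^ e" unfolding \<epsilon>(2)[symmetric] by (rule mult.assoc[symmetric])
    finally have l2: "\<epsilon> * M z \<le> \<mu>' / 2 * (1 + cmod z) ^ e" .
    have l3: "m0 * (1 + cmod z) ^ e \<le> \<mu>' / 2 * (1 + cmod z) ^ e" by (intro mult_right_mono) (auto simp: m0_def)
    have "\<mu>' * (1 + cmod z) ^ e = \<mu>' / 2 * (1 + cmod z) ^ e + \<mu>' / 2 * (1 + cmod z) ^ e"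
      by (simp only: distrib_right[symmetric] field_sum_of_halves)
    then show ?thesis using l1 l2 l3 by (simp only: mult_minus_left)
  qed
  obtain T where T: "T > 0" "\<And>t. t \<ge> T \<Longrightarrow> kernel_bound UNIV (\<lambda>z. t * \<psi> z) 4"
    using kernel_bound_mixed[OF mx\<psi> c\<psi> m0 low] by blast
  define t0 where "t0 = max 1 T"
  have t0: "t0 \<ge> 1" "t0 \<ge> T" by (auto simp: t0_def)
  have Qa: "Q a = 0" by (simp add: Q_def)
  have "\<exists>g. g holomorphic_on UNIV \<and> g a = 1 \<and> (\<forall>z. cmod (g z) \<le> 4 * exp (t0 * 2 ^ n * (P z - P a - \<epsilon> * Q z)))" for n :: nat
  proof -
    have "t0 * 1 \<le> t0 * 2 ^ n" using t0 by (intro mult_left_mono) auto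
    then have "t0 \<le> t0 * 2 ^ n" by (simp only: mult_1_right)
    then have "kernel_bound UNIV (\<lambda>z. t0 * 2 ^ n * \<psi> z) 4" by (intro T(2) order_trans[OF t0(2)])
    then have "\<exists>g. g holomorphic_on UNIV \<and> g a = 1 \<and>
        (\<forall>z\<in>UNIV. cmod (g z) \<le> 4 * exp (t0 * 2 ^ n * \<psi> z - t0 * 2 ^ n * \<psi> a))"
      unfolding kernel_bound_def by blast
    moreover have "t0 * 2 ^ n * \<psi> z - t0 * 2 ^ n * \<psi> a = t0 * 2 ^ n * (P z - P a - \<epsilon> * Q z)" for z
      unfolding \<psi>_def Qa by (simp add: algebra_simps)
    ultimately show ?thesis by (simp only: ball_UNIV)
  qed
  then have "\<forall>n. \<exists>g. g holomorphic_on UNIV \<and> g a = 1 \<and> (\<forall>z. cmod (g z) \<le> 4 * exp (t0 * 2 ^ n * (P z - P a - \<epsilon> * Q z)))" by blast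
  from choice[OF this] obtain g where g: "\<And>n. g n holomorphic_on UNIV" "\<And>n. g n a = 1"
    "\<And>n z. cmod (g n z) \<le> 4 * exp (t0 * 2 ^ n * (P z - P a - \<epsilon> * Q z))" by blast
  obtain C1 h where C1: "C1 \<ge> 0" and h: "\<And>a. h a holomorphic_on UNIV" "\<And>a. h a a = 0"
     "\<And>a z. \<bar>P z - P a - Re (h a z)\<bar> \<le> C1 * spread a z ^ e * (cmod (z - a))\<^sup>2"
    by (rule mixedE[OF mx[folded e_def]]) blast
  \<comment> \<open>Collects the losses in comparing \<open>spread a z ^ e\<close> with
    \<open>U z / \<eta>\<close>: \<open>spread a z\<close> is at most
    \<open>(1 + 2 * cmod a) * (1 + cmod z)\<close>, and \<open>2 ^ e\<close> comes from
    \<open>one_plus_power_le\<close>.\<close>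
  define K where "K = C1 * (1 + 2 * cmod a) ^ e * 2 ^ e / \<eta>"
  have K: "\<bar>P z - P a - Re (h a z)\<bar> \<le> K * Q z" for z
  proof -
    have "1 + cmod a + cmod (z - a) \<le> (1 + 2 * cmod a) * (1 + cmod z)"
    proof -
      have "cmod (z - a) \<le> cmod z + cmod a" by (rule norm_triangle_ineq4)
      moreover have "0 \<le> 2 * cmod a * cmod z" by simp
      moreover have "(1 + 2 * cmod a) * (1 + cmod z) = 1 + cmod z + 2 * cmod a + 2 * cmod a * cmod z" by (simp add: algebra_simps)
      ultimately show ?thesis by (smt (verit))
    qed
    then have "spread a z ^ e \<le> ((1 + 2 * cmod a) * (1 + cmod z)) ^ e" by (intro power_mono) auto
    also have "\<dots> = (1 + 2 * cmod a) ^ e * (1 + cmod z) ^ e" by (rule power_mult_distrib)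
    also have "\<dots> \<le> (1 + 2 * cmod a) ^ e * (2 ^ e * (1 + cmod z ^ e))"
      by (intro mult_left_mono one_plus_power_le) auto
    finally have "C1 * spread a z ^ e * (cmod (z - a))\<^sup>2
       \<le> C1 * ((1 + 2 * cmod a) ^ e * (2 ^ e * (1 + cmod z ^ e))) * (cmod (z - a))\<^sup>2"
      using C1 by (intro mult_right_mono mult_left_mono) auto
    also have "\<dots> = K * ((cmod (z - a))\<^sup>2 * (\<eta> * (1 + cmod z ^ e)))" using \<eta> by (simp add: K_def)
    also have "\<dots> \<le> K * Q z"
    proof -
      have "K \<ge> 0" using C1 \<eta> by (simp add: K_def)
      then show ?thesis unfolding Q_def by (intro mult_left_mono Uge) auto
    qed
    finally show ?thesis using h(3)[of z a] by linarith
  qed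
  obtain B where B: "\<And>z. z \<in> cball a 1 \<Longrightarrow> U z \<le> B"
  proof -
    have "compact (U ` cball a 1)" by (intro compact_continuous_image cU) auto
    from compact_imp_bounded[OF this] obtain B where "\<forall>x\<in>U ` cball a 1. norm x \<le> B" by (auto simp: bounded_iff)
    then show ?thesis by (intro that[of B]) (auto simp: abs_le_iff)
  qed
  define C where "C = max (max 4 K) B"
  have C: "C \<ge> 4" "C \<ge> K" "C \<ge> B" by (auto simp: C_def)
  define c where "c = min \<epsilon> \<eta>"
  have c: "c > 0" "c \<le> \<epsilon>" "c \<le> \<eta>" using \<epsilon> \<eta> by (auto simp: c_def)
  have Q0: "Q z \<ge> 0" for z using U0[of z] \<eta> by (simp add: Q_def)
  show ?thesis
  proof (rule peak_from_family[OF cP ab t0(1), where C = C and c = c and m = 2 and h = "h a" and d = Q and g = g])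
    show "\<bar>P z - P a - Re (h a z)\<bar> \<le> C * Q z" for z
      using order_trans[OF K[of z] mult_right_mono[OF C(2) Q0[of z]]] .
    show "c * (cmod (z - a))\<^sup>2 \<le> Q z" for z
      using mult_right_mono[OF order_trans[OF c(3) U0[of z]], of "(cmod (z - a))\<^sup>2"] by (simp add: Q_def mult.commute)
    show "Q z \<le> C * (cmod (z - a))\<^sup>2" if "cmod (z - a) \<le> 1" for z
    proof -
      have "U z \<le> C" using B[of z] that C(3) by (simp add: dist_norm norm_minus_commute)
      then show ?thesis unfolding Q_def by (simp add: mult.commute mult_right_mono)
    qed
    fix n z
    have "c * Q z \<le> \<epsilon> * Q z" using c Q0 by (intro mult_right_mono) auto
    then have "t0 * 2 ^ n * (P z - P a - \<epsilon> * Q z) \<le> t0 * 2 ^ n * (P z - P a - c * Q z)"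
      using t0 by (intro mult_left_mono) auto
    then have "4 * exp (t0 * 2 ^ n * (P z - P a - \<epsilon> * Q z)) \<le> C * exp (t0 * 2 ^ n * (P z - P a - c * Q z))"
      using C by (intro mult_mono) auto
    then show "cmod (g n z) \<le> C * exp (t0 * 2 ^ n * (P z - P a - c * Q z))" using g(3)[of n z] by linarith
  qed (use C c h g in auto)
qed

theorem theorem3p1:
  fixes N k :: nat and c :: "nat \<Rightarrow> nat \<Rightarrow> complex"
  assumes "k > 1"
    and real_valued: "\<forall>z. Im (wpoly N c z) = 0"
    and homog: "\<forall>(r::real) z. wpoly N c (of_real r * z) = of_real (r ^ (2 * k)) * wpoly N c z"
    and subharm: "\<forall>z. z \<noteq> 0 \<longrightarrow> wpoly_ddbar N c z \<in> \<real> \<and> Re (wpoly_ddbar N c z) > 0"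
  shows "\<forall>p\<in>frontier (model_domain N c).
           \<exists>f. holomorphic2_on f (model_domain N c)
             \<and> f ` model_domain N c \<subseteq> ball 0 1
             \<and> (f \<longlongrightarrow> 1) (at p within model_domain N c)
             \<and> (\<forall>r>0. \<exists>s>0. \<forall>w\<in>model_domain N c - ball p r. cmod (f w) < 1 - s)"
proof
  fix p assume p: "p \<in> frontier (model_domain N c)"
  obtain a b where ab: "p = (a, b)" by (cases p)
  define P where "P = (\<lambda>z. Re (wpoly N c z))"
  define L where "L = (\<lambda>z. Re (wpoly_ddbar N c z))"
  define e where "e = 2 * k - 2"
  have e: "e + 2 = 2 * k" "e > 0" using \<open>k > 1\<close> by (auto simp: e_def)
  \<comment> \<open>Homogeneity is given for the function. Passing to the coefficients makes it
    available for the termwise mixed derivative, and bounds all degrees at once.\<close>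
  have cz: "c j l = 0" if "j \<le> N" "l \<le> N" "j + l \<noteq> 2 * k" for j l
    using wpoly_homogeneous_coeff[OF homog[rule_format] that] .
  have mx: "mixed (2 * k - 2) P L"
    unfolding P_def L_def e_def[symmetric] by (rule wpoly_mixed) (use cz e in auto)
  have cP: "continuous_on UNIV P" unfolding P_def wpoly_def by (intro continuous_intros)
  have Lsc: "L (of_real r * z) = r ^ e * L z" for r z
    unfolding L_def using wpoly_ddbar_scale[of N e c r z] cz e by (simp del: of_real_power)
  \<comment> \<open>Positivity becomes quantitative by compactness of the unit circle; the
    homogeneity \<open>Lsc\<close> of degree \<open>e\<close> then spreads the bound over the plane,
    with both sides 0 at the origin.\<close>
  obtain \<mu> where \<mu>: "\<mu> > 0" "\<And>z. cmod z = 1 \<Longrightarrow> \<mu> \<le> L z"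
  proof -
    have "continuous_on (sphere 0 1) L" unfolding L_def wpoly_ddbar_def by (intro continuous_intros)
    moreover have "compact (sphere (0::complex) 1)" "sphere (0::complex) 1 \<noteq> {}" by auto
    ultimately obtain u where u: "u \<in> sphere 0 1" "\<And>z. z \<in> sphere 0 1 \<Longrightarrow> L u \<le> L z"
      using continuous_attains_inf[of "sphere (0::complex) 1" L] by blast
    have "u \<noteq> 0" using u(1) by auto
    then have "L u > 0" using subharm by (simp add: L_def)
    then show ?thesis using that[of "L u"] u(2) by simp
  qed
  have L: "L z \<ge> \<mu> * cmod z ^ (2 * k - 2)" for z
  proof (cases "z = 0")
    case True
    have "L 0 = 0" using Lsc[of 0 0] e(2) by (simp add: power_0_left)
    then show ?thesis using True e by (simp add: e_def[symmetric] power_0_left)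
  next
    case False
    have "L z = L (of_real (cmod z) * (z / of_real (cmod z)))" using False by simp
    also have "\<dots> = cmod z ^ e * L (z / of_real (cmod z))" by (rule Lsc)
    also have "\<dots> \<ge> cmod z ^ e * \<mu>" using False by (intro mult_left_mono \<mu>(2)) (auto simp: norm_divide)
    finally show ?thesis by (simp add: e_def mult.commute)
  qed
  have hom: "P (of_real r * z) = r ^ (2 * k) * P z" for r z
    unfolding P_def using homog[rule_format, of r z] by (simp del: of_real_power)
  have PC: "\<bar>P z\<bar> \<le> (\<Sum>j\<le>N. \<Sum>l\<le>N. cmod (c j l)) * cmod z ^ (2 * k)" for z
    unfolding P_def by (rule order_trans[OF abs_Re_le_cmod wpoly_norm_bound]) (use cz in auto)
  have dom: "model_domain N c = {z. Re (snd z) + P (fst z) < 0}"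
    by (auto simp: model_domain_def P_def)
  have cR: "continuous_on UNIV (\<lambda>z :: complex \<times> complex. Re (snd z) + P (fst z))"
    by (intro continuous_intros continuous_on_compose2[OF cP]) auto
  have bd: "Re b + P a = 0"
  proof -
    have "open (model_domain N c)" unfolding dom by (intro open_Collect_less continuous_on_const cR)
    then have "p \<notin> model_domain N c" using p by (simp add: frontier_def interior_open)
    moreover have "closure (model_domain N c) \<subseteq> {z. Re (snd z) + P (fst z) \<le> 0}"
      by (rule closure_minimal) (auto simp: dom intro!: closed_Collect_le continuous_on_const cR)
    then have "p \<in> {z. Re (snd z) + P (fst z) \<le> 0}" using p by (auto simp: frontier_def)
    ultimately show ?thesis by (simp add: dom ab)
  qed
  have "peak_at P p"
  proof (cases "a = 0")
    case True
    then show ?thesis using peak_zero[OF \<open>k > 1\<close> mx cP \<mu>(1) L hom PC] bd ab by simp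
  next
    case False
    then show ?thesis using peak_nonzero[OF \<open>k > 1\<close> mx cP \<mu>(1) L False bd] ab by simp
  qed
  then obtain f where f: "\<And>z. z \<in> model_domain N c \<Longrightarrow> cdiff f z" "f ` model_domain N c \<subseteq> ball 0 1"
    "(f \<longlongrightarrow> 1) (at p within model_domain N c)"
    "\<forall>r>0. \<exists>s>0. \<forall>w\<in>model_domain N c - ball p r. cmod (f w) < 1 - s"
    unfolding peak_at_def Let_def dom[symmetric] by blast
  have "holomorphic2_on f (model_domain N c)"
    unfolding holomorphic2_on_def using f(1) unfolding cdiff_def by (meson has_derivative_at_withinI)
  then show "\<exists>f. holomorphic2_on f (model_domain N c)
             \<and> f ` model_domain N c \<subseteq> ball 0 1
             \<and> (f \<longlongrightarrow> 1) (at p within model_domain N c)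
             \<and> (\<forall>r>0. \<exists>s>0. \<forall>w\<in>model_domain N c - ball p r. cmod (f w) < 1 - s)"
    using f(2-4) by blast
qed

end
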